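(* Let $k$ be a field and let $A_0 \xrightarrow{\phi_0} A_1 \xrightarrow{\phi_1} A_2 \to \cdots$ be a sequence of surjective homomorphisms of finitely generated $k$-algebras (respectively, of completed finitely generated $k$-algebras). Suppose that the algebras $A_n$ are equipped with presentations $A_n = k\langle X_n \mid R_n\rangle$ and degree functions $\deg : X_n \to \mathbb{R}_{>0}$ such that, for each $n$, the presentations and degree functions of $A_n$ and $A_{n+1}$ are compatible with respect to $\phi_n$, and such that each $A_n$ is weak Golod--Shafarevich with respect to its given presentation and degree function. Then the direct limit $$A = \lim_{n\to\infty} A_n$$ is weak Golod--Shafarevich with respect to the induced degree function, that is, the degree function on the generating set $\lim_n X_n$ (the image of $X_0$ in $A$) under which the image of each generator $x \in X_n$ has degree $\deg x$. Moreover, if all but finitely many of the algebras $A_n$ are Golod--Shafarevich with respect to these presentations and degree functions, then $A$ has exponential growth.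
   Context: **Presentations.** $X$ is a finite generating set and $F$ is the free associative algebra $k\langle \widetilde X\rangle$ (respectively, in the completed case, the algebra $k\langle\langle \widetilde X\rangle\rangle$ of noncommutative formal power series) on formal variables $\widetilde X$ in bijection with $X$. $A = k\langle X\mid R\rangle$ means that $A$ is the quotient of $F$ by the two-sided ideal generated by $R\subset F$ (respectively, by the closed two-sided ideal), the variable $\widetilde x$ mapping to $x$. Relations have zero constant term. **Degrees.** A degree function is a map $\deg: X\to\mathbb{R}_{>0}$. A monomial in the generators has degree equal to the sum of the degrees of its letters. A nonzero element of $F$ has degree equal to the minimum of the degrees of the monomials occurring in it with nonzero coefficient, and $\deg 0=+\infty$. The set $R$ of relations is discrete: for each $\alpha$ it has only finitely many elements of degree $\le\alpha$. **The series $f_A$.** For a discrete set $S$ put $H_S(z)=\sum_{s\in S} z^{\deg s}$ (a zero element contributes $0$). For $A = k\langle X\mid R\rangle$ put $f_A(z)=1-H_X(z)+H_R(z)$. **Golod--Shafarevich property.** $A$ is Golod--Shafarevich (respectively, weak Golod--Shafarevich) with respect to the presentation and degree function if there is a real $z_0\in[0,1]$ such that $f_A(z_0)$ converges and $f_A(z_0)<0$ (respectively, $f_A(z_0)\le 0$). Saying that the limit algebra is weak Golod--Shafarevich with respect to a degree function on a generating set means that it is so for some presentation with that generating set and a discrete set of relations. **Compatibility.** Let $\phi:A\to B$ be a surjection, $A = k\langle X\mid R\rangle$, $B=k\langle Y\mid S\rangle$ with degree functions on $X$ and $Y$. These data are compatible if $Y=\phi(X)$, $\deg\phi(x)=\deg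 x$ for all $x\in X$, and $\widetilde\phi(R)\subset S$, where $\widetilde\phi$ is the homomorphism of (completed) free algebras on $X$ and $Y$ sending the variable of $x$ to the variable of $\phi(x)$ (zero elements of $\widetilde\phi(R)$ being disregarded). **Direct limit.** In the completed case the direct limit is taken among completed algebras, i.e. one takes the quotient of the completed free algebra by the closure of the union of the ideals of relations. **Growth.** $A$, generated (topologically, in the completed case) by a finite set $X$, has exponential growth if $\limsup_{n\to\infty} h_n^{1/n}>1$, where $h_n$ is the dimension of the linear span in $A$ of all products of at most $n$ elements of $X$.
   Formalization: For completed algebras, the weak Golod–Shafarevich conclusion assumes that the induced degree function on the image of X_0 is well defined; this can fail, since generators of different degrees may become equal in the limit. *)

theory Defs
  imports "HOL-Analysis.Analysis" "HOL-Algebra.QuotRing" "Jordan_Normal_Form.VS_Connect"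
begin

section \<open>Associative algebras over a field\<close>

text \<open>The library locale \<^locale>\<open>algebra\<close> requires the multiplication to be commutative.\<close>

definition kalgebra :: "('k::field, 'a) module \<Rightarrow> bool" where
  "kalgebra A \<longleftrightarrow> ring A \<and> vectorspace class_ring A \<and>
     (\<forall>c. \<forall>x\<in>carrier A. \<forall>y\<in>carrier A.
        (c \<odot>\<^bsub>A\<^esub> x) \<otimes>\<^bsub>A\<^esub> y = c \<odot>\<^bsub>A\<^esub> (x \<otimes>\<^bsub>A\<^esub> y) \<and>
        x \<otimes>\<^bsub>A\<^esub> (c \<odot>\<^bsub>A\<^esub> y) = c \<odot>\<^bsub>A\<^esub> (x \<otimes>\<^bsub>A\<^esub> y))"

definition alg_hom :: "('k::field, 'a) module \<Rightarrow> ('k, 'b) module \<Rightarrow> ('a \<Rightarrow> 'b) set" where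
  "alg_hom A B = {h \<in> Ring.ring_hom A B. \<forall>c. \<forall>x\<in>carrier A. h (c \<odot>\<^bsub>A\<^esub> x) = c \<odot>\<^bsub>B\<^esub> h x}"


section \<open>Free algebras and presentations\<close>

text \<open>A noncommutative polynomial or power series is represented by its coefficient function on
  words. The flag \<open>completed\<close> selects the power series algebra (\<open>True\<close>) or the free algebra
  (\<open>False\<close>). When \<open>X\<close> is a subset of an algebra, its elements themselves serve as the formal
  variables.\<close>

definition free_algebra :: "bool \<Rightarrow> 'x set \<Rightarrow> ('k::field, 'x list \<Rightarrow> 'k) module" where
  "free_algebra completed X =
    \<lparr>carrier = {f. {w. f w \<noteq> 0} \<subseteq> lists X \<and> (completed \<or> finite {w. f w \<noteq> 0})},
     mult = (\<lambda>f g w. \<Sum>i\<le>length w. f (take i w) * g (drop i w)),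
     one = (\<lambda>w. if w = [] then 1 else 0),
     zero = (\<lambda>w. 0),
     add = (\<lambda>f g w. f w + g w),
     smult = (\<lambda>c f w. c * f w)\<rparr>"

definition var :: "'x \<Rightarrow> 'x list \<Rightarrow> 'k::field" where
  "var x = (\<lambda>w. if w = [x] then 1 else 0)"

text \<open>The topology of coefficientwise convergence, coefficients being discrete. For finite \<open>X\<close>
  it is the topology defined by the powers of the ideal generated by the variables, and also the
  one defined by any positive degree function.\<close>

definition coeff_topology :: "'x set \<Rightarrow> ('x list \<Rightarrow> 'k::field) topology" where
  "coeff_topology X =
     subtopology (product_topology (\<lambda>w. discrete_topology UNIV) UNIV)
       (carrier (free_algebra True X))"

definition relation_ideal :: "bool \<Rightarrow> 'x set \<Rightarrow> ('x list \<Rightarrow> 'k::field) set \<Rightarrow> ('x list \<Rightarrow> 'k) set" where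
  "relation_ideal completed X R =
     (if completed
      then \<Inter>{I. ideal I (free_algebra True X) \<and> closedin (coeff_topology X) I \<and> R \<subseteq> I}
      else Idl\<^bsub>free_algebra False X\<^esub> R)"

text \<open>\<open>A\<close> is the quotient of the (completed) free algebra on \<open>X\<close> by the (closed) ideal generated
  by \<open>R\<close>, with quotient map \<open>\<pi>\<close>.\<close>

definition presentation ::
  "bool \<Rightarrow> ('k::field, 'a) module \<Rightarrow> 'a set \<Rightarrow> ('a list \<Rightarrow> 'k) set \<Rightarrow> (('a list \<Rightarrow> 'k) \<Rightarrow> 'a) \<Rightarrow> bool"
where
  "presentation completed A X R \<pi> \<longleftrightarrow>
     finite X \<and> X \<subseteq> carrier A \<and>
     R \<subseteq> carrier (free_algebra completed X) \<and> (\<forall>r\<in>R. r [] = 0) \<and>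
     \<pi> \<in> alg_hom (free_algebra completed X) A \<and>
     \<pi> ` carrier (free_algebra completed X) = carrier A \<and>
     (\<forall>x\<in>X. \<pi> (var x) = x) \<and>
     a_kernel (free_algebra completed X) A \<pi> = relation_ideal completed X R"


section \<open>Degrees and the Golod--Shafarevich property\<close>

text \<open>The infimum below is \<open>\<infinity>\<close> for the zero series and otherwise, if \<open>d\<close> is positive on the
  finite set of letters involved, a minimum.\<close>

definition series_degree :: "('x \<Rightarrow> real) \<Rightarrow> ('x list \<Rightarrow> 'k::field) \<Rightarrow> ereal" where
  "series_degree d f = (INF w\<in>{w. f w \<noteq> 0}. ereal (sum_list (map d w)))"

definition discrete_set :: "('x \<Rightarrow> real) \<Rightarrow> ('x list \<Rightarrow> 'k::field) set \<Rightarrow> bool" where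
  "discrete_set d S \<longleftrightarrow> (\<forall>\<alpha>::real. finite {s \<in> S. series_degree d s \<le> ereal \<alpha>})"

text \<open>A zero relation contributes \<open>0\<close>, also at \<open>z = 1\<close>.\<close>

definition degree_power :: "real \<Rightarrow> ereal \<Rightarrow> real" where
  "degree_power z a = (if a = \<infinity> then 0 else z powr real_of_ereal a)"

definition gs_series :: "'x set \<Rightarrow> ('x \<Rightarrow> real) \<Rightarrow> ('x list \<Rightarrow> 'k::field) set \<Rightarrow> real \<Rightarrow> real" where
  "gs_series X d R z =
     1 - (\<Sum>x\<in>X. z powr d x) + (\<Sum>\<^sub>\<infinity>r\<in>R. degree_power z (series_degree d r))"

definition gs_converges :: "('x \<Rightarrow> real) \<Rightarrow> ('x list \<Rightarrow> 'k::field) set \<Rightarrow> real \<Rightarrow> bool" where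
  "gs_converges d R z \<longleftrightarrow> (\<lambda>r. degree_power z (series_degree d r)) summable_on R"

definition golod_shafarevich :: "'x set \<Rightarrow> ('x \<Rightarrow> real) \<Rightarrow> ('x list \<Rightarrow> 'k::field) set \<Rightarrow> bool" where
  "golod_shafarevich X d R \<longleftrightarrow> (\<exists>z\<in>{0..1}. gs_converges d R z \<and> gs_series X d R z < 0)"

definition weak_golod_shafarevich :: "'x set \<Rightarrow> ('x \<Rightarrow> real) \<Rightarrow> ('x list \<Rightarrow> 'k::field) set \<Rightarrow> bool" where
  "weak_golod_shafarevich X d R \<longleftrightarrow> (\<exists>z\<in>{0..1}. gs_converges d R z \<and> gs_series X d R z \<le> 0)"

text \<open>A presentation together with a positive degree function for which the relations are discrete.\<close>

definition graded_presentation ::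
  "bool \<Rightarrow> ('k::field, 'a) module \<Rightarrow> 'a set \<Rightarrow> ('a \<Rightarrow> real) \<Rightarrow> ('a list \<Rightarrow> 'k) set
    \<Rightarrow> (('a list \<Rightarrow> 'k) \<Rightarrow> 'a) \<Rightarrow> bool"
where
  "graded_presentation completed A X d R \<pi> \<longleftrightarrow>
     presentation completed A X R \<pi> \<and> (\<forall>x\<in>X. 0 < d x) \<and> discrete_set d R"

definition weak_golod_shafarevich_wrt ::
  "bool \<Rightarrow> ('k::field, 'a) module \<Rightarrow> 'a set \<Rightarrow> ('a \<Rightarrow> real) \<Rightarrow> bool"
where
  "weak_golod_shafarevich_wrt completed A X d \<longleftrightarrow>
     (\<exists>R \<pi>. graded_presentation completed A X d R \<pi> \<and> weak_golod_shafarevich X d R)"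


section \<open>Compatibility and direct limits\<close>

text \<open>The homomorphism of (completed) free algebras sending the variable of \<open>x\<close> to the variable
  of \<open>\<phi> x\<close>: the coefficient at \<open>w\<close> collects the coefficients of all words mapped letterwise
  to \<open>w\<close>. For finite \<open>X\<close> these are finitely many.\<close>

definition free_map :: "('x \<Rightarrow> 'y) \<Rightarrow> 'x set \<Rightarrow> ('x list \<Rightarrow> 'k::field) \<Rightarrow> 'y list \<Rightarrow> 'k" where
  "free_map \<phi> X f = (\<lambda>w. \<Sum>u\<in>{u \<in> lists X. map \<phi> u = w}. f u)"

definition compatible ::
  "('a \<Rightarrow> 'b) \<Rightarrow> 'a set \<Rightarrow> ('a \<Rightarrow> real) \<Rightarrow> ('a list \<Rightarrow> 'k::field) set
    \<Rightarrow> 'b set \<Rightarrow> ('b \<Rightarrow> real) \<Rightarrow> ('b list \<Rightarrow> 'k) set \<Rightarrow> bool"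
where
  "compatible \<phi> X d R Y e S \<longleftrightarrow>
     Y = \<phi> ` X \<and> (\<forall>x\<in>X. e (\<phi> x) = d x) \<and> free_map \<phi> X ` R - {\<lambda>w. 0} \<subseteq> S"

text \<open>\<open>transition \<phi> n k\<close> is the composite map from stage \<open>n\<close> to stage \<open>n + k\<close>.\<close>

primrec transition :: "(nat \<Rightarrow> 'a \<Rightarrow> 'a) \<Rightarrow> nat \<Rightarrow> nat \<Rightarrow> 'a \<Rightarrow> 'a" where
  "transition \<phi> n 0 = id"
| "transition \<phi> n (Suc k) = \<phi> (n + k) \<circ> transition \<phi> n k"

definition alg_cocone ::
  "(nat \<Rightarrow> ('k::field, 'a) module) \<Rightarrow> (nat \<Rightarrow> 'a \<Rightarrow> 'a) \<Rightarrow> ('k, 'b) module \<Rightarrow> (nat \<Rightarrow> 'a \<Rightarrow> 'b) \<Rightarrow> bool"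
where
  "alg_cocone A \<phi> L \<psi> \<longleftrightarrow> kalgebra L \<and> (\<forall>n. \<psi> n \<in> alg_hom (A n) L) \<and>
     (\<forall>n. \<forall>a\<in>carrier (A n). \<psi> (Suc n) (\<phi> n a) = \<psi> n a)"

text \<open>\<open>L\<close> is, up to isomorphism, the disjoint union of the \<open>A n\<close> modulo eventual equality.\<close>

definition direct_limit ::
  "(nat \<Rightarrow> ('k::field, 'a) module) \<Rightarrow> (nat \<Rightarrow> 'a \<Rightarrow> 'a) \<Rightarrow> ('k, 'b) module \<Rightarrow> (nat \<Rightarrow> 'a \<Rightarrow> 'b) \<Rightarrow> bool"
where
  "direct_limit A \<phi> L \<psi> \<longleftrightarrow> alg_cocone A \<phi> L \<psi> \<and>
     carrier L = (\<Union>n. \<psi> n ` carrier (A n)) \<and>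
     (\<forall>n. \<forall>a\<in>carrier (A n). \<forall>b\<in>carrier (A n).
        \<psi> n a = \<psi> n b \<longrightarrow> (\<exists>k. transition \<phi> n k a = transition \<phi> n k b))"

text \<open>\<open>L\<close> is, up to isomorphism, the quotient of the completed free algebra on \<open>X 0\<close> by the closure
  of the union over \<open>n\<close> of the kernels of its maps onto the \<open>A n\<close>; here \<open>\<pi> 0\<close> is the quotient map
  onto \<open>A 0\<close>.\<close>

definition completed_direct_limit ::
  "(nat \<Rightarrow> ('k::field, 'a) module) \<Rightarrow> (nat \<Rightarrow> 'a \<Rightarrow> 'a) \<Rightarrow> (nat \<Rightarrow> 'a set)
    \<Rightarrow> (nat \<Rightarrow> ('a list \<Rightarrow> 'k) \<Rightarrow> 'a) \<Rightarrow> ('k, 'b) module \<Rightarrow> (nat \<Rightarrow> 'a \<Rightarrow> 'b) \<Rightarrow> bool"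
where
  "completed_direct_limit A \<phi> X \<pi> L \<psi> \<longleftrightarrow> alg_cocone A \<phi> L \<psi> \<and>
     carrier L = \<psi> 0 ` carrier (A 0) \<and>
     a_kernel (free_algebra True (X 0)) L (\<psi> 0 \<circ> \<pi> 0) =
       coeff_topology (X 0) closure_of
         (\<Union>n. a_kernel (free_algebra True (X 0)) (A n) (transition \<phi> 0 n \<circ> \<pi> 0))"


section \<open>Growth\<close>

definition short_products :: "('k::field, 'a) module \<Rightarrow> 'a set \<Rightarrow> nat \<Rightarrow> 'a set" where
  "short_products A X n =
     {foldr (mult A) w \<one>\<^bsub>A\<^esub> |w. w \<in> lists X \<and> length w \<le> n}"

definition growth :: "('k::field, 'a) module \<Rightarrow> 'a set \<Rightarrow> nat \<Rightarrow> nat" where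
  "growth A X n =
     vectorspace.dim class_ring (A\<lparr>carrier := LinearCombinations.module.span class_ring A (short_products A X n)\<rparr>)"

definition exponential_growth :: "('k::field, 'a) module \<Rightarrow> 'a set \<Rightarrow> bool" where
  "exponential_growth A X \<longleftrightarrow> limsup (\<lambda>n. ereal (root n (real (growth A X n)))) > 1"

end

(*
The limit is treated on the letters X_N of a stage N after which no two letters are identified
any more: the relations of the later stages, pulled back to X_N, form an increasing sequence whose
union S presents the limit. Homomorphisms out of completed free algebras are automatically
continuous, so this also holds in the completed case.

The parameters z in [0,1] with f(z) <= 0 for the n-th stage form nested nonempty compact sets, and a
common element z works for S. If z = 1, then S is finite, hence already the set of relations of a
single stage, and a strict inequality at that stage moves z below 1.

In the completed case the closure may still identify two letters x and y. Then some relation s0 has a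
nonzero coefficient at x, hence degree at most that of x; by a Nakayama argument x and s0 can be
dropped together, which does not increase f(z).

For exponential growth, let a(t) be the codimension of the relations modulo words of weight at
least t. The Golod-Shafarevich inequality
  a(t) + (SUM s. a(t - deg s)) >= 1 + (SUM x. a(t - deg x))
multiplied by z^t and integrated shows that the integral of a(t) z^t diverges if f(z) <= 0. As z < 1,
this is impossible when a(t), a lower bound of the growth function, grows subexponentially.
*)

theory Submission
  imports Defs "HOL-Library.Function_Algebras" "HOL-Computational_Algebra.Formal_Power_Series"
begin


section \<open>Convolution of coefficient functions and ideals spanned by words\<close>

text \<open>Degrees are arbitrary positive reals and relations are not homogeneous, so no graded
  Hilbert series is at hand. This is why dimensions are counted modulo words of high weight and why
  integrals against z^t replace power series. The same count makes the completed and the ordinary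
  case alike: below a given weight there are finitely many words, and there a closed ideal cannot be
  told from a dense part of it. The condition f(z) <= 0 is encoded as a bound on all finite partial
  sums. Each of these is a closed condition on z and passes to increasing unions, which the nested
  compact sets rely on. A strict inequality may be lost in the limit. What survives, the weak one at
  some z < 1, still forces divergence, because the constant 1 in the inequality contributes a
  positive amount to the integral. Working on the letters of one late stage avoids merging letters:
  a merge lowers the sum over the generators, which is the wrong direction for f(z) <= 0. Where the
  closure imposes a merge nevertheless, it has to be paid for by a relation.\<close>

global_interpretation fv: vector_space "\<lambda>(c::'k::field) (f::'x list \<Rightarrow> 'k) w. c * f w"
  by standard (auto simp: fun_eq_iff algebra_simps)

text \<open>Linearity is demanded on all functions on words, with no carrier: convolution,
  truncation and change of letters are total, so spans and dimensions live in one ambient space for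
  every set of letters and for both kinds of free algebra.\<close>

definition lin :: "(('x list \<Rightarrow> 'k::field) \<Rightarrow> 'y list \<Rightarrow> 'k) \<Rightarrow> bool" where
  "lin T \<longleftrightarrow> (\<forall>f g. T (f + g) = T f + T g) \<and> (\<forall>c f. T (\<lambda>w. c * f w) = (\<lambda>w. c * T f w))"

lemma linD:
  assumes "lin T"
  shows "T (f + g) = T f + T g" "T (\<lambda>w. c * f w) = (\<lambda>w. c * T f w)" "T 0 = 0" "T (f - g) = T f - T g"
proof -
  show add: "T (f + g) = T f + T g" for f g using assms by (simp add: lin_def)
  show "T (\<lambda>w. c * f w) = (\<lambda>w. c * T f w)" using assms by (simp add: lin_def)
  show "T 0 = 0" using add[of 0 0] by simp
  show "T (f - g) = T f - T g" using add[of "f - g" g] by simp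
qed

lemma subspace_lin_preimage:
  assumes "lin T" "fv.subspace V"
  shows "fv.subspace {f. T f \<in> V}"
  using assms(2) linD[OF assms(1)] by (auto simp: fv.subspace_def)

lemma subspace_lin_image:
  assumes "lin T" "fv.subspace V"
  shows "fv.subspace (T ` V)"
  unfolding fv.subspace_def
proof (intro conjI ballI allI)
  show "0 \<in> T ` V" using fv.subspace_0[OF assms(2)] linD(3)[OF assms(1)] by force
  show "f + g \<in> T ` V" if fg: "f \<in> T ` V" "g \<in> T ` V" for f g
  proof -
    obtain f' g' where *: "f = T f'" "g = T g'" "f' \<in> V" "g' \<in> V" using fg by auto
    show ?thesis
      by (rule image_eqI[of _ _ "f' + g'"]) (simp_all add: * linD(1)[OF assms(1)] fv.subspace_add[OF assms(2)])
  qed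
  show "(\<lambda>w. c * f w) \<in> T ` V" if f: "f \<in> T ` V" for f c
  proof -
    obtain f' where *: "f = T f'" "f' \<in> V" using f by auto
    show ?thesis
      by (rule image_eqI[of _ _ "\<lambda>w. c * f' w"]) (simp_all add: * linD(2)[OF assms(1)] fv.subspace_scale[OF assms(2)])
  qed
qed

lemma lin_span:
  assumes "lin T" "f \<in> fv.span B" "\<And>b. b \<in> B \<Longrightarrow> T b \<in> V" "fv.subspace V"
  shows "T f \<in> V"
proof -
  have "fv.span B \<subseteq> {f. T f \<in> V}"
    by (rule fv.span_minimal[OF _ subspace_lin_preimage[OF assms(1,4)]]) (use assms(3) in auto)
  thus ?thesis using assms(2) by auto
qed

lemma lin_sum: "lin T \<Longrightarrow> T (\<Sum>i\<in>I. f i) = (\<Sum>i\<in>I. T (f i))"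
  by (induction I rule: infinite_finite_induct) (simp_all add: linD(1,3) del: plus_fun_apply zero_fun_apply)

lemma sum_fun_apply: "(\<Sum>i\<in>I. f i) x = (\<Sum>i\<in>I. (f i x :: 'b::comm_monoid_add))"
  by (induction I rule: infinite_finite_induct) auto

section \<open>The convolution product on coefficient functions\<close>

definition wmon :: "'x list \<Rightarrow> 'x list \<Rightarrow> 'k::field" where
  "wmon u = (\<lambda>w. if w = u then 1 else 0)"

definition conv :: "('x list \<Rightarrow> 'k::field) \<Rightarrow> ('x list \<Rightarrow> 'k) \<Rightarrow> 'x list \<Rightarrow> 'k" where
  "conv f g = (\<lambda>w. \<Sum>i\<le>length w. f (take i w) * g (drop i w))"

lemma var_eq_wmon: "var x = wmon [x]"
  by (simp add: var_def wmon_def)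

lemma conv_add_left: "conv (f + g) h = conv f h + conv g h"
  by (simp add: conv_def fun_eq_iff distrib_right sum.distrib)

lemma conv_add_right: "conv h (f + g) = conv h f + conv h g"
  by (simp add: conv_def fun_eq_iff distrib_left sum.distrib)

lemma conv_scale_left: "conv (\<lambda>w. c * f w) h = (\<lambda>w. c * conv f h w)"
  by (simp add: conv_def fun_eq_iff sum_distrib_left mult.assoc)

lemma conv_scale_right: "conv h (\<lambda>w. c * f w) = (\<lambda>w. c * conv h f w)"
  by (simp add: conv_def fun_eq_iff sum_distrib_left mult.left_commute)

lemma lin_conv_left: "lin (\<lambda>f. conv f h)"
  by (simp add: lin_def conv_add_left conv_scale_left)

lemma lin_conv_right: "lin (conv h)"
  by (simp add: lin_def conv_add_right conv_scale_right)

lemma conv_zero_left [simp]: "conv 0 h = 0"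
  by (simp add: conv_def fun_eq_iff)

lemma conv_zero_right [simp]: "conv h 0 = 0"
  by (simp add: conv_def fun_eq_iff)

lemma conv_wmon_left:
  "conv (wmon u) f w = (if take (length u) w = u then f (drop (length u) w) else 0)"
proof (cases "take (length u) w = u")
  case True
  hence len: "length u \<le> length w"
    by (metis length_take min.cobounded1)
  have "conv (wmon u) f w = (\<Sum>i\<le>length w. if i = length u then f (drop i w) else 0)"
    unfolding conv_def
  proof (rule sum.cong, goal_cases)
    case (2 i)
    have "take i w = u \<longleftrightarrow> i = length u"
      using 2 True by auto
    thus ?case by (simp add: wmon_def)
  qed simp
  thus ?thesis using True len by simp
next
  case False
  have "conv (wmon u) f w = (\<Sum>i\<le>length w. 0)"
    unfolding conv_def
  proof (rule sum.cong, goal_cases)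
    case (2 i)
    have "take i w \<noteq> u"
      using 2 False by auto
    thus ?case by (simp add: wmon_def)
  qed simp
  thus ?thesis using False by simp
qed

lemma conv_wmon_right:
  "conv f (wmon v) w = (if length v \<le> length w \<and> drop (length w - length v) w = v
     then f (take (length w - length v) w) else 0)"
proof (cases "length v \<le> length w \<and> drop (length w - length v) w = v")
  case True
  have "conv f (wmon v) w = (\<Sum>i\<le>length w. if i = length w - length v then f (take i w) else 0)"
    unfolding conv_def
  proof (rule sum.cong, goal_cases)
    case (2 i)
    have "drop i w = v \<longleftrightarrow> i = length w - length v"
      using 2 True by auto
    thus ?case by (simp add: wmon_def)
  qed simp
  thus ?thesis using True by simp
next
  case False
  have "conv f (wmon v) w = (\<Sum>i\<le>length w. 0)"
    unfolding conv_def
  proof (rule sum.cong, goal_cases)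
    case (2 i)
    have "drop i w \<noteq> v"
      using 2 False by auto
    thus ?case by (simp add: wmon_def)
  qed simp
  thus ?thesis unfolding if_not_P[OF False] by simp
qed

lemma conv_one_left [simp]: "conv (wmon []) f = f"
  by (simp add: fun_eq_iff conv_wmon_left)

lemma conv_one_right [simp]: "conv f (wmon []) = f"
  by (simp add: fun_eq_iff conv_wmon_right)

lemma conv_var_right_snoc [simp]: "conv f (wmon [x]) (w @ [y]) = (if x = y then f w else 0)"
  by (auto simp: conv_wmon_right)

lemma conv_Nil [simp]: "conv f g [] = f [] * g []"
  by (simp add: conv_def)

lemma conv_snoc: "conv f g (w @ [x]) = conv f (\<lambda>v. g (v @ [x])) w + f (w @ [x]) * g []"
  by (simp add: conv_def)

lemma conv_assoc: "conv (conv f g) h = conv f (conv g h)"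
proof
  fix w
  \<comment> \<open>The third index matches the shape of the reindexing lemma for triple products of
    formal power series, which sums over i + j + k = length w.\<close>
  define F where "F i j k = f (take i w) * g (take j (drop i w)) * h (drop (i + j) w)" for i j and k :: nat
  have "conv (conv f g) h w = (\<Sum>j=0..length w. \<Sum>i=0..j. F i (j - i) (length w - j))"
    unfolding conv_def atLeast0AtMost
    by (intro sum.cong refl)
      (auto simp: F_def sum_distrib_right min_def drop_take intro!: sum.cong)
  also have "\<dots> = (\<Sum>j=0..length w. \<Sum>i=0..length w - j. F j i (length w - j - i))"
    by (rule fps_mult_assoc_lemma)
  also have "\<dots> = conv f (conv g h) w"
    unfolding conv_def atLeast0AtMost
    by (intro sum.cong refl)
      (auto simp: F_def sum_distrib_left mult.assoc add.commute intro!: sum.cong)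
  finally show "conv (conv f g) h w = conv f (conv g h) w" .
qed

lemma conv_wmon_wmon: "conv (wmon u) (wmon v) = wmon (u @ v)"
proof
  fix w
  have "w = u @ v \<longleftrightarrow> take (length u) w = u \<and> drop (length u) w = v"
    using append_eq_conv_conj[of u v w] by auto
  thus "conv (wmon u) (wmon v) w = wmon (u @ v) w"
    unfolding conv_wmon_left by (simp add: wmon_def)
qed

section \<open>Carriers of the free algebra and of its completion\<close>

lemma free_algebra_simps:
  "mult (free_algebra c X) = conv"
  "one (free_algebra c X) = wmon []"
  "zero (free_algebra c X) = 0"
  "add (free_algebra c X) = (+)"
  "smult (free_algebra c X) = (\<lambda>a f w. a * f w)"
  by (auto simp: free_algebra_def conv_def wmon_def fun_eq_iff)

lemma carrier_free_algebra_iff: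
  "f \<in> carrier (free_algebra c X) \<longleftrightarrow>
     (\<forall>w. f w \<noteq> 0 \<longrightarrow> w \<in> lists X) \<and> (c \<or> finite {w. f w \<noteq> 0})"
  by (auto simp: free_algebra_def)

lemma carrier_True: "f \<in> carrier (free_algebra c X) \<Longrightarrow> f \<in> carrier (free_algebra True X)"
  by (auto simp: carrier_free_algebra_iff)

lemma carrier_subset: "X \<subseteq> Y \<Longrightarrow> carrier (free_algebra c X) \<subseteq> carrier (free_algebra c Y)"
  unfolding subset_iff carrier_free_algebra_iff using lists_mono[of X Y] by blast

lemma carrier_outside: "f \<in> carrier (free_algebra c X) \<Longrightarrow> w \<notin> lists X \<Longrightarrow> f w = 0"
  by (auto simp: carrier_free_algebra_iff)

lemma wmon_closed [simp, intro]: "w \<in> lists X \<Longrightarrow> wmon w \<in> carrier (free_algebra c X)"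
  by (auto simp: carrier_free_algebra_iff wmon_def)

lemma zero_closed [simp, intro]: "0 \<in> carrier (free_algebra c X)"
  by (auto simp: carrier_free_algebra_iff)

lemma add_closed [intro]:
  assumes "f \<in> carrier (free_algebra c X)" "g \<in> carrier (free_algebra c X)"
  shows "f + g \<in> carrier (free_algebra c X)"
proof -
  have "{w. f w + g w \<noteq> 0} \<subseteq> {w. f w \<noteq> 0} \<union> {w. g w \<noteq> 0}" by auto
  thus ?thesis using assms
    by (auto simp: carrier_free_algebra_iff intro: finite_subset)
qed

lemma scale_closed [intro]:
  assumes "f \<in> carrier (free_algebra c X)"
  shows "(\<lambda>w. a * f w) \<in> carrier (free_algebra c X)"
proof -
  have "{w. a * f w \<noteq> 0} \<subseteq> {w. f w \<noteq> 0}" by auto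
  thus ?thesis using assms by (auto simp: carrier_free_algebra_iff intro: finite_subset)
qed

lemma uminus_closed [intro]:
  "f \<in> carrier (free_algebra c X) \<Longrightarrow> - f \<in> carrier (free_algebra c X)"
  by (auto simp: carrier_free_algebra_iff)

lemma diff_closed [intro]:
  assumes "f \<in> carrier (free_algebra c X)" "g \<in> carrier (free_algebra c X)"
  shows "f - g \<in> carrier (free_algebra c X)"
  using add_closed[OF assms(1) uminus_closed[OF assms(2)]] by simp

lemma subspace_carrier: "fv.subspace (carrier (free_algebra c X))"
  by (auto simp: fv.subspace_def)

lemma conv_nonzeroE:
  assumes "conv f g w \<noteq> 0"
  obtains u v where "w = u @ v" "f u \<noteq> 0" "g v \<noteq> 0"
proof -
  obtain i where "f (take i w) * g (drop i w) \<noteq> 0"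
    using assms unfolding conv_def by (metis (mono_tags, lifting) sum.neutral)
  thus ?thesis using that[of "take i w" "drop i w"] by auto
qed

lemma conv_closed [intro]:
  assumes "f \<in> carrier (free_algebra c X)" "g \<in> carrier (free_algebra c X)"
  shows "conv f g \<in> carrier (free_algebra c X)"
proof -
  have "{w. conv f g w \<noteq> 0} \<subseteq> (\<lambda>(u, v). u @ v) ` ({w. f w \<noteq> 0} \<times> {w. g w \<noteq> 0})"
    by (auto elim!: conv_nonzeroE)
  moreover have "w \<in> lists X" if "conv f g w \<noteq> 0" for w
    using that assms by (elim conv_nonzeroE) (auto simp: carrier_free_algebra_iff)
  ultimately show ?thesis using assms
    by (auto simp: carrier_free_algebra_iff intro: finite_subset)
qed

lemma ring_free_algebra: "ring (free_algebra c X :: ('k::field, 'x list \<Rightarrow> 'k) module)"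
proof (rule ringI)
  show "abelian_group (free_algebra c X :: ('k::field, 'x list \<Rightarrow> 'k) module)"
  proof (rule abelian_groupI)
    fix x :: "'x list \<Rightarrow> 'k" assume "x \<in> carrier (free_algebra c X)"
    thus "\<exists>y\<in>carrier (free_algebra c X). y \<oplus>\<^bsub>free_algebra c X\<^esub> x = \<zero>\<^bsub>free_algebra c X\<^esub>"
      by (intro bexI[of _ "- x"]) (auto simp: free_algebra_simps)
  qed (auto simp: free_algebra_simps algebra_simps)
  show "Group.monoid (free_algebra c X :: ('k::field, 'x list \<Rightarrow> 'k) module)"
    by (rule Group.monoidI) (auto simp: free_algebra_simps conv_assoc)
qed (auto simp: free_algebra_simps conv_add_left conv_add_right)

section \<open>Expansion into words, and the ideals spanned by multiples of relations\<close>

lemma finite_lists_le: "finite X \<Longrightarrow> finite {w \<in> lists X. length w \<le> M}"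
  using finite_lists_length_le[of X M] by (simp add: in_lists_conv_set subset_eq)

lemma expand_on:
  assumes "finite W" "\<And>w. f w \<noteq> 0 \<Longrightarrow> w \<in> W"
  shows "f = (\<Sum>w\<in>W. (\<lambda>v. f w * wmon w v))"
proof
  fix v
  have "(\<Sum>w\<in>W. (\<lambda>v. f w * wmon w v)) v = (\<Sum>w\<in>W. if w = v then f w else 0)"
    by (simp add: sum_fun_apply wmon_def, intro sum.cong) auto
  also have "\<dots> = f v" using assms by auto
  finally show "f v = (\<Sum>w\<in>W. (\<lambda>v. f w * wmon w v)) v" ..
qed

lemma expand_in_span:
  assumes "finite W" "\<And>w. f w \<noteq> 0 \<Longrightarrow> w \<in> W"
  shows "f \<in> fv.span (wmon ` W)"
proof -
  have "(\<Sum>w\<in>W. (\<lambda>v. f w * wmon w v)) \<in> fv.span (wmon ` W)"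
    by (rule fv.span_sum, rule fv.span_scale, rule fv.span_base) simp
  thus ?thesis using expand_on[of W f, OF assms] by simp
qed

lemma carrier_False_eq_span:
  fixes X :: "'a set"
  shows
  "(carrier (free_algebra False X) :: ('a list \<Rightarrow> 'b::field) set) = fv.span (wmon ` lists X)"
proof
  show "(carrier (free_algebra False X) :: ('a list \<Rightarrow> 'b) set) \<subseteq> fv.span (wmon ` lists X)"
  proof
    fix f :: "'a list \<Rightarrow> 'b" assume f: "f \<in> carrier (free_algebra False X)"
    hence "f \<in> fv.span (wmon ` {w. f w \<noteq> 0})"
      by (intro expand_in_span) (auto simp: carrier_free_algebra_iff)
    moreover have "{w. f w \<noteq> 0} \<subseteq> lists X"
      using f by (auto simp: carrier_free_algebra_iff)
    hence "fv.span (wmon ` {w. f w \<noteq> 0}) \<subseteq> (fv.span (wmon ` lists X) :: ('a list \<Rightarrow> 'b) set)"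
      by (intro fv.span_mono image_mono)
    ultimately show "f \<in> fv.span (wmon ` lists X)"
      by blast
  qed
  show "fv.span (wmon ` lists X) \<subseteq> (carrier (free_algebra False X) :: ('a list \<Rightarrow> 'b) set)"
    by (rule fv.span_minimal) (auto simp: subspace_carrier)
qed

text \<open>Multiples are taken by words, hence by polynomials. For polynomial relations this is the
  ideal they generate. For power series it is in general neither closed nor stable under
  multiplication by series, but it is dense in the closed ideal.\<close>

definition word_ideal :: "'x set \<Rightarrow> ('x list \<Rightarrow> 'k::field) set \<Rightarrow> ('x list \<Rightarrow> 'k) set" where
  "word_ideal X S =
     fv.span {conv (wmon u) (conv s (wmon v)) |u v s. u \<in> lists X \<and> v \<in> lists X \<and> s \<in> S}"

lemma subspace_word_ideal: "fv.subspace (word_ideal X S)"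
  by (simp add: word_ideal_def fv.subspace_span)

lemma word_idealI:
  "u \<in> lists X \<Longrightarrow> v \<in> lists X \<Longrightarrow> s \<in> S \<Longrightarrow> conv (wmon u) (conv s (wmon v)) \<in> word_ideal X S"
  unfolding word_ideal_def by (intro fv.span_base) auto

lemma word_ideal_base: "s \<in> S \<Longrightarrow> s \<in> word_ideal X S"
  using word_idealI[of "[]" X "[]" s S] by simp

lemma word_ideal_minimal:
  assumes "fv.subspace V"
    "\<And>u v s. u \<in> lists X \<Longrightarrow> v \<in> lists X \<Longrightarrow> s \<in> S \<Longrightarrow> conv (wmon u) (conv s (wmon v)) \<in> V"
  shows "word_ideal X S \<subseteq> V"
  unfolding word_ideal_def using assms by (intro fv.span_minimal) auto

lemma word_ideal_mono: "S \<subseteq> T \<Longrightarrow> word_ideal X S \<subseteq> word_ideal X T"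
  by (rule word_ideal_minimal[OF subspace_word_ideal]) (auto intro: word_idealI)

lemma word_ideal_subset_carrier:
  "S \<subseteq> carrier (free_algebra c X) \<Longrightarrow> word_ideal X S \<subseteq> carrier (free_algebra c X)"
  by (rule word_ideal_minimal[OF subspace_carrier]) auto

lemma word_ideal_lin:
  assumes "lin T" "f \<in> word_ideal X S" "fv.subspace V"
    "\<And>u v s. u \<in> lists X \<Longrightarrow> v \<in> lists X \<Longrightarrow> s \<in> S \<Longrightarrow> T (conv (wmon u) (conv s (wmon v))) \<in> V"
  shows "T f \<in> V"
  using assms(2) unfolding word_ideal_def
  by (rule lin_span[OF assms(1) _ _ assms(3)]) (use assms(4) in auto)

lemma word_ideal_wmon_left:
  assumes "f \<in> word_ideal X S" "u \<in> lists X"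
  shows "conv (wmon u) f \<in> word_ideal X S"
proof (rule word_ideal_lin[OF lin_conv_right assms(1) subspace_word_ideal])
  fix u' v s assume *: "u' \<in> lists X" "v \<in> lists X" "s \<in> S"
  have "conv (wmon u) (conv (wmon u') (conv s (wmon v))) = conv (wmon (u @ u')) (conv s (wmon v))"
    by (simp flip: conv_assoc add: conv_wmon_wmon)
  thus "conv (wmon u) (conv (wmon u') (conv s (wmon v))) \<in> word_ideal X S"
    using assms(2) * by (simp add: word_idealI)
qed

lemma word_ideal_wmon_right:
  assumes "f \<in> word_ideal X S" "v \<in> lists X"
  shows "conv f (wmon v) \<in> word_ideal X S"
proof (rule word_ideal_lin[OF lin_conv_left assms(1) subspace_word_ideal])
  fix u v' s assume *: "u \<in> lists X" "v' \<in> lists X" "s \<in> S"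
  have "conv (conv (wmon u) (conv s (wmon v'))) (wmon v) = conv (wmon u) (conv s (wmon (v' @ v)))"
    by (simp add: conv_assoc conv_wmon_wmon)
  thus "conv (conv (wmon u) (conv s (wmon v'))) (wmon v) \<in> word_ideal X S"
    using assms(2) * by (simp add: word_idealI)
qed

lemma word_ideal_left:
  assumes "f \<in> word_ideal X S" "a \<in> carrier (free_algebra False X)"
  shows "conv a f \<in> word_ideal X S"
  using assms(2) unfolding carrier_False_eq_span
  by (rule lin_span[OF lin_conv_left _ _ subspace_word_ideal])
    (use word_ideal_wmon_left[OF assms(1)] in auto)

lemma word_ideal_right:
  assumes "f \<in> word_ideal X S" "a \<in> carrier (free_algebra False X)"
  shows "conv f a \<in> word_ideal X S"
  using assms(2) unfolding carrier_False_eq_span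
  by (rule lin_span[OF lin_conv_right _ _ subspace_word_ideal])
    (use word_ideal_wmon_right[OF assms(1)] in auto)

section \<open>Agreement up to a word length, and closed ideals\<close>

definition agree :: "nat \<Rightarrow> ('x list \<Rightarrow> 'k) \<Rightarrow> ('x list \<Rightarrow> 'k) \<Rightarrow> bool" where
  "agree M f g \<longleftrightarrow> (\<forall>w. length w \<le> M \<longrightarrow> f w = g w)"

definition cut :: "nat \<Rightarrow> ('x list \<Rightarrow> 'k::field) \<Rightarrow> 'x list \<Rightarrow> 'k" where
  "cut M f = (\<lambda>w. if length w \<le> M then f w else 0)"

lemma agree_refl [simp]: "agree M f f"
  by (simp add: agree_def)

lemma agree_sym: "agree M f g \<Longrightarrow> agree M g f"
  by (simp add: agree_def)

lemma agree_trans: "agree M f g \<Longrightarrow> agree M g h \<Longrightarrow> agree M f h"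
  by (simp add: agree_def)

lemma agree_mono: "agree M f g \<Longrightarrow> N \<le> M \<Longrightarrow> agree N f g"
  by (simp add: agree_def)

lemma agree_cut: "agree M f (cut M f)"
  by (simp add: agree_def cut_def)

lemma agree_add: "agree M f g \<Longrightarrow> agree M f' g' \<Longrightarrow> agree M (f + f') (g + g')"
  by (simp add: agree_def)

lemma agree_diff:
  fixes f :: "'x list \<Rightarrow> 'k::ab_group_add"
  shows "agree M f g \<Longrightarrow> agree M f' g' \<Longrightarrow> agree M (f - f') (g - g')"
  by (simp add: agree_def)

lemma agree_scale:
  fixes f :: "'x list \<Rightarrow> 'k::field"
  shows "agree M f g \<Longrightarrow> agree M (\<lambda>w. c * f w) (\<lambda>w. c * g w)"
  by (simp add: agree_def)

lemma agree_conv: "agree M f g \<Longrightarrow> agree M f' g' \<Longrightarrow> agree M (conv f f') (conv g g')"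
  by (auto simp: agree_def conv_def intro!: sum.cong)

lemma cut_closed:
  assumes "finite X" "f \<in> carrier (free_algebra True X)"
  shows "cut M f \<in> carrier (free_algebra c X)"
proof -
  have "{w. cut M f w \<noteq> 0} \<subseteq> {w \<in> lists X. length w \<le> M}"
    using assms(2) by (auto simp: cut_def carrier_free_algebra_iff split: if_splits)
  thus ?thesis using finite_lists_le[OF assms(1), of M]
    by (auto simp: carrier_free_algebra_iff intro: finite_subset)
qed

text \<open>In the completed case this is the closure of \<open>word_ideal X S\<close>, phrased
  through agreement on short words instead of open sets. Both cases share the approximation property
  \<open>rel_ideal_agree\<close>, which lets later proofs treat them together.\<close>

definition rel_ideal :: "bool \<Rightarrow> 'x set \<Rightarrow> ('x list \<Rightarrow> 'k::field) set \<Rightarrow> ('x list \<Rightarrow> 'k) set" where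
  "rel_ideal c X S = {f \<in> carrier (free_algebra c X).
     if c then \<forall>M. \<exists>g\<in>word_ideal X S. agree M f g else f \<in> word_ideal X S}"

lemma word_ideal_subset_rel_ideal:
  "S \<subseteq> carrier (free_algebra c X) \<Longrightarrow> word_ideal X S \<subseteq> rel_ideal c X S"
  using word_ideal_subset_carrier[of S c X] by (auto simp: rel_ideal_def intro: agree_refl)

lemma relations_subset_rel_ideal:
  assumes "S \<subseteq> carrier (free_algebra c X)"
  shows "S \<subseteq> rel_ideal c X S"
proof
  fix s assume "s \<in> S"
  hence "s \<in> word_ideal X S" by (rule word_ideal_base)
  thus "s \<in> rel_ideal c X S" using word_ideal_subset_rel_ideal[OF assms] by (rule rev_subsetD)
qed

lemma rel_ideal_agree:
  "f \<in> rel_ideal c X S \<Longrightarrow> \<exists>g\<in>word_ideal X S. agree M f g"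
  by (auto simp: rel_ideal_def split: if_splits intro: agree_refl)

lemma rel_ideal_closed:
  assumes "f \<in> carrier (free_algebra True X)" "\<And>M. \<exists>g\<in>rel_ideal True X S. agree M f g"
  shows "f \<in> rel_ideal True X S"
proof -
  have "\<exists>g\<in>word_ideal X S. agree M f g" for M
    using assms(2)[of M] rel_ideal_agree agree_trans by blast
  thus ?thesis using assms(1) by (simp add: rel_ideal_def)
qed

lemma subspace_rel_ideal: "fv.subspace (rel_ideal c X S)"
proof (cases c)
  case True
  show ?thesis unfolding fv.subspace_def
  proof (intro conjI ballI allI)
    show "0 \<in> rel_ideal c X S"
      using subspace_word_ideal[of X S] by (auto simp: rel_ideal_def fv.subspace_0 intro!: bexI[of _ 0])
    show "f + g \<in> rel_ideal c X S" if "f \<in> rel_ideal c X S" "g \<in> rel_ideal c X S" for f g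
    proof -
      have "\<exists>h\<in>word_ideal X S. agree M (f + g) h" for M
        using rel_ideal_agree[OF that(1), of M] rel_ideal_agree[OF that(2), of M]
        by (meson agree_add fv.subspace_add subspace_word_ideal)
      thus ?thesis using that True by (auto simp: rel_ideal_def)
    qed
    show "(\<lambda>w. a * f w) \<in> rel_ideal c X S" if f: "f \<in> rel_ideal c X S" for f a
    proof -
      have "\<exists>h\<in>word_ideal X S. agree M (\<lambda>w. a * f w) h" for M
      proof -
        obtain h where h: "h \<in> word_ideal X S" "agree M f h"
          using rel_ideal_agree[OF f] by blast
        show ?thesis
          using fv.subspace_scale[OF subspace_word_ideal h(1)] agree_scale[OF h(2)] by blast
      qed
      thus ?thesis using f True by (auto simp: rel_ideal_def)
    qed
  qed
next
  case False
  hence "rel_ideal c X S = carrier (free_algebra False X) \<inter> word_ideal X S"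
    by (auto simp: rel_ideal_def)
  thus ?thesis by (simp add: fv.subspace_inter subspace_carrier subspace_word_ideal)
qed

text \<open>Up to length M a product sees only the part of each factor up to length M. Cutting the
  series \<open>a\<close> there leaves a polynomial, because there are finitely many letters, and
  polynomials do preserve \<open>word_ideal\<close>.\<close>

lemma rel_ideal_conv:
  assumes "finite X" "f \<in> rel_ideal c X S" "a \<in> carrier (free_algebra c X)"
  shows "conv a f \<in> rel_ideal c X S" "conv f a \<in> rel_ideal c X S"
proof -
  have f: "f \<in> carrier (free_algebra c X)" using assms(2) by (simp add: rel_ideal_def)
  have "(\<exists>g\<in>word_ideal X S. agree M (conv a f) g) \<and> (\<exists>g\<in>word_ideal X S. agree M (conv f a) g)" for M
  proof -
    obtain g where g: "g \<in> word_ideal X S" "agree M f g"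
      using rel_ideal_agree[OF assms(2)] by blast
    have a: "cut M a \<in> carrier (free_algebra False X)"
      using cut_closed[OF assms(1) carrier_True[OF assms(3)]] .
    show ?thesis
      using word_ideal_left[OF g(1) a] word_ideal_right[OF g(1) a] g(2)
      by (meson agree_conv agree_cut)
  qed
  moreover have "conv a f \<in> word_ideal X S" "conv f a \<in> word_ideal X S" if "\<not> c"
    using assms that word_ideal_left word_ideal_right by (auto simp: rel_ideal_def)
  ultimately show "conv a f \<in> rel_ideal c X S" "conv f a \<in> rel_ideal c X S"
    using f assms(3) by (auto simp: rel_ideal_def)
qed

lemma ideal_rel_ideal:
  fixes S :: "('x list \<Rightarrow> 'k::field) set"
  assumes "finite X"
  shows "ideal (rel_ideal c X S) (free_algebra c X)"
proof (rule idealI[OF ring_free_algebra])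
  interpret R: ring "free_algebra c X :: ('k, 'x list \<Rightarrow> 'k) module" by (rule ring_free_algebra)
  note sub = subspace_rel_ideal[of c X S]
  show "subgroup (rel_ideal c X S) (add_monoid (free_algebra c X))"
  proof (rule R.add.subgroupI)
    show "rel_ideal c X S \<subseteq> carrier (free_algebra c X)" by (auto simp: rel_ideal_def)
    show "rel_ideal c X S \<noteq> {}" using fv.subspace_0[OF sub] by auto
  next
    fix a b assume ab: "a \<in> rel_ideal c X S" "b \<in> rel_ideal c X S"
    show "a \<oplus>\<^bsub>free_algebra c X\<^esub> b \<in> rel_ideal c X S"
      using fv.subspace_add[OF sub ab] by (simp add: free_algebra_simps)
  next
    fix a assume a: "a \<in> rel_ideal c X S"
    hence "a \<in> carrier (free_algebra c X)" by (simp add: rel_ideal_def)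
    hence "\<ominus>\<^bsub>free_algebra c X\<^esub> a = - a"
      by (intro R.minus_equality) (auto simp: free_algebra_simps)
    thus "\<ominus>\<^bsub>free_algebra c X\<^esub> a \<in> rel_ideal c X S"
      using fv.subspace_neg[OF sub a] by simp
  qed
next
  fix a x :: "'x list \<Rightarrow> 'k" assume "a \<in> rel_ideal c X S" "x \<in> carrier (free_algebra c X)"
  thus "x \<otimes>\<^bsub>free_algebra c X\<^esub> a \<in> rel_ideal c X S" "a \<otimes>\<^bsub>free_algebra c X\<^esub> x \<in> rel_ideal c X S"
    using rel_ideal_conv[OF assms] by (auto simp: free_algebra_simps)
qed

lemma ideal_contains_word_ideal:
  fixes I :: "('x list \<Rightarrow> 'k::field) set"
  assumes "ideal I (free_algebra c X)" "S \<subseteq> I"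
  shows "word_ideal X S \<subseteq> I"
proof -
  interpret ideal I "free_algebra c X :: ('k, 'x list \<Rightarrow> 'k) module" by fact
  \<comment> \<open>A ring ideal is closed under scalars because a scalar multiple is the product
    with a constant series.\<close>
  have sc: "(\<lambda>w. a * f w) \<in> I" if "f \<in> I" for a f
  proof -
    have "conv (\<lambda>w. a * wmon [] w) f \<in> I"
      using I_l_closed[OF that, of "\<lambda>w. a * wmon [] w"] by (auto simp: free_algebra_simps)
    thus ?thesis by (simp add: conv_scale_left)
  qed
  have "fv.subspace I"
    unfolding fv.subspace_def using additive_subgroup.a_closed[OF is_additive_subgroup] sc additive_subgroup.zero_closed[OF is_additive_subgroup]
    by (simp add: free_algebra_simps)
  thus ?thesis
  proof (rule word_ideal_minimal)
    fix u v s assume "u \<in> lists X" "v \<in> lists X" "s \<in> S"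
    thus "conv (wmon u) (conv s (wmon v)) \<in> I"
      using I_l_closed[of "conv s (wmon v)" "wmon u"] I_r_closed[of s "wmon v"] assms(2)
      by (auto simp: free_algebra_simps)
  qed
qed

text \<open>Agreement up to length M prescribes finitely many coefficients, since X is finite and
  coefficients off \<open>lists X\<close> vanish on both sides; so it describes an open
  neighbourhood. Conversely a basic open set restricts finitely many words, whose lengths are
  bounded.\<close>

lemma closure_of_coeff_topology:
  fixes B :: "('x list \<Rightarrow> 'k::field) set"
  assumes "finite X" "B \<subseteq> carrier (free_algebra True X)"
  shows "coeff_topology X closure_of B =
    {f \<in> carrier (free_algebra True X). \<forall>M. \<exists>g\<in>B. agree M f g}"
proof -
  let ?P = "product_topology (\<lambda>w :: 'x list. discrete_topology (UNIV :: 'k set)) UNIV"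
  let ?C = "carrier (free_algebra True X) :: ('x list \<Rightarrow> 'k) set"
  have "coeff_topology X closure_of B = ?C \<inter> (?P closure_of B)"
    using assms(2) unfolding coeff_topology_def
    by (metis closure_of_subtopology inf.absorb_iff2)
  also have "?C \<inter> (?P closure_of B) = {f \<in> ?C. \<forall>M. \<exists>g\<in>B. agree M f g}"
  proof (rule Set.set_eqI, rule iffI)
    fix f assume f: "f \<in> ?C \<inter> (?P closure_of B)"
    have "\<exists>g\<in>B. agree M f g" for M
    proof -
      let ?W = "{w \<in> lists X. length w \<le> M}"
      let ?T = "Pi\<^sub>E UNIV (\<lambda>w. if w \<in> ?W then {f w} else (UNIV :: 'k set))"
      have "finite {w. (if w \<in> ?W then {f w} else (UNIV :: 'k set)) \<noteq> UNIV}"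
        by (rule finite_subset[OF _ finite_lists_le[OF assms(1), of M]]) auto
      hence "openin ?P ?T"
        by (intro product_topology_basis) auto
      moreover have "f \<in> ?T" by auto
      moreover have "f \<in> ?P closure_of B" using f by simp
      ultimately have "\<exists>g. g \<in> B \<and> g \<in> ?T"
        unfolding in_closure_of by (elim conjE allE[of _ ?T]) simp
      then obtain g where g: "g \<in> B" "g \<in> ?T" by (elim exE conjE)
      have "f w = g w" if "length w \<le> M" for w
      proof (cases "w \<in> lists X")
        case True
        have "g w \<in> (if w \<in> ?W then {f w} else UNIV)" using g(2) by (simp add: PiE_iff)
        thus ?thesis using True that by simp
      next
        case False
        thus ?thesis using f g(1) assms(2) by (metis IntD1 carrier_outside subsetD)
      qed
      thus ?thesis using g(1) by (auto simp: agree_def)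
    qed
    thus "f \<in> {f \<in> ?C. \<forall>M. \<exists>g\<in>B. agree M f g}" using f by auto
  next
    fix f assume f: "f \<in> {f \<in> ?C. \<forall>M. \<exists>g\<in>B. agree M f g}"
    have "\<exists>g. g \<in> B \<and> g \<in> T" if T: "f \<in> T" "openin ?P T" for T
    proof -
      obtain U where U: "finite {i. U i \<noteq> UNIV}" "f \<in> Pi\<^sub>E UNIV U" "Pi\<^sub>E UNIV U \<subseteq> T"
        using product_topology_open_contains_basis[OF T(2,1)] by auto
      have "finite (length ` {i. U i \<noteq> UNIV})"
        using U(1) by (rule finite_imageI)
      then obtain M where M: "\<And>w. U w \<noteq> UNIV \<Longrightarrow> length w \<le> M"
        unfolding finite_nat_set_iff_bounded_le by blast
      obtain g where g: "g \<in> B" "agree M f g" using f by auto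
      have "g w \<in> U w" for w
      proof (cases "U w = UNIV")
        case False
        hence "f w = g w" using M[of w] g(2) by (simp add: agree_def)
        moreover have "f w \<in> U w" using U(2) by (simp add: PiE_iff)
        ultimately show ?thesis by simp
      qed auto
      hence "g \<in> Pi\<^sub>E UNIV U" by (auto simp: PiE_iff)
      thus ?thesis using U(3) g(1) by auto
    qed
    thus "f \<in> ?C \<inter> (?P closure_of B)"
      using f by (auto simp: in_closure_of)
  qed
  finally show ?thesis .
qed

text \<open>Every closed ideal containing S contains \<open>word_ideal X S\<close>, hence its
  closure, and the closure is itself such an ideal. From here on presentations are handled through
  \<open>rel_ideal\<close>.\<close>

lemma relation_ideal_eq:
  fixes S :: "('x list \<Rightarrow> 'k::field) set"
  assumes "finite X" "S \<subseteq> carrier (free_algebra c X)"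
  shows "relation_ideal c X S = rel_ideal c X S"
proof (cases c)
  case True
  let ?C = "carrier (free_algebra True X) :: ('x list \<Rightarrow> 'k) set"
  have top: "topspace (coeff_topology X :: ('x list \<Rightarrow> 'k) topology) = ?C"
    by (simp add: coeff_topology_def)
  have closed_iff: "closedin (coeff_topology X) I \<longleftrightarrow>
      (\<forall>f\<in>?C. (\<forall>M. \<exists>g\<in>I. agree M f g) \<longrightarrow> f \<in> I)" if "I \<subseteq> ?C" for I
    using that closure_of_coeff_topology[OF assms(1) that]
    by (auto simp: closure_of_subset_eq[symmetric] top)
  have sub: "S \<subseteq> rel_ideal True X S"
    using relations_subset_rel_ideal[of S True X] assms(2) True by simp
  have carr: "rel_ideal True X S \<subseteq> ?C"
    by (auto simp: rel_ideal_def)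
  have "\<Inter>{I. ideal I (free_algebra True X) \<and> closedin (coeff_topology X) I \<and> S \<subseteq> I} = rel_ideal True X S"
  proof
    have "closedin (coeff_topology X) (rel_ideal True X S)"
      using closed_iff[OF carr] rel_ideal_closed by blast
    thus "\<Inter>{I. ideal I (free_algebra True X) \<and> closedin (coeff_topology X) I \<and> S \<subseteq> I} \<subseteq> rel_ideal True X S"
      using sub ideal_rel_ideal[OF assms(1), of True S] by blast
    show "rel_ideal True X S \<subseteq> \<Inter>{I. ideal I (free_algebra True X) \<and> closedin (coeff_topology X) I \<and> S \<subseteq> I}"
    proof (intro Inter_greatest, clarify)
      fix I f assume I: "ideal I (free_algebra True X)" "closedin (coeff_topology X) I" "S \<subseteq> I"
        and f: "f \<in> rel_ideal True X S"
      have "I \<subseteq> ?C"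
        using closedin_subset[OF I(2)] top by simp
      moreover have "\<exists>g\<in>I. agree M f g" for M
        using rel_ideal_agree[OF f, of M] ideal_contains_word_ideal[OF I(1,3)] by blast
      ultimately show "f \<in> I" using closed_iff I(2) f carr by blast
    qed
  qed
  thus ?thesis using True by (simp add: relation_ideal_def)
next
  case False
  interpret R: ring "free_algebra False X :: ('k, 'x list \<Rightarrow> 'k) module" by (rule ring_free_algebra)
  have S: "S \<subseteq> rel_ideal False X S"
    using relations_subset_rel_ideal[of S False X] assms(2) False by simp
  have "genideal (free_algebra False X) S = rel_ideal False X S"
  proof
    show "genideal (free_algebra False X) S \<subseteq> rel_ideal False X S"
      by (rule R.genideal_minimal[OF ideal_rel_ideal[OF assms(1)] S])
    have "ideal (genideal (free_algebra False X) S) (free_algebra False X)"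
      using R.genideal_ideal assms(2) False by simp
    hence "word_ideal X S \<subseteq> genideal (free_algebra False X) S"
      using R.genideal_self assms(2) False by (intro ideal_contains_word_ideal) auto
    thus "rel_ideal False X S \<subseteq> genideal (free_algebra False X) S"
      by (auto simp: rel_ideal_def)
  qed
  thus ?thesis using False by (simp add: relation_ideal_def)
qed

section \<open>The Golod--Shafarevich inequality\<close>

lemma wmon_singleton_Nil [simp]: "wmon [x] [] = 0"
  by (simp add: wmon_def)

lemma take_drop_lists: "w \<in> lists X \<Longrightarrow> take i w \<in> lists X \<and> drop i w \<in> lists X"
  by (auto dest: in_set_takeD in_set_dropD)

text \<open>\<open>D\<close> merely bounds the weights in a relation from below and is a real number
  even for the zero relation, where the bound is vacuous. Relations are taken as series, so that
  both kinds of presentation are covered.\<close>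

locale weighted_relations =
  fixes X :: "'x set" and d :: "'x \<Rightarrow> real"
    and S :: "('x list \<Rightarrow> 'k::field) set" and D :: "('x list \<Rightarrow> 'k) \<Rightarrow> real"
  assumes finite_X: "finite X"
    and weight_pos: "\<And>x. x \<in> X \<Longrightarrow> 0 < d x"
    and S_carrier: "S \<subseteq> carrier (free_algebra True X)"
    and S_const: "\<And>s. s \<in> S \<Longrightarrow> s [] = 0"
    and S_weight: "\<And>s w. s \<in> S \<Longrightarrow> s w \<noteq> 0 \<Longrightarrow> D s \<le> sum_list (map d w)"
begin

abbreviation wt :: "'x list \<Rightarrow> real" where "wt w \<equiv> sum_list (map d w)"

text \<open>Strictness makes the set empty at \<alpha> = 0 and puts the empty word into it as soon
  as \<alpha> > 0; this word is the summand 1 in the recursion.\<close>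

definition words_below :: "real \<Rightarrow> 'x list set" where
  "words_below \<alpha> = {w \<in> lists X. wt w < \<alpha>}"

definition trunc :: "real \<Rightarrow> ('x list \<Rightarrow> 'k) \<Rightarrow> 'x list \<Rightarrow> 'k" where
  "trunc \<alpha> f = (\<lambda>w. if w \<in> words_below \<alpha> then f w else 0)"

definition trunc_ideal :: "real \<Rightarrow> ('x list \<Rightarrow> 'k) set" where
  "trunc_ideal \<alpha> = trunc \<alpha> ` word_ideal X S"

text \<open>The dimension of the free algebra modulo the ideal and all words of weight at least
  \<alpha>. The subtraction of naturals is exact, because truncated elements of the ideal are
  combinations of the words below \<alpha>.\<close>

definition codim :: "real \<Rightarrow> nat" where
  "codim \<alpha> = card (words_below \<alpha>) - fv.dim (trunc_ideal \<alpha>)"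

lemma wt_nonneg: "w \<in> lists X \<Longrightarrow> 0 \<le> wt w"
  using weight_pos by (force intro!: sum_list_nonneg)

lemma min_weight: obtains \<delta> where "\<delta> > 0" "\<And>w. w \<in> lists X \<Longrightarrow> \<delta> * real (length w) \<le> wt w"
proof
  \<comment> \<open>The inserted 1 covers the case of no letters.\<close>
  let ?\<delta> = "Min (insert 1 (d ` X))"
  show "?\<delta> > 0" using finite_X weight_pos by simp
  fix w assume "w \<in> lists X"
  thus "?\<delta> * real (length w) \<le> wt w"
  proof (induction w)
    case (Cons x w)
    have "?\<delta> \<le> d x" using Cons.hyps finite_X by (intro Min_le) auto
    thus ?case using Cons by (simp add: algebra_simps)
  qed simp
qed

lemma finite_words_below: "finite (words_below \<alpha>)"
proof -
  obtain \<delta> where \<delta>: "\<delta> > 0" "\<And>w. w \<in> lists X \<Longrightarrow> \<delta> * real (length w) \<le> wt w"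
    using min_weight by blast
  have "words_below \<alpha> \<subseteq> {w \<in> lists X. length w \<le> nat \<lceil>\<alpha> / \<delta>\<rceil>}"
  proof
    fix w assume "w \<in> words_below \<alpha>"
    hence w: "w \<in> lists X" "wt w < \<alpha>" by (auto simp: words_below_def)
    hence "real (length w) \<le> \<alpha> / \<delta>"
      using \<delta>(2)[of w] \<delta>(1) by (simp add: field_simps)
    thus "w \<in> {w \<in> lists X. length w \<le> nat \<lceil>\<alpha> / \<delta>\<rceil>}" using w by simp linarith
  qed
  thus ?thesis using finite_lists_le[OF finite_X] finite_subset by blast
qed

lemma words_below_mono: "\<alpha> \<le> \<beta> \<Longrightarrow> words_below \<alpha> \<subseteq> words_below \<beta>"
  by (auto simp: words_below_def)

lemma words_below_empty: "\<alpha> \<le> 0 \<Longrightarrow> words_below \<alpha> = {}"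
  using wt_nonneg by (force simp: words_below_def)

lemma lin_trunc: "lin (trunc \<alpha>)"
  by (auto simp: lin_def trunc_def fun_eq_iff)

lemma trunc_closed: "trunc \<alpha> f \<in> carrier (free_algebra c X)"
proof -
  have "{w. trunc \<alpha> f w \<noteq> 0} \<subseteq> words_below \<alpha>" by (auto simp: trunc_def)
  thus ?thesis using finite_words_below[of \<alpha>]
    by (auto simp: carrier_free_algebra_iff words_below_def intro: finite_subset)
qed

lemma trunc_in_span: "trunc \<alpha> f \<in> fv.span (wmon ` words_below \<alpha>)"
  by (rule expand_in_span[OF finite_words_below]) (auto simp: trunc_def split: if_splits)

lemma trunc_snoc:
  assumes "x \<in> X"
  shows "trunc \<alpha> (conv f (wmon [x])) = conv (trunc (\<alpha> - d x) f) (wmon [x])"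
proof
  fix w
  show "trunc \<alpha> (conv f (wmon [x])) w = conv (trunc (\<alpha> - d x) f) (wmon [x]) w"
    using assms
    by (cases w rule: rev_cases) (auto simp: trunc_def words_below_def)
qed

lemma trunc_conv_right: "trunc \<alpha> (conv f (trunc \<alpha> g)) = trunc \<alpha> (conv f g)"
proof
  fix w
  have "conv f (trunc \<alpha> g) w = conv f g w" if w: "w \<in> words_below \<alpha>"
    unfolding conv_def
  proof (intro sum.cong refl)
    fix i
    have "take i w \<in> lists X" "drop i w \<in> lists X"
      using w take_drop_lists[of w X i] by (auto simp: words_below_def)
    moreover have "wt w = wt (take i w) + wt (drop i w)"
      by (metis append_take_drop_id map_append sum_list_append)
    ultimately have "drop i w \<in> words_below \<alpha>"
      using w wt_nonneg[of "take i w"] by (auto simp: words_below_def)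
    thus "f (take i w) * trunc \<alpha> g (drop i w) = f (take i w) * g (drop i w)"
      by (simp add: trunc_def)
  qed
  thus "trunc \<alpha> (conv f (trunc \<alpha> g)) w = trunc \<alpha> (conv f g) w"
    by (simp add: trunc_def)
qed

text \<open>The factor \<open>s\<close> already uses up weight at least \<open>D s\<close>, so only
  words of \<open>f\<close> below \<alpha> - D s can reach a word below \<alpha>.\<close>

lemma trunc_conv_left:
  assumes s: "s \<in> S"
  shows "trunc \<alpha> (conv (trunc (\<alpha> - D s) f) s) = trunc \<alpha> (conv f s)"
proof
  fix w
  have "conv (trunc (\<alpha> - D s) f) s w = conv f s w" if w: "w \<in> words_below \<alpha>"
    unfolding conv_def
  proof (intro sum.cong refl)
    fix i
    show "trunc (\<alpha> - D s) f (take i w) * s (drop i w) = f (take i w) * s (drop i w)"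
    proof (cases "s (drop i w) = 0")
      case False
      have "take i w \<in> lists X"
        using w take_drop_lists[of w X i] by (auto simp: words_below_def)
      moreover have "wt w = wt (take i w) + wt (drop i w)"
        by (metis append_take_drop_id map_append sum_list_append)
      ultimately have "take i w \<in> words_below (\<alpha> - D s)"
        using w S_weight[OF s False] by (auto simp: words_below_def)
      thus ?thesis by (simp add: trunc_def)
    qed simp
  qed
  thus "trunc \<alpha> (conv (trunc (\<alpha> - D s) f) s) w = trunc \<alpha> (conv f s) w"
    by (simp add: trunc_def)
qed

lemma subspace_trunc_ideal: "fv.subspace (trunc_ideal \<alpha>)"
  unfolding trunc_ideal_def by (rule subspace_lin_image[OF lin_trunc subspace_word_ideal])

text \<open>\<open>word_ideal\<close> is stable under polynomials only, but truncation hides the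
  difference: the right factor may be replaced by its own truncation. This admits the series that
  arise when the last letter of a relation is stripped.\<close>

lemma trunc_conv_ideal:
  assumes "j \<in> word_ideal X S"
  shows "trunc \<alpha> (conv j g) \<in> trunc_ideal \<alpha>"
proof -
  have "conv j (trunc \<alpha> g) \<in> word_ideal X S"
    using word_ideal_right[OF assms trunc_closed] .
  thus ?thesis
    unfolding trunc_ideal_def by (metis trunc_conv_right image_eqI)
qed

text \<open>Since \<open>s\<close> has no constant term, each of its words ends in a letter;
  \<open>\<lambda>v. s (v @ [x])\<close> is the right derivative of \<open>s\<close> by
  \<open>x\<close>. For \<open>f\<close> in the ideal I this places \<open>f s\<close>, up to
  truncation, in the sum of the right multiples I x.\<close>

lemma split_last_letter:
  assumes s: "s \<in> S"
  shows "conv f s = (\<Sum>x\<in>X. conv (conv f (\<lambda>v. s (v @ [x]))) (wmon [x]))"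
proof
  fix w
  show "conv f s w = (\<Sum>x\<in>X. conv (conv f (\<lambda>v. s (v @ [x]))) (wmon [x])) w"
  proof (cases w rule: rev_cases)
    case Nil
    thus ?thesis using S_const[OF s] by (simp add: sum_fun_apply)
  next
    case (snoc v y)
    have "(\<Sum>x\<in>X. conv (conv f (\<lambda>v. s (v @ [x]))) (wmon [x])) w =
        (\<Sum>x\<in>X. if x = y then conv f (\<lambda>v. s (v @ [x])) v else 0)"
      by (simp add: sum_fun_apply snoc)
    also have "\<dots> = (if y \<in> X then conv f (\<lambda>v. s (v @ [y])) v else 0)"
      using finite_X by (simp add: sum.delta)
    also have "\<dots> = conv f (\<lambda>v. s (v @ [y])) v"
    proof (cases "y \<in> X")
      case False
      hence "s (u @ [y]) = 0" for u
        using s S_carrier carrier_outside[of s True X "u @ [y]"] by auto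
      thus ?thesis using False by (simp add: conv_def)
    qed simp
    also have "\<dots> = conv f s w"
      using S_const[OF s] by (simp add: snoc conv_snoc)
    finally show ?thesis ..
  qed
qed

section \<open>Normal words and codimensions\<close>

lemma wmon_eq_iff [simp]: "(wmon u :: 'x list \<Rightarrow> 'k) = wmon v \<longleftrightarrow> u = v"
  by (auto simp: wmon_def fun_eq_iff split: if_splits)

lemma independent_wmon: "fv.independent (wmon ` W :: ('x list \<Rightarrow> 'k) set)"
  unfolding fv.independent_explicit_module
proof (intro allI impI)
  fix t u and v :: "'x list \<Rightarrow> 'k"
  assume t: "finite t" "t \<subseteq> wmon ` W" "(\<Sum>v\<in>t. (\<lambda>w. u v * v w)) = 0" "v \<in> t"
  then obtain w where w: "v = wmon w" by auto
  have "0 = (\<Sum>v\<in>t. (\<lambda>w. u v * v w)) w" by (simp add: t(3))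
  also have "\<dots> = (\<Sum>v'\<in>t. if v' = v then u v' else 0)"
    unfolding sum_fun_apply
  proof (intro sum.cong refl)
    fix v' assume "v' \<in> t"
    then obtain w' where "v' = wmon w'" using t(2) by auto
    thus "u v' * v' w = (if v' = v then u v' else 0)"
      by (simp add: w) (simp add: wmon_def)
  qed
  also have "\<dots> = u v" using t by simp
  finally show "u v = 0" ..
qed

lemma card_wmon: "card (wmon ` W :: ('x list \<Rightarrow> 'k) set) = card W"
  by (rule card_image) (auto simp: inj_on_def)

text \<open>A basis \<open>Z\<close> of the truncated ideal is completed by monomials to a basis of
  the span of all words below \<alpha>; the words \<open>B\<close> that are added represent a basis
  of the quotient.\<close>

lemma trunc_ideal_basis:
  obtains Z B where "Z \<subseteq> trunc_ideal \<alpha>" "finite Z" "trunc_ideal \<alpha> = fv.span Z"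
    "card Z = fv.dim (trunc_ideal \<alpha>)"
    "B \<subseteq> words_below \<alpha>" "card B = codim \<alpha>" "wmon ` B \<inter> Z = {}" "fv.independent (Z \<union> wmon ` B)"
    "wmon ` words_below \<alpha> \<subseteq> fv.span (Z \<union> wmon ` B)"
    "card (words_below \<alpha>) = fv.dim (trunc_ideal \<alpha>) + codim \<alpha>"
proof -
  let ?U = "trunc_ideal \<alpha>" and ?W = "words_below \<alpha>"
  let ?M = "wmon ` ?W :: ('x list \<Rightarrow> 'k) set"
  obtain Z where Z: "Z \<subseteq> ?U" "fv.independent Z" "?U \<subseteq> fv.span Z" "card Z = fv.dim ?U"
    using fv.basis_exists by blast
  have U: "?U \<subseteq> fv.span ?M"
    unfolding trunc_ideal_def using trunc_in_span by auto
  have Zfin: "finite Z"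
    using fv.independent_span_bound[of ?M Z] Z U finite_words_below by auto
  have ZU: "?U = fv.span Z"
    using Z fv.span_minimal[OF Z(1) subspace_trunc_ideal] by auto
  obtain B' where B': "Z \<subseteq> B'" "B' \<subseteq> Z \<union> ?M" "fv.independent B'" "Z \<union> ?M \<subseteq> fv.span B'"
    using fv.maximal_independent_subset_extend[of Z "Z \<union> ?M"] Z(2) by blast
  define B where "B = {w \<in> ?W. wmon w \<in> B' - Z}"
  have BB: "B' = Z \<union> wmon ` B"
    using B' by (auto simp: B_def)
  have disj: "wmon ` B \<inter> Z = {}" by (auto simp: B_def)
  have "fv.span B' \<subseteq> fv.span ?M"
    using B'(2) Z(1) U by (intro fv.span_minimal fv.subspace_span) (auto intro: fv.span_base)
  moreover have "fv.span ?M \<subseteq> fv.span B'"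
    using B'(4) by (intro fv.span_minimal fv.subspace_span) auto
  ultimately have "fv.span B' = fv.span ?M" by auto
  hence "card B' = card ?M"
    using fv.dim_eq_card[of B' ?M] B'(3) fv.dim_eq_card_independent[OF independent_wmon, of ?W] by simp
  hence "card B' = card ?W" by (simp add: card_wmon)
  moreover have "finite B" using finite_words_below by (simp add: B_def)
  hence "card B' = card Z + card B"
    unfolding BB using disj Zfin by (subst card_Un_disjoint) (auto simp: card_wmon)
  ultimately have "card ?W = fv.dim ?U + card B" using Z(4) by simp
  hence cod: "card B = codim \<alpha>" "card ?W = fv.dim ?U + codim \<alpha>" by (simp_all add: codim_def)
  have sub: "B \<subseteq> ?W" by (auto simp: B_def)
  have ind: "fv.independent (Z \<union> wmon ` B)" using B'(3) unfolding BB .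
  have spn: "?M \<subseteq> fv.span (Z \<union> wmon ` B)" using B'(4) unfolding BB by blast
  show ?thesis
    by (rule that[OF Z(1) Zfin ZU Z(4) sub cod(1) disj ind spn cod(2)])
qed

text \<open>A combination of the words \<open>B\<close> inside the truncated ideal has coordinates
  in \<open>Z\<close> only and also in \<open>B\<close> only, hence none at all. The images of these
  words in the algebra give the lower bound for growth.\<close>

lemma normal_words:
  obtains B where "B \<subseteq> words_below \<alpha>" "card B = codim \<alpha>"
    "\<And>f. (\<And>w. f w \<noteq> 0 \<Longrightarrow> w \<in> B) \<Longrightarrow> f \<in> trunc_ideal \<alpha> \<Longrightarrow> f = 0"
proof -
  obtain Z B where B: "B \<subseteq> words_below \<alpha>" "card B = codim \<alpha>" "trunc_ideal \<alpha> = fv.span Z"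
    "wmon ` B \<inter> Z = {}" "fv.independent (Z \<union> wmon ` B)"
    using trunc_ideal_basis by metis
  have "f = 0" if f: "\<And>w. f w \<noteq> 0 \<Longrightarrow> w \<in> B" "f \<in> trunc_ideal \<alpha>" for f
  proof -
    let ?A = "Z \<union> wmon ` B"
    have fB: "f \<in> fv.span (wmon ` B)"
      using expand_in_span[of B f] f(1) B(1) finite_words_below finite_subset by blast
    have fZ: "f \<in> fv.span Z" using f(2) B(3) by simp
    have "fv.representation ?A f b = 0" for b
    proof (rule ccontr)
      assume nz: "fv.representation ?A f b \<noteq> 0"
      have "b \<in> Z"
        using nz fv.representation_extend[OF B(5) fZ] fv.representation_ne_zero[of Z f b] by auto
      moreover have "b \<in> wmon ` B"
        using nz fv.representation_extend[OF B(5) fB] fv.representation_ne_zero[of "wmon ` B" f b] by auto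
      ultimately show False using B(4) by auto
    qed
    moreover have "f \<in> fv.span ?A" using fZ fv.span_mono[of Z ?A] by auto
    ultimately show ?thesis
      using fv.sum_nonzero_representation_eq[OF B(5), of f] by simp
  qed
  thus ?thesis using that B(1,2) by blast
qed

lemma codim_nonpos: "\<alpha> \<le> 0 \<Longrightarrow> codim \<alpha> = 0"
  by (simp add: codim_def words_below_empty)

text \<open>Truncating at \<beta> instead of \<alpha> changes an element of the ideal only by words
  of weight between \<alpha> and \<beta>, so the ideal gains at most as many dimensions as the space
  of words does.\<close>

lemma codim_mono:
  assumes "\<alpha> \<le> \<beta>"
  shows "codim \<alpha> \<le> codim \<beta>"
proof -
  obtain Z where Z: "finite Z" "trunc_ideal \<alpha> = fv.span Z" "card Z = fv.dim (trunc_ideal \<alpha>)"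
    and a: "card (words_below \<alpha>) = fv.dim (trunc_ideal \<alpha>) + codim \<alpha>"
    using trunc_ideal_basis by metis
  have b: "card (words_below \<beta>) = fv.dim (trunc_ideal \<beta>) + codim \<beta>"
    using trunc_ideal_basis by metis
  let ?N = "wmon ` (words_below \<beta> - words_below \<alpha>) :: ('x list \<Rightarrow> 'k) set"
  have "trunc_ideal \<beta> \<subseteq> fv.span (Z \<union> ?N)"
  proof
    fix f assume "f \<in> trunc_ideal \<beta>"
    then obtain j where j: "j \<in> word_ideal X S" "f = trunc \<beta> j" by (auto simp: trunc_ideal_def)
    have "trunc \<alpha> j \<in> fv.span Z" using j Z(2) by (auto simp: trunc_ideal_def)
    hence 1: "trunc \<alpha> j \<in> fv.span (Z \<union> ?N)" using fv.span_mono[of Z "Z \<union> ?N"] by auto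
    have "f - trunc \<alpha> j \<in> fv.span ?N"
      using finite_words_below words_below_mono[OF assms]
      by (intro expand_in_span) (auto simp: j(2) trunc_def split: if_splits)
    hence 2: "f - trunc \<alpha> j \<in> fv.span (Z \<union> ?N)" using fv.span_mono[of ?N "Z \<union> ?N"] by auto
    show "f \<in> fv.span (Z \<union> ?N)" using fv.span_add[OF 1 2] by simp
  qed
  hence "fv.dim (trunc_ideal \<beta>) \<le> card (Z \<union> ?N)"
    using Z(1) finite_words_below by (intro fv.dim_le_card) auto
  also have "\<dots> \<le> card Z + card ?N" by (rule card_Un_le)
  also have "card ?N = card (words_below \<beta>) - card (words_below \<alpha>)"
    by (simp add: card_wmon card_Diff_subset finite_words_below words_below_mono[OF assms])
  finally show ?thesis
    using a b Z(3) card_mono[OF finite_words_below words_below_mono[OF assms]] by linarith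
qed

section \<open>The recursion for the codimensions\<close>

lemma card_words_below:
  assumes "\<alpha> > 0"
  shows "card (words_below \<alpha>) = 1 + (\<Sum>x\<in>X. card (words_below (\<alpha> - d x)))"
proof -
  let ?E = "\<lambda>x. (\<lambda>w. w @ [x]) ` words_below (\<alpha> - d x)"
  have "words_below \<alpha> = insert [] (\<Union>x\<in>X. ?E x)"
  proof (intro Set.set_eqI iffI)
    fix w assume w: "w \<in> words_below \<alpha>"
    show "w \<in> insert [] (\<Union>x\<in>X. ?E x)"
    proof (cases w rule: rev_cases)
      case (snoc v x)
      hence "x \<in> X" "v \<in> words_below (\<alpha> - d x)" using w by (auto simp: words_below_def)
      thus ?thesis using snoc by auto
    qed simp
  qed (use assms in \<open>auto simp: words_below_def\<close>)
  moreover have "card (insert [] (\<Union>x\<in>X. ?E x)) = Suc (card (\<Union>x\<in>X. ?E x))"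
    using finite_X finite_words_below by (intro card_insert_disjoint) auto
  moreover have "card (\<Union>x\<in>X. ?E x) = (\<Sum>x\<in>X. card (?E x))"
    using finite_X finite_words_below by (intro card_UN_disjoint) auto
  moreover have "card (?E x) = card (words_below (\<alpha> - d x))" for x
    by (rule card_image) (auto simp: inj_on_def)
  ultimately show ?thesis by simp
qed

text \<open>The Golod--Shafarevich inequality in cumulative form. A relation \<open>u s v\<close> with \<open>v\<close> nonempty
  lies in the span of the \<open>I x\<close>; for \<open>v\<close> empty, \<open>u\<close> matters only modulo \<open>I\<close>, because \<open>s\<close> has no
  constant term.\<close>

lemma codim_recursion:
  assumes "\<alpha> > 0" and T: "T \<subseteq> S" "finite T" and small: "\<And>s. s \<in> S - T \<Longrightarrow> s = 0 \<or> \<alpha> \<le> D s"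
  shows "1 + (\<Sum>x\<in>X. codim (\<alpha> - d x)) \<le> codim \<alpha> + (\<Sum>s\<in>T. codim (\<alpha> - D s))"
proof -
  \<comment> \<open>Bases are chosen for all thresholds at once, since the recursion compares
    \<alpha> with the shifted thresholds \<alpha> - d x and \<alpha> - D s.\<close>
  have "\<forall>\<alpha>. \<exists>Z B. finite Z \<and> trunc_ideal \<alpha> = fv.span Z \<and> card Z = fv.dim (trunc_ideal \<alpha>) \<and>
    B \<subseteq> words_below \<alpha> \<and> card B = codim \<alpha> \<and> wmon ` words_below \<alpha> \<subseteq> fv.span (Z \<union> wmon ` B) \<and>
    card (words_below \<alpha>) = fv.dim (trunc_ideal \<alpha>) + codim \<alpha>"
  proof
    fix \<alpha>
    show "\<exists>Z B. finite Z \<and> trunc_ideal \<alpha> = fv.span Z \<and> card Z = fv.dim (trunc_ideal \<alpha>) \<and>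
      B \<subseteq> words_below \<alpha> \<and> card B = codim \<alpha> \<and> wmon ` words_below \<alpha> \<subseteq> fv.span (Z \<union> wmon ` B) \<and>
      card (words_below \<alpha>) = fv.dim (trunc_ideal \<alpha>) + codim \<alpha>"
      by (rule trunc_ideal_basis[of \<alpha>]) blast
  qed
  then obtain Z B where ZB: "\<And>\<alpha>. finite (Z \<alpha>)" "\<And>\<alpha>. trunc_ideal \<alpha> = fv.span (Z \<alpha>)"
    "\<And>\<alpha>. card (Z \<alpha>) = fv.dim (trunc_ideal \<alpha>)" "\<And>\<alpha>. B \<alpha> \<subseteq> words_below \<alpha>" "\<And>\<alpha>. card (B \<alpha>) = codim \<alpha>"
    "\<And>\<alpha>. wmon ` words_below \<alpha> \<subseteq> fv.span (Z \<alpha> \<union> wmon ` B \<alpha>)"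
    "\<And>\<alpha>. card (words_below \<alpha>) = fv.dim (trunc_ideal \<alpha>) + codim \<alpha>"
    by metis
  have finB: "finite (B \<beta>)" for \<beta> using ZB(4) finite_words_below finite_subset by blast
  let ?P = "\<Union>x\<in>X. (\<lambda>f. conv f (wmon [x])) ` Z (\<alpha> - d x)"
  let ?Q = "\<Union>s\<in>T. (\<lambda>w. trunc \<alpha> (conv (wmon w) s)) ` B (\<alpha> - D s)"
  let ?A = "?P \<union> ?Q"
  have fin: "finite ?A" using finite_X T(2) ZB(1) finB by auto
  have P: "trunc \<alpha> (conv f (wmon [x])) \<in> fv.span ?A"
    if x: "x \<in> X" and f: "trunc (\<alpha> - d x) f \<in> trunc_ideal (\<alpha> - d x)" for x f
  proof -
    have "trunc (\<alpha> - d x) f \<in> fv.span (Z (\<alpha> - d x))" using f ZB(2) by simp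
    hence "conv (trunc (\<alpha> - d x) f) (wmon [x]) \<in> fv.span ?A"
      by (rule lin_span[OF lin_conv_left]) (use x in \<open>auto intro!: fv.span_base\<close>)
    thus ?thesis by (simp add: trunc_snoc[OF x])
  qed
  have J: "trunc \<alpha> (conv j s) \<in> fv.span ?A" if j: "j \<in> word_ideal X S" and s: "s \<in> S" for j s
    unfolding split_last_letter[OF s] lin_sum[OF lin_trunc]
    by (intro fv.span_sum P trunc_conv_ideal j)
  have Q: "trunc \<alpha> (conv f s) \<in> fv.span ?A" if s: "s \<in> S" for f s
  proof (cases "s \<in> T")
    case True
    have lin: "lin (\<lambda>f. trunc \<alpha> (conv f s))"
      using linD(1,2)[OF lin_trunc] by (simp add: lin_def conv_add_left conv_scale_left)
    have "trunc \<alpha> (conv b s) \<in> fv.span ?A" if b: "b \<in> Z (\<alpha> - D s) \<union> wmon ` B (\<alpha> - D s)" for b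
    proof (cases "b \<in> Z (\<alpha> - D s)")
      case b: True
      hence "b \<in> trunc_ideal (\<alpha> - D s)" using ZB(2) by (simp add: fv.span_base)
      then obtain j where "j \<in> word_ideal X S" "b = trunc (\<alpha> - D s) j" by (auto simp: trunc_ideal_def)
      thus ?thesis using J[OF _ s] by (simp add: trunc_conv_left[OF s])
    next
      case False
      thus ?thesis using b True by (intro fv.span_base) auto
    qed
    hence "fv.span (Z (\<alpha> - D s) \<union> wmon ` B (\<alpha> - D s)) \<subseteq> {f. trunc \<alpha> (conv f s) \<in> fv.span ?A}"
      by (intro fv.span_minimal subspace_lin_preimage[OF lin]) auto
    moreover have "trunc (\<alpha> - D s) f \<in> fv.span (Z (\<alpha> - D s) \<union> wmon ` B (\<alpha> - D s))"
      using trunc_in_span[of "\<alpha> - D s" f] ZB(6)[of "\<alpha> - D s"]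
        fv.span_minimal[OF ZB(6)[of "\<alpha> - D s"] fv.subspace_span] by blast
    ultimately have "trunc \<alpha> (conv (trunc (\<alpha> - D s) f) s) \<in> fv.span ?A" by blast
    thus ?thesis by (simp add: trunc_conv_left[OF s])
  next
    case False
    \<comment> \<open>A relation outside \<open>T\<close> has no word below \<alpha>, so its
      multiples disappear under truncation.\<close>
    have "trunc \<alpha> (conv f s) = 0"
    proof (cases "s = 0")
      case s0: False
      have "words_below (\<alpha> - D s) = {}"
        using small[of s] s False s0 by (intro words_below_empty) auto
      hence "trunc (\<alpha> - D s) f = 0" by (simp add: trunc_def fun_eq_iff)
      hence "trunc \<alpha> (conv (trunc (\<alpha> - D s) f) s) = 0"
        by (simp add: linD(3)[OF lin_trunc])
      thus ?thesis by (simp add: trunc_conv_left[OF s])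
    qed (simp add: linD(3)[OF lin_trunc])
    thus ?thesis by (simp only: fv.span_zero)
  qed
  have "trunc_ideal \<alpha> \<subseteq> fv.span ?A"
  proof
    fix f assume "f \<in> trunc_ideal \<alpha>"
    then obtain j where j: "j \<in> word_ideal X S" "f = trunc \<alpha> j" by (auto simp: trunc_ideal_def)
    have "trunc \<alpha> j \<in> fv.span ?A"
    proof (rule word_ideal_lin[OF lin_trunc j(1) fv.subspace_span])
      fix u v s assume *: "u \<in> lists X" "v \<in> lists X" "s \<in> S"
      show "trunc \<alpha> (conv (wmon u) (conv s (wmon v))) \<in> fv.span ?A"
      proof (cases v rule: rev_cases)
        case Nil
        thus ?thesis using Q[OF *(3)] by simp
      next
        case (snoc v' x)
        hence eq: "conv (wmon u) (conv s (wmon v)) = conv (conv (wmon u) (conv s (wmon v'))) (wmon [x])"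
          by (simp add: conv_assoc conv_wmon_wmon)
        have "conv (wmon u) (conv s (wmon v')) \<in> word_ideal X S"
          using * snoc by (intro word_idealI) auto
        thus ?thesis unfolding eq using * snoc
          by (intro P) (auto simp: trunc_ideal_def)
      qed
    qed
    thus "f \<in> fv.span ?A" by (simp add: j(2))
  qed
  hence "fv.dim (trunc_ideal \<alpha>) \<le> card ?A" using fin by (rule fv.dim_le_card)
  also have "\<dots> \<le> card ?P + card ?Q" by (rule card_Un_le)
  also have "card ?P \<le> (\<Sum>x\<in>X. card ((\<lambda>f. conv f (wmon [x])) ` Z (\<alpha> - d x)))"
    by (rule card_UN_le[OF finite_X])
  also have "\<dots> \<le> (\<Sum>x\<in>X. fv.dim (trunc_ideal (\<alpha> - d x)))"
    by (intro sum_mono) (metis ZB(1,3) card_image_le)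
  also have "card ?Q \<le> (\<Sum>s\<in>T. card ((\<lambda>w. trunc \<alpha> (conv (wmon w) s)) ` B (\<alpha> - D s)))"
    by (rule card_UN_le[OF T(2)])
  also have "\<dots> \<le> (\<Sum>s\<in>T. codim (\<alpha> - D s))"
    by (intro sum_mono) (metis finB ZB(5) card_image_le)
  finally have *: "fv.dim (trunc_ideal \<alpha>) \<le>
    (\<Sum>x\<in>X. fv.dim (trunc_ideal (\<alpha> - d x))) + (\<Sum>s\<in>T. codim (\<alpha> - D s))" by simp
  \<comment> \<open>Counting words by their last letter turns the upper bound for the ideal into a
    lower bound for its codimension; the dimensions at the thresholds \<alpha> - d x cancel.\<close>
  have "fv.dim (trunc_ideal \<alpha>) + codim \<alpha> = 1 + (\<Sum>x\<in>X. card (words_below (\<alpha> - d x)))"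
    using card_words_below[OF assms(1)] ZB(7)[of \<alpha>] by simp
  also have "\<dots> = 1 + (\<Sum>x\<in>X. fv.dim (trunc_ideal (\<alpha> - d x))) + (\<Sum>x\<in>X. codim (\<alpha> - d x))"
    by (subst ZB(7)) (simp add: sum.distrib)
  finally show ?thesis using * by linarith
qed

end

section \<open>Divergence of the integral and growth\<close>

text \<open>The recursion is available up to a cutoff, with a finite set of relations depending on
  it; bounds uniform in the cutoff pass to the whole line by monotone convergence.\<close>

lemma nn_integral_halfline_bound:
  fixes f :: "real \<Rightarrow> ennreal"
  assumes [measurable]: "f \<in> borel_measurable borel"
    and le: "\<And>n::nat. (\<integral>\<^sup>+x. f x * indicator {..real n} x \<partial>lborel) \<le> C"
  shows "(\<integral>\<^sup>+x. f x \<partial>lborel) \<le> C"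
proof -
  have "(SUP n. f x * indicator {..real n} x) = f x" for x
  proof (rule antisym)
    show "(SUP n. f x * indicator {..real n} x) \<le> f x"
      by (intro SUP_least) (auto simp: indicator_def)
    obtain n where "x \<le> real n" using real_arch_simple by blast
    thus "f x \<le> (SUP n. f x * indicator {..real n} x)"
      by (intro SUP_upper2[of n]) auto
  qed
  hence "(\<integral>\<^sup>+x. f x \<partial>lborel) = (\<integral>\<^sup>+x. (SUP n. f x * indicator {..real n} x) \<partial>lborel)"
    by simp
  also have "\<dots> = (SUP n. \<integral>\<^sup>+x. f x * indicator {..real n} x \<partial>lborel)"
    by (intro nn_integral_monotone_convergence_SUP)
      (auto simp: incseq_def le_fun_def indicator_def)
  also have "\<dots> \<le> C" by (intro SUP_least le)
  finally show ?thesis .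
qed

text \<open>Let G be the integral and H the sum over the generators. Translating \<open>a\<close> by
  t multiplies its integral by z^t, so the integrated recursion reads z + H G \<le> (1 + sum of z^D)
  G \<le> H G, which is absurd for finite G. The set \<open>T\<close> may vary with \<open>K\<close>
  because the last bound is the same for all of them.\<close>

lemma recursion_integral_infinite:
  fixes a :: "real \<Rightarrow> nat" and z :: real and d :: "'x \<Rightarrow> real" and D :: "'s \<Rightarrow> real"
  assumes X: "finite X" "\<And>x. x \<in> X \<Longrightarrow> 0 < d x"
    and a: "mono a" "\<And>\<alpha>. \<alpha> \<le> 0 \<Longrightarrow> a \<alpha> = 0"
    and z: "0 < z" "z < 1"
    and rec: "\<And>K. \<exists>T. finite T \<and> (\<Sum>s\<in>T. z powr D s) \<le> (\<Sum>x\<in>X. z powr d x) - 1 \<and>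
      (\<forall>\<alpha>. 0 < \<alpha> \<longrightarrow> \<alpha> \<le> K \<longrightarrow> 1 + (\<Sum>x\<in>X. a (\<alpha> - d x)) \<le> a \<alpha> + (\<Sum>s\<in>T. a (\<alpha> - D s)))"
  shows "(\<integral>\<^sup>+\<alpha>. ennreal (real (a \<alpha>) * z powr \<alpha>) \<partial>lborel) = \<infinity>"
proof (rule ccontr)
  let ?g = "\<lambda>\<alpha>. ennreal (real (a \<alpha>) * z powr \<alpha>)"
  let ?s = "\<lambda>t \<alpha>. ennreal (real (a (\<alpha> - t)) * z powr \<alpha>)"
  define G where "G = (\<integral>\<^sup>+\<alpha>. ?g \<alpha> \<partial>lborel)"
  define H where "H = (\<Sum>x\<in>X. z powr d x)"
  have H0: "0 \<le> H" by (simp add: H_def sum_nonneg)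
  assume "(\<integral>\<^sup>+\<alpha>. ?g \<alpha> \<partial>lborel) \<noteq> \<infinity>"
  hence G: "G < \<infinity>" by (simp add: G_def top.not_eq_extremum)
  have "mono (\<lambda>\<alpha>. real (a \<alpha>))" using a(1) by (auto simp: mono_def)
  hence [measurable]: "(\<lambda>\<alpha>. real (a \<alpha>)) \<in> borel_measurable borel"
    by (rule borel_measurable_mono)
  have shift: "(\<integral>\<^sup>+\<alpha>. ?s t \<alpha> \<partial>lborel) = ennreal (z powr t) * G" for t
  proof -
    have "(\<integral>\<^sup>+\<alpha>. ?s t \<alpha> \<partial>lborel) = (\<integral>\<^sup>+\<alpha>. ?s t (t + 1 * \<alpha>) \<partial>lborel)"
      by (subst nn_integral_real_affine[of _ 1 t]) simp_all
    also have "\<dots> = (\<integral>\<^sup>+\<alpha>. ennreal (z powr t) * ?g \<alpha> \<partial>lborel)"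
    proof (intro nn_integral_cong)
      fix \<alpha>
      have "real (a (t + 1 * \<alpha> - t)) * z powr (t + 1 * \<alpha>) = z powr t * (real (a \<alpha>) * z powr \<alpha>)"
        by (simp add: powr_add)
      thus "?s t (t + 1 * \<alpha>) = ennreal (z powr t) * ?g \<alpha>"
        by (simp only: ennreal_mult' powr_ge_zero)
    qed
    also have "\<dots> = ennreal (z powr t) * G"
      unfolding G_def by (intro nn_integral_cmult) simp
    finally show ?thesis .
  qed
  \<comment> \<open>The constant 1 of the recursion contributes z^\<alpha>. On (0,1] this is at
    least \<open>z\<close>, which leaves a step function with integral \<open>z\<close>.\<close>
  let ?L = "\<lambda>\<alpha>. ennreal z * indicator {0<..1} \<alpha> + (\<Sum>x\<in>X. ?s (d x) \<alpha>)"
  have bound: "(\<integral>\<^sup>+\<alpha>. ?L \<alpha> * indicator {..real n} \<alpha> \<partial>lborel) \<le> ennreal H * G" for n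
  proof -
    obtain T where T: "finite T" "(\<Sum>s\<in>T. z powr D s) \<le> H - 1"
      "\<And>\<alpha>. 0 < \<alpha> \<Longrightarrow> \<alpha> \<le> real n \<Longrightarrow> 1 + (\<Sum>x\<in>X. a (\<alpha> - d x)) \<le> a \<alpha> + (\<Sum>s\<in>T. a (\<alpha> - D s))"
      using rec[of "real n"] unfolding H_def by blast
    have "?L \<alpha> * indicator {..real n} \<alpha> \<le> ?g \<alpha> + (\<Sum>s\<in>T. ?s (D s) \<alpha>)" for \<alpha>
    proof (cases "0 < \<alpha> \<and> \<alpha> \<le> real n")
      case True
      have "z * indicator {0<..1} \<alpha> \<le> z powr \<alpha>"
        using z powr_mono'[of \<alpha> 1 z] True by (auto simp: indicator_def)
      hence "z * indicator {0<..1} \<alpha> + (\<Sum>x\<in>X. real (a (\<alpha> - d x)) * z powr \<alpha>) \<le>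
          real (1 + (\<Sum>x\<in>X. a (\<alpha> - d x))) * z powr \<alpha>"
        by (simp add: algebra_simps sum_distrib_left)
      also have "\<dots> \<le> real (a \<alpha> + (\<Sum>s\<in>T. a (\<alpha> - D s))) * z powr \<alpha>"
        using T(3)[of \<alpha>] True by (intro mult_right_mono of_nat_mono) auto
      also have "\<dots> = real (a \<alpha>) * z powr \<alpha> + (\<Sum>s\<in>T. real (a (\<alpha> - D s)) * z powr \<alpha>)"
        by (simp add: algebra_simps sum_distrib_left)
      finally have "ennreal (z * indicator {0<..1} \<alpha> + (\<Sum>x\<in>X. real (a (\<alpha> - d x)) * z powr \<alpha>)) \<le>
          ennreal (real (a \<alpha>) * z powr \<alpha> + (\<Sum>s\<in>T. real (a (\<alpha> - D s)) * z powr \<alpha>))"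
        by (rule ennreal_leI)
      moreover have "?L \<alpha> = ennreal (z * indicator {0<..1} \<alpha> + (\<Sum>x\<in>X. real (a (\<alpha> - d x)) * z powr \<alpha>))"
        using z by (subst ennreal_plus) (auto simp: sum_nonneg indicator_def sum_ennreal)
      ultimately show ?thesis using True
        by (simp add: sum_nonneg sum_ennreal)
    next
      case False
      have "?L \<alpha> * indicator {..real n} \<alpha> = 0"
      proof (cases "\<alpha> \<le> real n")
        case True
        hence "\<alpha> \<le> 0" using False by auto
        moreover have "a (\<alpha> - d x) = 0" if "x \<in> X" for x
          using X(2)[OF that] \<open>\<alpha> \<le> 0\<close> by (intro a(2)) auto
        ultimately show ?thesis by (simp add: indicator_def)
      qed simp
      thus ?thesis by (simp only: zero_le)
    qed
    hence "(\<integral>\<^sup>+\<alpha>. ?L \<alpha> * indicator {..real n} \<alpha> \<partial>lborel) \<le> (\<integral>\<^sup>+\<alpha>. ?g \<alpha> + (\<Sum>s\<in>T. ?s (D s) \<alpha>) \<partial>lborel)"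
      by (rule nn_integral_mono)
    also have "\<dots> = G + (\<Sum>s\<in>T. ennreal (z powr D s) * G)"
      by (subst nn_integral_add) (simp_all add: nn_integral_sum shift G_def del: sum_ennreal)
    also have "\<dots> = (1 + (\<Sum>s\<in>T. ennreal (z powr D s))) * G"
      by (simp only: distrib_right sum_distrib_right mult_1_left)
    also have "1 + (\<Sum>s\<in>T. ennreal (z powr D s)) = ennreal (1 + (\<Sum>s\<in>T. z powr D s))"
      by (subst ennreal_plus) (simp_all add: sum_nonneg sum_ennreal)
    also have "ennreal (1 + (\<Sum>s\<in>T. z powr D s)) * G \<le> ennreal H * G"
      by (rule mult_right_mono[OF ennreal_leI]) (use T(2) in linarith, rule zero_le)
    finally show ?thesis .
  qed
  have "?L \<in> borel_measurable borel" by measurable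
  hence "(\<integral>\<^sup>+\<alpha>. ?L \<alpha> \<partial>lborel) \<le> ennreal H * G"
    by (rule nn_integral_halfline_bound) (rule bound)
  moreover have "(\<integral>\<^sup>+\<alpha>. ?L \<alpha> \<partial>lborel) = ennreal z + ennreal H * G"
  proof -
    have "(\<integral>\<^sup>+\<alpha>. ?L \<alpha> \<partial>lborel) = ennreal z + (\<Sum>x\<in>X. ennreal (z powr d x) * G)"
      by (subst nn_integral_add) (simp_all add: nn_integral_sum shift nn_integral_cmult del: sum_ennreal)
    also have "(\<Sum>x\<in>X. ennreal (z powr d x) * G) = (\<Sum>x\<in>X. ennreal (z powr d x)) * G"
      by (rule sum_distrib_right[symmetric])
    also have "(\<Sum>x\<in>X. ennreal (z powr d x)) = ennreal H"
      unfolding H_def by (intro sum_ennreal) simp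
    finally show ?thesis .
  qed
  ultimately have le: "ennreal z + ennreal H * G \<le> ennreal H * G" by simp
  have "ennreal H * G < \<infinity>" using G by (simp add: ennreal_mult_less_top)
  then obtain r where r: "0 \<le> r" "ennreal H * G = ennreal r"
    by (cases "ennreal H * G" rule: ennreal_cases) auto
  have "ennreal (z + r) \<le> ennreal r" using le r z by (simp add: ennreal_plus)
  thus False using r(1) z by (simp add: ennreal_le_iff)
qed

lemma powr_exp_decay_finite:
  fixes p :: real
  assumes p: "0 < p" "p < 1"
    and g: "g \<in> borel_measurable borel" "\<And>\<alpha>. g \<alpha> \<le> ennreal (C * p powr \<alpha>) * indicator {0..} \<alpha>"
    and C: "0 \<le> C"
  shows "(\<integral>\<^sup>+\<alpha>. g \<alpha> \<partial>lborel) < \<infinity>"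
proof -
  have "(\<integral>\<^sup>+\<alpha>. g \<alpha> \<partial>lborel) \<le> (\<integral>\<^sup>+\<alpha>. ennreal (C * p powr \<alpha>) * indicator {0..} \<alpha> \<partial>lborel)"
    by (intro nn_integral_mono g)
  also have "\<dots> = ennreal (0 - C * (p powr 0 / ln p))"
  proof (rule nn_integral_FTC_atLeast)
    show "((\<lambda>\<alpha>. C * (p powr \<alpha> / ln p)) has_real_derivative C * p powr x) (at x)" for x
      using p by (auto intro!: derivative_eq_intros)
    have "((\<lambda>\<alpha>. C * (p powr \<alpha> / ln p)) \<longlongrightarrow> C * (0 / ln p)) at_top"
      using p by (intro tendsto_intros) (real_asymp, simp)
    thus "((\<lambda>\<alpha>. C * (p powr \<alpha> / ln p)) \<longlongrightarrow> 0) at_top" by simp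
  qed (use C p in auto)
  also have "\<dots> < \<infinity>" by simp
  finally show ?thesis .
qed

text \<open>The limsup controls large n only; the constant \<open>C\<close> absorbs the finitely
  many remaining values.\<close>

lemma not_exponential_growthD:
  assumes "\<not> exponential_growth L Y" "q > 1"
  obtains C where "0 \<le> C" "\<And>n. real (growth L Y n) \<le> C * q ^ n"
proof -
  let ?h = "\<lambda>n. real (growth L Y n)"
  have "limsup (\<lambda>n. ereal (root n (?h n))) \<le> 1"
    using assms(1) by (simp only: exponential_growth_def not_less)
  also have "(1 :: ereal) < ereal q" using assms(2) by simp
  finally have "limsup (\<lambda>n. ereal (root n (?h n))) < ereal q" .
  hence "\<forall>\<^sub>F n in sequentially. ereal (root n (?h n)) < ereal q"
    by (rule Limsup_lessD)
  then obtain N where N: "\<And>n. n \<ge> N \<Longrightarrow> root n (?h n) < q"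
    by (auto simp: eventually_sequentially)
  \<comment> \<open>\<open>n \<ge> Suc N\<close> excludes n = 0, where \<open>root 0\<close> is 0
    and taking powers does not recover the value.\<close>
  have ev: "?h n \<le> q ^ n" if "n \<ge> Suc N" for n
  proof -
    have "?h n = root n (?h n) ^ n" using that by (simp add: real_root_pow_pos2)
    also have "\<dots> \<le> q ^ n"
      using N[of n] that by (intro power_mono) (auto simp: real_root_ge_zero)
    finally show ?thesis .
  qed
  define C where "C = 1 + (\<Sum>n\<le>N. ?h n)"
  have C1: "1 \<le> C" by (simp add: C_def sum_nonneg)
  show ?thesis
  proof
    show "0 \<le> C" using C1 by simp
    fix n
    show "?h n \<le> C * q ^ n"
    proof (cases "n \<le> N")
      case True
      hence "?h n \<le> C"
        using member_le_sum[of n "{..N}" ?h] by (simp add: C_def)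
      also have "\<dots> = C * 1" by simp
      also have "\<dots> \<le> C * q ^ n" using C1 assms(2) by (intro mult_left_mono) auto
      finally show ?thesis .
    next
      case False
      hence "?h n \<le> 1 * q ^ n" using ev by simp
      also have "\<dots> \<le> C * q ^ n" using C1 assms(2) by (intro mult_right_mono) auto
      finally show ?thesis .
    qed
  qed
qed

section \<open>Homomorphisms from free algebras, and lower bounds for growth\<close>

locale free_algebra_hom =
  fixes c :: bool and X :: "'x set" and L :: "('k::field, 'b) module" and h :: "('x list \<Rightarrow> 'k) \<Rightarrow> 'b"
  assumes ring_L: "ring L" and hom: "h \<in> alg_hom (free_algebra c X) L"
begin

abbreviation F :: "('x list \<Rightarrow> 'k) set" where "F \<equiv> carrier (free_algebra c X)"

sublocale L: ring L by (rule ring_L)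

lemma h_closed [simp]: "f \<in> F \<Longrightarrow> h f \<in> carrier L"
  using hom by (auto simp: alg_hom_def Ring.ring_hom_def)

lemma h_add: "f \<in> F \<Longrightarrow> g \<in> F \<Longrightarrow> h (f + g) = h f \<oplus>\<^bsub>L\<^esub> h g"
  using hom by (auto simp: alg_hom_def Ring.ring_hom_def free_algebra_simps)

lemma h_mult: "f \<in> F \<Longrightarrow> g \<in> F \<Longrightarrow> h (conv f g) = h f \<otimes>\<^bsub>L\<^esub> h g"
  using hom by (auto simp: alg_hom_def Ring.ring_hom_def free_algebra_simps)

lemma h_one: "h (wmon []) = \<one>\<^bsub>L\<^esub>"
  using hom by (auto simp: alg_hom_def Ring.ring_hom_def free_algebra_simps)

lemma h_scale: "f \<in> F \<Longrightarrow> h (\<lambda>w. a * f w) = a \<odot>\<^bsub>L\<^esub> h f"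
  using hom by (auto simp: alg_hom_def Ring.ring_hom_def free_algebra_simps)

lemma h_zero: "h 0 = \<zero>\<^bsub>L\<^esub>"
proof -
  have "h 0 = h 0 \<oplus>\<^bsub>L\<^esub> h 0"
    using h_add[of 0 0] by (simp del: plus_fun_apply zero_fun_apply)
  thus ?thesis using L.add.r_cancel_one'[of "h 0" "h 0"] by simp
qed

lemma h_eq_iff:
  assumes "f \<in> F" "g \<in> F"
  shows "h f = h g \<longleftrightarrow> h (f - g) = \<zero>\<^bsub>L\<^esub>"
proof -
  have fg: "f - g \<in> F" using assms by blast
  have "h f = h ((f - g) + g)" by simp
  also have "\<dots> = h (f - g) \<oplus>\<^bsub>L\<^esub> h g" by (rule h_add[OF fg assms(2)])
  finally have eq: "h f = h (f - g) \<oplus>\<^bsub>L\<^esub> h g" .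
  show ?thesis
  proof
    assume "h f = h g"
    hence "h g = h (f - g) \<oplus>\<^bsub>L\<^esub> h g" using eq by simp
    thus "h (f - g) = \<zero>\<^bsub>L\<^esub>"
      using L.add.r_cancel_one'[of "h g" "h (f - g)"] fg assms by simp
  qed (use eq assms in simp)
qed

lemma h_sum:
  assumes "\<And>i. i \<in> I \<Longrightarrow> f i \<in> F" "finite I"
  shows "h (\<Sum>i\<in>I. f i) = (\<Oplus>\<^bsub>L\<^esub>i\<in>I. h (f i))"
  using assms(2,1)
proof (induction I rule: finite_induct)
  case empty
  thus ?case by (simp add: h_zero del: zero_fun_apply)
next
  case (insert i I)
  have "(\<Sum>i\<in>I. f i) \<in> F"
    by (rule fv.subspace_sum[OF subspace_carrier]) (use insert in auto)
  hence "h (f i + (\<Sum>i\<in>I. f i)) = h (f i) \<oplus>\<^bsub>L\<^esub> (\<Oplus>\<^bsub>L\<^esub>i\<in>I. h (f i))"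
    using insert by (subst h_add) auto
  thus ?case using insert
    by (subst L.finsum_insert) (auto simp del: plus_fun_apply)
qed

lemma h_wmon: "w \<in> lists X \<Longrightarrow> h (wmon w) = foldr (mult L) (map (\<lambda>x. h (var x)) w) \<one>\<^bsub>L\<^esub>"
proof (induction w)
  case (Cons x w)
  have "h (wmon (x # w)) = h (conv (wmon [x]) (wmon w))" by (simp add: conv_wmon_wmon)
  also have "\<dots> = h (wmon [x]) \<otimes>\<^bsub>L\<^esub> h (wmon w)"
    using Cons by (intro h_mult) auto
  finally show ?case using Cons by (simp add: var_eq_wmon)
qed (simp add: h_one)

text \<open>Words of \<open>B\<close> go to products of at most n generators. By \<open>ind\<close>
  the images are distinct and linearly independent, and they lie in the space whose dimension is the
  growth function.\<close>

lemma card_le_growth: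
  assumes L: "kalgebra L" and X: "finite X"
    and B: "B \<subseteq> {w \<in> lists X. length w \<le> n}"
    and ind: "\<And>f. (\<And>w. f w \<noteq> 0 \<Longrightarrow> w \<in> B) \<Longrightarrow> h f = \<zero>\<^bsub>L\<^esub> \<Longrightarrow> f = 0"
  shows "card B \<le> growth L ((\<lambda>x. h (var x)) ` X) n"
proof -
  interpret V: vectorspace class_ring L using L by (simp add: kalgebra_def)
  let ?Y = "(\<lambda>x. h (var x)) ` X"
  let ?P = "short_products L ?Y n"
  let ?e = "\<lambda>w. h (wmon w)"
  have finB: "finite B" using B finite_lists_le[OF X] finite_subset by blast
  have varF: "var x \<in> F" if "x \<in> X" for x using that by (auto simp: var_eq_wmon)
  have Y: "?Y \<subseteq> carrier L" using varF by auto
  have BF: "wmon w \<in> F" if "w \<in> B" for w using that B by auto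
  have inj: "inj_on ?e B"
  proof (rule inj_onI)
    fix u v assume uv: "u \<in> B" "v \<in> B" "?e u = ?e v"
    hence "h (wmon u - wmon v) = \<zero>\<^bsub>L\<^esub>" using h_eq_iff BF by blast
    hence "wmon u - wmon v = (0 :: 'x list \<Rightarrow> 'k)"
      by (intro ind) (use uv in \<open>auto simp: wmon_def split: if_splits\<close>)
    hence "(wmon u - wmon v) u = (0::'k)" by simp
    thus "u = v" by (simp add: wmon_def split: if_splits)
  qed
  have finP: "finite ?P"
  proof -
    have "?P = (\<lambda>w. foldr (mult L) w \<one>\<^bsub>L\<^esub>) ` {w \<in> lists ?Y. length w \<le> n}"
      by (auto simp: short_products_def)
    thus ?thesis using finite_lists_le[of ?Y n] X by simp
  qed
  have Pc: "?P \<subseteq> carrier L"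
  proof -
    have "foldr (mult L) w \<one>\<^bsub>L\<^esub> \<in> carrier L" if "w \<in> lists ?Y" for w
      using that Y by (induction w) auto
    thus ?thesis by (auto simp: short_products_def)
  qed
  have eP: "?e ` B \<subseteq> ?P"
  proof
    fix y assume "y \<in> ?e ` B"
    then obtain w where w: "w \<in> B" "y = ?e w" by auto
    hence "y = foldr (mult L) (map (\<lambda>x. h (var x)) w) \<one>\<^bsub>L\<^esub>"
      using h_wmon B by auto
    moreover have "w \<in> lists X" "length w \<le> n" using w B by auto
    hence "map (\<lambda>x. h (var x)) w \<in> lists ?Y" "length w \<le> n" by auto
    ultimately show "y \<in> ?P" unfolding short_products_def by fastforce
  qed
  have indpt: "V.lin_indpt (?e ` B)"
    unfolding V.lin_dep_def
  proof (clarify)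
    fix A a v assume A: "finite A" "A \<subseteq> ?e ` B" "V.lincomb a A = \<zero>\<^bsub>L\<^esub>" "v \<in> A"
      "a v \<noteq> \<zero>\<^bsub>class_ring\<^esub>"
    define B' where "B' = {w \<in> B. ?e w \<in> A}"
    have finB': "finite B'" using finB by (simp add: B'_def)
    have B'A: "A = ?e ` B'" using A(2) by (auto simp: B'_def)
    \<comment> \<open>A dependency among the images is lifted to a polynomial supported on
      \<open>B\<close>, to which \<open>ind\<close> applies.\<close>
    define f where "f = (\<Sum>w\<in>B'. (\<lambda>v. a (?e w) * wmon w v))"
    have B'F: "wmon w \<in> F" if "w \<in> B'" for w using BF that by (simp add: B'_def)
    have fw: "f w = (if w \<in> B' then a (?e w) else 0)" for w
    proof -
      have "f w = (\<Sum>u\<in>B'. if u = w then a (?e u) else 0)"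
        unfolding f_def sum_fun_apply by (intro sum.cong) (auto simp: wmon_def)
      thus ?thesis using finB' by simp
    qed
    have "h f = (\<Oplus>\<^bsub>L\<^esub>w\<in>B'. h (\<lambda>v. a (?e w) * wmon w v))"
      unfolding f_def using finB' B'F by (intro h_sum) auto
    also have "\<dots> = (\<Oplus>\<^bsub>L\<^esub>w\<in>B'. a (?e w) \<odot>\<^bsub>L\<^esub> ?e w)"
      using B'F by (intro L.finsum_cong') (auto simp: h_scale)
    also have "\<dots> = (\<Oplus>\<^bsub>L\<^esub>v\<in>A. a v \<odot>\<^bsub>L\<^esub> v)"
      unfolding B'A using B'F inj
      by (subst L.finsum_reindex) (auto simp: B'_def inj_on_def)
    also have "\<dots> = \<zero>\<^bsub>L\<^esub>" using A(3) by (simp add: V.lincomb_def)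
    finally have "f = 0"
      by (intro ind) (auto simp: fw B'_def split: if_splits)
    moreover obtain w where "w \<in> B'" "v = ?e w" using A(4) B'A by auto
    ultimately have "a v = 0" using fw[of w] by simp
    thus False using A(5) by simp
  qed
  let ?W = "V.span ?P"
  have sub: "subspace class_ring ?W L" by (rule V.span_is_subspace[OF Pc])
  hence subm: "submodule class_ring ?W L" by (simp add: VectorSpace.subspace_def)
  interpret W: vectorspace class_ring "L\<lparr>carrier := ?W\<rparr>" by (rule V.subspace_is_vs[OF sub])
  have PW: "?P \<subseteq> ?W" by (rule V.in_own_span[OF Pc])
  \<comment> \<open>The short products are finitely many, so their span is finite-dimensional and
    its \<open>dim\<close> bounds the size of independent sets.\<close>
  have "W.fin_dim"
    unfolding W.fin_dim_def
    using finP PW V.span_li_not_depend(1)[OF PW subm] by (intro exI[of _ ?P]) auto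
  moreover have "W.lin_indpt (?e ` B)"
    using indpt V.span_li_not_depend(2)[of "?e ` B" ?W] eP PW subm by auto
  ultimately have "card (?e ` B) \<le> W.dim"
    using eP PW by (intro W.li_le_dim(2)) auto
  thus ?thesis by (simp add: card_image[OF inj] growth_def)
qed

end

section \<open>The bound defining the Golod--Shafarevich property\<close>

text \<open>As all terms are nonnegative, a uniform bound on the finite partial sums expresses
  convergence and f(z) \<le> 0 together.\<close>

definition gs_bound :: "'x set \<Rightarrow> ('x \<Rightarrow> real) \<Rightarrow> ('x list \<Rightarrow> 'k::field) set \<Rightarrow> real \<Rightarrow> bool" where
  "gs_bound X d S z \<longleftrightarrow> (\<forall>T. finite T \<longrightarrow> T \<subseteq> S \<longrightarrow>
     (\<Sum>r\<in>T. degree_power z (series_degree d r)) \<le> (\<Sum>x\<in>X. z powr d x) - 1)"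

lemma degree_power_nonneg [simp]: "0 \<le> degree_power z a"
  by (simp add: degree_power_def)

lemma series_degree_zero [simp]: "series_degree d 0 = \<infinity>"
  by (simp add: series_degree_def top_ereal_def)

lemma degree_power_infty [simp]: "degree_power z \<infinity> = 0"
  by (simp add: degree_power_def)

lemma gs_bound_iff: "gs_converges d S z \<and> gs_series X d S z \<le> 0 \<longleftrightarrow> gs_bound X d S z"
proof -
  let ?f = "\<lambda>r. degree_power z (series_degree d r)"
  let ?H = "\<Sum>x\<in>X. z powr d x"
  show ?thesis
  proof
    assume *: "gs_converges d S z \<and> gs_series X d S z \<le> 0"
    have "sum ?f T \<le> ?H - 1" if T: "finite T" "T \<subseteq> S" for T
    proof -
      have "sum ?f T \<le> infsum ?f S"
        using * T by (intro finite_sum_le_infsum) (auto simp: gs_converges_def)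
      thus ?thesis using * by (simp add: gs_series_def)
    qed
    thus "gs_bound X d S z" by (simp add: gs_bound_def)
  next
    assume b: "gs_bound X d S z"
    have "?f summable_on S"
      by (rule nonneg_bdd_above_summable_on)
        (use b in \<open>auto simp: gs_bound_def bdd_above_def\<close>)
    moreover from this have "infsum ?f S \<le> ?H - 1"
      by (rule infsum_le_finite_sums) (use b in \<open>auto simp: gs_bound_def\<close>)
    ultimately show "gs_converges d S z \<and> gs_series X d S z \<le> 0"
      by (simp add: gs_converges_def gs_series_def)
  qed
qed

lemma weak_gs_iff: "weak_golod_shafarevich X d S \<longleftrightarrow> (\<exists>z\<in>{0..1}. gs_bound X d S z)"
  unfolding weak_golod_shafarevich_def gs_bound_iff ..

text \<open>The exception for 0 matches compatibility, which passes only nonzero relations on to the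
  next stage; a zero relation has degree \<infinity> and contributes nothing.\<close>

lemma gs_bound_mono:
  assumes "gs_bound X d S z" "T - {0} \<subseteq> S"
  shows "gs_bound X d T z"
  unfolding gs_bound_def
proof (intro allI impI)
  fix U assume U: "finite U" "U \<subseteq> T"
  have "(\<Sum>r\<in>U. degree_power z (series_degree d r)) = (\<Sum>r\<in>U - {0}. degree_power z (series_degree d r))"
    using U(1) by (intro sum.mono_neutral_right) auto
  also have "\<dots> \<le> (\<Sum>x\<in>X. z powr d x) - 1"
    using assms U unfolding gs_bound_def by blast
  finally show "(\<Sum>r\<in>U. degree_power z (series_degree d r)) \<le> (\<Sum>x\<in>X. z powr d x) - 1" .
qed

text \<open>The empty set of relations gives 1 \<le> sum of z^(d x), which fails at z = 0 because
  \<open>0 powr\<close> is 0.\<close>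

lemma gs_bound_pos:
  assumes "gs_bound X d S z" "0 \<le> z"
  shows "0 < z"
proof -
  have "0 \<le> (\<Sum>x\<in>X. z powr d x) - 1"
    using assms(1) unfolding gs_bound_def by (metis empty_subsetI finite.emptyI sum.empty)
  thus ?thesis using assms(2) by (cases "z = 0") auto
qed

lemma series_degree_le: "f w \<noteq> 0 \<Longrightarrow> series_degree d f \<le> ereal (sum_list (map d w))"
  unfolding series_degree_def by (intro INF_lower) auto

lemma series_degree_pos:
  fixes f :: "'x list \<Rightarrow> 'k::field"
  assumes X: "finite X" "\<And>x. x \<in> X \<Longrightarrow> 0 < d x"
    and f: "f \<in> carrier (free_algebra c X)" "f [] = 0"
  shows "0 < series_degree d f"
proof -
  \<comment> \<open>Positivity of every single weight would not suffice, as the degree is an infimum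
    over possibly infinitely many words; the smallest letter weight keeps it away from 0.\<close>
  define \<delta> where "\<delta> = Min (insert 1 (d ` X))"
  have \<delta>: "0 < \<delta>" using X by (simp add: \<delta>_def)
  have "\<delta> \<le> sum_list (map d w)" if w: "f w \<noteq> 0" for w
  proof -
    have "w \<in> lists X" "w \<noteq> []" using w f carrier_outside[OF f(1)] by auto
    then obtain x v where xv: "w = x # v" "x \<in> X" "v \<in> lists X" by (cases w) auto
    have "\<delta> \<le> d x" using xv X(1) by (auto simp: \<delta>_def intro: Min_le)
    moreover have "0 \<le> sum_list (map d v)"
      using xv(3) X(2) by (force intro!: sum_list_nonneg)
    ultimately show ?thesis by (simp add: xv)
  qed
  hence "ereal \<delta> \<le> series_degree d f"
    unfolding series_degree_def by (intro INF_greatest) auto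
  thus ?thesis using \<delta> by (meson ereal_less(2) less_le_trans)
qed

lemma series_degree_finite:
  fixes f :: "'x list \<Rightarrow> 'k::field"
  assumes "finite X" "\<And>x. x \<in> X \<Longrightarrow> 0 < d x" "f \<in> carrier (free_algebra c X)" "f [] = 0" "f \<noteq> 0"
  obtains a where "0 < a" "series_degree d f = ereal a"
proof -
  obtain w where w: "f w \<noteq> 0" using assms(5) by (auto simp: fun_eq_iff)
  have "0 < series_degree d f" using series_degree_pos[OF assms(1-4)] by simp
  thus ?thesis using series_degree_le[of f w d] w that by (cases "series_degree d f") auto
qed

text \<open>Each relation of degree at most \<alpha> contributes at least a fixed amount, while the
  total is bounded. Thus discreteness of the relations of the limit follows from the bound and is
  not carried through the limit separately.\<close>

lemma gs_bound_discrete: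
  assumes b: "gs_bound X d S z" and z: "0 < z" "z \<le> 1"
  shows "discrete_set d S"
  unfolding discrete_set_def
proof (rule allI, rule ccontr)
  fix \<alpha> :: real
  assume inf: "infinite {s \<in> S. series_degree d s \<le> ereal \<alpha>}"
  define H where "H = (\<Sum>x\<in>X. z powr d x)"
  \<comment> \<open>The 1 is the contribution of degree \<open>-\<infinity>\<close>, which
    \<open>real_of_ereal\<close> turns into the exponent 0.\<close>
  define c where "c = min 1 (z powr \<alpha>)"
  have c: "0 < c" using z by (simp add: c_def)
  obtain n :: nat where n: "H < real n * c"
    using reals_Archimedean3[OF c] by blast
  obtain T where T: "finite T" "card T = n" "T \<subseteq> {s \<in> S. series_degree d s \<le> ereal \<alpha>}"
    using infinite_arbitrarily_large[OF inf, of n] by blast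
  have "c \<le> degree_power z (series_degree d s)" if s: "s \<in> T" for s
  proof -
    have le: "series_degree d s \<le> ereal \<alpha>" using s T by auto
    show ?thesis
    proof (cases "series_degree d s")
      case (real a)
      hence "z powr \<alpha> \<le> z powr a" using le z by (intro powr_mono') auto
      thus ?thesis using real by (simp add: degree_power_def c_def)
    qed (use le z in \<open>auto simp: degree_power_def c_def\<close>)
  qed
  hence "real n * c \<le> (\<Sum>s\<in>T. degree_power z (series_degree d s))"
    using sum_bounded_below[of T c "\<lambda>s. degree_power z (series_degree d s)"] T(2) by simp
  also have "\<dots> \<le> H - 1" using b T unfolding gs_bound_def H_def by blast
  finally show False using n by simp
qed

section \<open>Continuity and compactness in the parameter z\<close>

lemma continuous_on_degree_power:
  assumes "0 < a"
  shows "continuous_on {0..1} (\<lambda>z. degree_power z a)"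
proof (cases a)
  case (real r)
  hence "0 < r" using assms by simp
  hence "continuous_on {0..1} (\<lambda>z::real. z powr r)"
    by (intro continuous_on_powr') (auto intro: continuous_intros)
  thus ?thesis using real by (simp add: degree_power_def)
qed (use assms in auto)

definition relations_on :: "'x set \<Rightarrow> ('x \<Rightarrow> real) \<Rightarrow> ('x list \<Rightarrow> 'k::field) set \<Rightarrow> bool" where
  "relations_on X d S \<longleftrightarrow> finite X \<and> (\<forall>x\<in>X. 0 < d x) \<and>
     S \<subseteq> carrier (free_algebra True X) \<and> (\<forall>s\<in>S. s [] = 0)"

lemma relations_on_degree_pos:
  "relations_on X d S \<Longrightarrow> s \<in> S \<Longrightarrow> 0 < series_degree d s"
  using series_degree_pos[of X d s True] by (auto simp: relations_on_def)

lemma relations_on_degree: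
  assumes "relations_on X d S" "s \<in> S" "s \<noteq> 0"
  obtains a where "0 < a" "series_degree d s = ereal a"
  using series_degree_finite[of X d s True] assms that by (auto simp: relations_on_def)

lemma continuous_on_generators:
  assumes "relations_on X d S"
  shows "continuous_on {0..1} (\<lambda>z::real. \<Sum>x\<in>X. z powr d x)"
  using assms
  by (intro continuous_on_sum continuous_on_powr') (auto simp: relations_on_def intro: continuous_intros)

lemma compact_gs_bound:
  assumes "relations_on X d S"
  shows "compact {z \<in> {0..1}. gs_bound X d S z}"
proof -
  have "{z \<in> {0..1}. gs_bound X d S z} = {0..1} \<inter> (\<Inter>T\<in>{T. finite T \<and> T \<subseteq> S}.
      {z \<in> {0..1}. (\<Sum>r\<in>T. degree_power z (series_degree d r)) \<le> (\<Sum>x\<in>X. z powr d x) - 1})"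
    by (auto simp: gs_bound_def)
  moreover have "closed {z \<in> {0..1}. (\<Sum>r\<in>T. degree_power z (series_degree d r)) \<le> (\<Sum>x\<in>X. z powr d x) - 1}"
    if "T \<subseteq> S" for T
  proof (rule continuous_on_closed_Collect_le)
    show "continuous_on {0..1} (\<lambda>z. \<Sum>r\<in>T. degree_power z (series_degree d r))"
      using that relations_on_degree_pos[OF assms]
      by (intro continuous_on_sum continuous_on_degree_power) auto
    show "continuous_on {0..1} (\<lambda>z. (\<Sum>x\<in>X. z powr d x) - 1)"
      by (intro continuous_intros continuous_on_generators[OF assms])
  qed auto
  ultimately show ?thesis by (auto intro!: compact_Int_closed closed_INT)
qed

lemma gs_bound_Union:
  assumes "\<And>n. relations_on X d (S n)" "\<And>n. S n - {0} \<subseteq> S (Suc n)"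
    and "\<And>n. \<exists>z\<in>{0..1}. gs_bound X d (S n) z"
  obtains z where "z \<in> {0<..1}" "gs_bound X d (\<Union>n. S n) z"
proof -
  have mono: "S m - {0} \<subseteq> S n" if "m \<le> n" for m n
    using that assms(2) by (induction n rule: dec_induct) auto
  have "(\<Inter>n. {z \<in> {0..1}. gs_bound X d (S n) z}) \<noteq> {}"
  proof (rule compact_nest)
    fix n
    show "compact {z \<in> {0..1}. gs_bound X d (S n) z}" by (rule compact_gs_bound[OF assms(1)])
    show "{z \<in> {0..1}. gs_bound X d (S n) z} \<noteq> {}" using assms(3)[of n] by auto
  next
    fix m n :: nat assume "m \<le> n"
    thus "{z \<in> {0..1}. gs_bound X d (S n) z} \<subseteq> {z \<in> {0..1}. gs_bound X d (S m) z}"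
      using gs_bound_mono mono by blast
  qed
  then obtain z where z: "z \<in> {0..1}" "\<And>n. gs_bound X d (S n) z" by auto
  have "gs_bound X d (\<Union>n. S n) z"
    unfolding gs_bound_def
  proof (intro allI impI)
    fix T assume T: "finite T" "T \<subseteq> (\<Union>n. S n)"
    have "\<exists>n. T - {0} \<subseteq> S n"
      using T
    proof (induction T rule: finite_induct)
      case (insert r T)
      have "T \<subseteq> (\<Union>n. S n)" using insert.prems by simp
      then obtain n where n: "T - {0} \<subseteq> S n" using insert.IH by blast
      obtain m where m: "r \<in> S m" using insert.prems by auto
      have "insert r T - {0} \<subseteq> S (max m n)"
        using m n mono[of m "max m n"] mono[of n "max m n"] by auto
      thus ?case ..
    qed auto
    then obtain n where "T - {0} \<subseteq> S n" ..
    hence "gs_bound X d T z" using gs_bound_mono z(2) by blast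
    thus "(\<Sum>r\<in>T. degree_power z (series_degree d r)) \<le> (\<Sum>x\<in>X. z powr d x) - 1"
      using T(1) by (simp add: gs_bound_def)
  qed
  moreover from this have "z \<in> {0<..1}" using gs_bound_pos z(1) by fastforce
  ultimately show ?thesis using that by blast
qed

text \<open>At z = 1 every nonzero relation counts 1, so the bound allows at most
  \<open>card X - 1\<close> of them.\<close>

lemma gs_bound_one_finite:
  assumes "relations_on X d S" "gs_bound X d S 1"
  shows "finite (S - {0})"
proof (rule ccontr)
  assume inf: "infinite (S - {0})"
  define N where "N = card X"
  obtain T where T: "finite T" "card T = N" "T \<subseteq> S - {0}"
    using infinite_arbitrarily_large[OF inf, of N] by blast
  have "degree_power 1 (series_degree d r) = 1" if "r \<in> T" for r
  proof -
    have r: "r \<in> S" "r \<noteq> 0" using T(3) that by auto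
    obtain a where "series_degree d r = ereal a" using relations_on_degree[OF assms(1) r] by blast
    thus ?thesis by (simp add: degree_power_def)
  qed
  hence "(\<Sum>r\<in>T. degree_power 1 (series_degree d r)) = real N" using T(2) by simp
  moreover have "(\<Sum>r\<in>T. degree_power 1 (series_degree d r)) \<le> real N - 1"
    using assms(2) T unfolding gs_bound_def N_def by auto
  ultimately show False by simp
qed

text \<open>The case that needs an argument is z = 1: there the nonzero relations are finite in
  number, f is a finite sum, hence continuous, and the strict inequality persists slightly below
  1.\<close>

lemma golod_shafarevich_gs_bound:
  assumes rel: "relations_on X d S" and gs: "golod_shafarevich X d S"
  obtains z where "0 < z" "z < 1" "gs_bound X d S z"
proof -
  obtain z where z: "z \<in> {0..1}" "gs_converges d S z" "gs_series X d S z < 0"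
    using gs by (auto simp: golod_shafarevich_def)
  have b: "gs_bound X d S z" using z gs_bound_iff[of d S z X] by simp
  have z0: "0 < z" using gs_bound_pos[OF b] z(1) by simp
  show ?thesis
  proof (cases "z = 1")
    case False
    thus ?thesis using that z0 z(1) b by auto
  next
    case True
    let ?U = "S - {0}"
    have fin: "finite ?U" using gs_bound_one_finite[OF rel] b True by simp
    let ?f = "\<lambda>z. 1 - (\<Sum>x\<in>X. z powr d x) + (\<Sum>r\<in>?U. degree_power z (series_degree d r))"
    have eq: "gs_series X d S 1 = ?f 1"
    proof -
      have "(\<Sum>\<^sub>\<infinity>r\<in>S. degree_power 1 (series_degree d r)) = (\<Sum>\<^sub>\<infinity>r\<in>?U. degree_power 1 (series_degree d r))"
        by (rule infsum_cong_neutral) auto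
      thus ?thesis using fin by (simp add: gs_series_def)
    qed
    have cont: "continuous_on {0..1} ?f"
      using relations_on_degree_pos[OF rel]
      by (intro continuous_intros continuous_on_generators[OF rel] continuous_on_degree_power) auto
    have neg: "?f 1 < 0" using z(3) eq True by simp
    have lim: "(?f \<longlongrightarrow> ?f 1) (at 1 within {0..1})"
      by (rule bspec[OF cont[unfolded continuous_on_def]]) simp
    have "\<forall>\<^sub>F z in at 1 within {0..1}. ?f z < 0"
      by (rule order_tendstoD(2)[OF lim neg])
    then obtain e where e: "e > 0" "\<And>y. y \<in> {0..1} \<Longrightarrow> y \<noteq> 1 \<Longrightarrow> dist y 1 < e \<Longrightarrow> ?f y < 0"
      unfolding eventually_at by blast
    define y where "y = max (1/2) (1 - e/2)"
    have y: "0 < y" "y < 1" "dist y 1 < e" using e(1) by (auto simp: y_def dist_real_def max_def)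
    hence fy: "?f y < 0" using e(2)[of y] by auto
    have "gs_bound X d ?U y"
      unfolding gs_bound_def
    proof (intro allI impI)
      fix T assume "finite T" "T \<subseteq> ?U"
      hence "(\<Sum>r\<in>T. degree_power y (series_degree d r)) \<le> (\<Sum>r\<in>?U. degree_power y (series_degree d r))"
        using fin by (intro sum_mono2) auto
      thus "(\<Sum>r\<in>T. degree_power y (series_degree d r)) \<le> (\<Sum>x\<in>X. y powr d x) - 1"
        using fy by simp
    qed
    hence "gs_bound X d S y" by (rule gs_bound_mono) auto
    thus ?thesis using that y by blast
  qed
qed

text \<open>Presentations whose letters are formal, i.e. need not be mapped injectively.\<close>

definition labelled_presentation ::
  "bool \<Rightarrow> ('k::field, 'b) module \<Rightarrow> 'x set \<Rightarrow> ('x list \<Rightarrow> 'k) set \<Rightarrow> (('x list \<Rightarrow> 'k) \<Rightarrow> 'b) \<Rightarrow> bool"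
where
  "labelled_presentation c L X S \<rho> \<longleftrightarrow>
     S \<subseteq> carrier (free_algebra c X) \<and> \<rho> \<in> alg_hom (free_algebra c X) L \<and>
     \<rho> ` carrier (free_algebra c X) = carrier L \<and>
     (\<forall>f\<in>carrier (free_algebra c X). \<rho> f = \<zero>\<^bsub>L\<^esub> \<longleftrightarrow> f \<in> rel_ideal c X S)"

theorem labelled_presentation_exponential_growth:
  fixes L :: "('k::field, 'b) module"
  assumes L: "kalgebra L" and pres: "labelled_presentation c L X S \<rho>"
    and rel: "relations_on X d S" and z: "0 < z" "z < 1" and b: "gs_bound X d S z"
  shows "exponential_growth L ((\<lambda>x. \<rho> (var x)) ` X)"
proof (rule ccontr)
  let ?Y = "(\<lambda>x. \<rho> (var x)) ` X"
  assume no: "\<not> exponential_growth L ?Y"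
  \<comment> \<open>The zero relation gets the value 0. It satisfies the weight condition vacuously
    and, having degree \<infinity>, never enters the sets \<open>?T\<close> below.\<close>
  define D where "D s = real_of_ereal (series_degree d s)" for s :: "'a list \<Rightarrow> 'k"
  have X: "finite X" using rel by (simp add: relations_on_def)
  interpret R: weighted_relations X d S D
  proof
    fix s w assume s: "s \<in> S" "s w \<noteq> 0"
    then obtain a where "series_degree d s = ereal a"
      using relations_on_degree[OF rel, of s] by (metis zero_fun_apply)
    thus "D s \<le> sum_list (map d w)" using series_degree_le[of s w d] s(2) by (simp add: D_def)
  qed (use rel in \<open>auto simp: relations_on_def\<close>)
  interpret H: free_algebra_hom c X L \<rho>
    using L pres by (intro free_algebra_hom.intro) (simp_all add: kalgebra_def labelled_presentation_def)
  obtain \<delta> where \<delta>: "\<delta> > 0" "\<And>w. w \<in> lists X \<Longrightarrow> \<delta> * real (length w) \<le> sum_list (map d w)"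
    using R.min_weight by blast
  have disc: "discrete_set d S" using gs_bound_discrete[OF b] z by simp
  \<comment> \<open>Words of weight below \<delta> n have length less than n, so the normal words
    below \<alpha> are among the products counted by the growth function at n.\<close>
  have growth: "R.codim \<alpha> \<le> growth L ?Y n" if \<alpha>: "\<alpha> \<le> \<delta> * real n" for \<alpha> n
  proof -
    obtain B where B: "B \<subseteq> R.words_below \<alpha>" "card B = R.codim \<alpha>"
      "\<And>f. (\<And>w. f w \<noteq> 0 \<Longrightarrow> w \<in> B) \<Longrightarrow> f \<in> R.trunc_ideal \<alpha> \<Longrightarrow> f = 0"
      using R.normal_words[of \<alpha>] by blast
    have short: "length w \<le> n" if "w \<in> R.words_below \<alpha>" for w
    proof -
      have "\<delta> * real (length w) < \<delta> * real n"
        using that \<delta>(2)[of w] \<alpha> by (auto simp: R.words_below_def)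
      thus ?thesis using \<delta>(1) by simp
    qed
    have "card B \<le> growth L ?Y n"
    proof (rule H.card_le_growth[OF L X])
      show "B \<subseteq> {w \<in> lists X. length w \<le> n}"
      proof
        fix w assume "w \<in> B"
        hence "w \<in> R.words_below \<alpha>" using B(1) by auto
        thus "w \<in> {w \<in> lists X. length w \<le> n}"
          using short[of w] by (simp add: R.words_below_def)
      qed
      fix f assume f: "\<And>w. f w \<noteq> 0 \<Longrightarrow> w \<in> B" "\<rho> f = \<zero>\<^bsub>L\<^esub>"
      have supp: "w \<in> R.words_below \<alpha>" if "f w \<noteq> 0" for w using f(1)[OF that] B(1) by auto
      hence "{w. f w \<noteq> 0} \<subseteq> R.words_below \<alpha>" by auto
      hence "f \<in> carrier (free_algebra c X)"
        using R.finite_words_below[of \<alpha>] finite_subset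
        by (auto simp: carrier_free_algebra_iff R.words_below_def)
      hence "f \<in> rel_ideal c X S"
        using f(2) pres by (auto simp: labelled_presentation_def)
      \<comment> \<open>Agreement up to length n covers every word of weight below \<alpha>, so an
        element of the closed ideal has the same truncation as an element of
        \<open>word_ideal\<close>.\<close>
      then obtain g where g: "g \<in> word_ideal X S" "agree n f g" using rel_ideal_agree by blast
      have "f = R.trunc \<alpha> g"
      proof
        fix w
        show "f w = R.trunc \<alpha> g w"
          using supp[of w] short[of w] g(2) by (auto simp: R.trunc_def agree_def)
      qed
      hence "f \<in> R.trunc_ideal \<alpha>" using g(1) by (auto simp: R.trunc_ideal_def)
      thus "f = 0" using B(3)[OF f(1)] by blast
    qed
    thus ?thesis by (simp add: B(2))
  qed
  have inf: "(\<integral>\<^sup>+\<alpha>. ennreal (real (R.codim \<alpha>) * z powr \<alpha>) \<partial>lborel) = \<infinity>"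
  proof (rule recursion_integral_infinite[OF X])
    show "0 < d x" if "x \<in> X" for x using that by (rule R.weight_pos)
    show "mono R.codim" by (auto simp: mono_def R.codim_mono)
    show "R.codim \<alpha> = 0" if "\<alpha> \<le> 0" for \<alpha> using that by (rule R.codim_nonpos)
    fix K :: real
    \<comment> \<open>Relations of degree above \<open>K\<close> do not act at thresholds up to
      \<open>K\<close>, and discreteness leaves finitely many others.\<close>
    let ?T = "{s \<in> S. series_degree d s \<le> ereal K}"
    have finT: "finite ?T" using disc by (simp add: discrete_set_def)
    have "(\<Sum>s\<in>?T. z powr D s) = (\<Sum>s\<in>?T. degree_power z (series_degree d s))"
      by (intro sum.cong refl) (auto simp: degree_power_def D_def)
    also have "\<dots> \<le> (\<Sum>x\<in>X. z powr d x) - 1"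
      using b finT by (auto simp: gs_bound_def)
    finally have 1: "(\<Sum>s\<in>?T. z powr D s) \<le> (\<Sum>x\<in>X. z powr d x) - 1" .
    have 2: "1 + (\<Sum>x\<in>X. R.codim (\<alpha> - d x)) \<le> R.codim \<alpha> + (\<Sum>s\<in>?T. R.codim (\<alpha> - D s))"
      if "0 < \<alpha>" "\<alpha> \<le> K" for \<alpha>
    proof (rule R.codim_recursion[OF that(1) _ finT])
      fix s assume s: "s \<in> S - ?T"
      show "s = 0 \<or> \<alpha> \<le> D s"
      proof (cases "s = 0")
        case False
        then obtain a where "series_degree d s = ereal a"
          using relations_on_degree[OF rel, of s] s by auto
        thus ?thesis using s that(2) by (auto simp: D_def)
      qed simp
    qed auto
    show "\<exists>T. finite T \<and> (\<Sum>s\<in>T. z powr D s) \<le> (\<Sum>x\<in>X. z powr d x) - 1 \<and>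
      (\<forall>\<alpha>. 0 < \<alpha> \<longrightarrow> \<alpha> \<le> K \<longrightarrow>
        1 + (\<Sum>x\<in>X. R.codim (\<alpha> - d x)) \<le> R.codim \<alpha> + (\<Sum>s\<in>T. R.codim (\<alpha> - D s)))"
      using finT 1 2 by blast
  qed (use z in auto)
  \<comment> \<open>Chosen so that q^n, for n close to \<alpha>/\<delta>, is about z^(-\<alpha>/2):
    against z^\<alpha> there remains the integrable z^(\<alpha>/2).\<close>
  define q where "q = z powr (- \<delta> / 2)"
  have q: "q > 1"
  proof -
    have "z powr (\<delta> / 2) < 1" using z \<delta>(1) by (simp add: powr01_less_one)
    hence "1 < inverse (z powr (\<delta> / 2))" using z by (intro one_less_inverse) auto
    thus ?thesis by (simp add: q_def powr_minus)
  qed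
  obtain C where C: "0 \<le> C" "\<And>n. real (growth L ?Y n) \<le> C * q ^ n"
    using not_exponential_growthD[OF no q] by blast
  have "(\<integral>\<^sup>+\<alpha>. ennreal (real (R.codim \<alpha>) * z powr \<alpha>) \<partial>lborel) < \<infinity>"
  \<comment> \<open>The extra factor \<open>q\<close> pays for rounding \<alpha>/\<delta> up to an
    integer.\<close>
  proof (rule powr_exp_decay_finite[of "z powr (1/2)" _ "C * q"])
    show "0 < z powr (1/2)" "z powr (1/2) < 1" using z by (simp_all add: powr01_less_one)
    have "mono (\<lambda>\<alpha>. real (R.codim \<alpha>))" by (auto simp: mono_def R.codim_mono)
    hence [measurable]: "(\<lambda>\<alpha>. real (R.codim \<alpha>)) \<in> borel_measurable borel"
      by (rule borel_measurable_mono)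
    show "(\<lambda>\<alpha>. ennreal (real (R.codim \<alpha>) * z powr \<alpha>)) \<in> borel_measurable borel" by measurable
    show "0 \<le> C * q" using C(1) q by simp
    fix \<alpha>
    show "ennreal (real (R.codim \<alpha>) * z powr \<alpha>) \<le> ennreal (C * q * (z powr (1/2)) powr \<alpha>) * indicator {0..} \<alpha>"
    proof (cases "\<alpha> \<le> 0")
      case True
      thus ?thesis by (simp add: R.codim_nonpos)
    next
      case False
      define n where "n = nat \<lceil>\<alpha> / \<delta>\<rceil>"
      have n: "\<alpha> / \<delta> \<le> real n" "real n \<le> \<alpha> / \<delta> + 1"
        using False \<delta>(1) by (auto simp: n_def)
      have "real (R.codim \<alpha>) \<le> real (growth L ?Y n)"
        using n(1) \<delta>(1) by (intro of_nat_mono growth) (simp add: field_simps)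
      also have "\<dots> \<le> C * q ^ n" by (rule C(2))
      also have "q ^ n = q powr real n" using q by (simp add: powr_realpow)
      also have "C * q powr real n \<le> C * q powr (\<alpha> / \<delta> + 1)"
        using C(1) q n(2) by (intro mult_left_mono powr_mono) auto
      also have "q powr (\<alpha> / \<delta> + 1) = q * q powr (\<alpha> / \<delta>)" using q by (simp add: powr_add)
      also have "q powr (\<alpha> / \<delta>) = z powr (- \<alpha> / 2)"
        using \<delta>(1) by (simp add: q_def powr_powr)
      finally have "real (R.codim \<alpha>) * z powr \<alpha> \<le> C * (q * z powr (- \<alpha> / 2)) * z powr \<alpha>"
        by (intro mult_right_mono) auto
      also have "\<dots> = C * q * (z powr (1/2)) powr \<alpha>"
        by (simp add: powr_powr mult.assoc flip: powr_add)
      finally show ?thesis using False by (simp add: ennreal_leI)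
    qed
  qed
  thus False using inf by simp
qed

section \<open>Change of letters\<close>

lemma map_in_lists: "w \<in> lists X \<Longrightarrow> t ` X \<subseteq> Y \<Longrightarrow> map t w \<in> lists Y"
  by (induction w) auto

lemma finite_fibre: "finite X \<Longrightarrow> finite {u \<in> lists X. map t u = w}"
  by (rule finite_subset[OF _ finite_lists_le[of X "length w"]]) auto

lemma lin_free_map: "lin (free_map t X)"
  by (auto simp: lin_def free_map_def fun_eq_iff sum.distrib sum_distrib_left)

lemma free_map_nonzeroE:
  assumes "free_map t X f w \<noteq> 0"
  obtains u where "u \<in> lists X" "map t u = w" "f u \<noteq> 0"
proof -
  have "\<exists>u\<in>{u \<in> lists X. map t u = w}. f u \<noteq> 0"
    using assms unfolding free_map_def by (metis (no_types, lifting) sum.neutral)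
  thus ?thesis using that by blast
qed

lemma free_map_closed:
  assumes "f \<in> carrier (free_algebra c X)" "t ` X \<subseteq> Y"
  shows "free_map t X f \<in> carrier (free_algebra c Y)"
proof -
  have "{w. free_map t X f w \<noteq> 0} \<subseteq> map t ` {w. f w \<noteq> 0}"
    by (auto elim!: free_map_nonzeroE)
  moreover have "w \<in> lists Y" if "free_map t X f w \<noteq> 0" for w
    using that by (elim free_map_nonzeroE) (use map_in_lists[OF _ assms(2)] in blast)
  ultimately show ?thesis using assms(1)
    by (auto simp: carrier_free_algebra_iff intro: finite_subset)
qed

lemma free_map_wmon:
  assumes "finite X" "u \<in> lists X"
  shows "free_map t X (wmon u) = wmon (map t u)"
proof
  fix w
  have "free_map t X (wmon u) w = (\<Sum>v\<in>{u \<in> lists X. map t u = w}. if v = u then 1 else 0)"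
    by (simp add: free_map_def wmon_def)
  also have "\<dots> = (if u \<in> {u \<in> lists X. map t u = w} then 1 else 0)"
    by (rule sum.delta[OF finite_fibre[OF assms(1)]])
  finally show "free_map t X (wmon u) w = wmon (map t u) w"
    using assms(2) by (auto simp: wmon_def)
qed

lemma free_map_Nil [simp]: "free_map t X f [] = f []"
proof -
  have "{u \<in> lists X. map t u = []} = {[]}" by auto
  thus ?thesis by (simp add: free_map_def)
qed

text \<open>Letterwise maps preserve length, so the preimages of \<open>w\<close>, split at position
  i, are exactly the pairs of a preimage of \<open>take i w\<close> and one of
  \<open>drop i w\<close>.\<close>

lemma free_map_conv:
  assumes "finite X"
  shows "free_map t X (conv f g) = conv (free_map t X f) (free_map t X g)"
proof
  fix w
  let ?F = "\<lambda>w. {u \<in> lists X. map t u = w}"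
  have "free_map t X (conv f g) w = (\<Sum>u\<in>?F w. \<Sum>i\<le>length w. f (take i u) * g (drop i u))"
    unfolding free_map_def conv_def by (intro sum.cong refl) auto
  also have "\<dots> = (\<Sum>i\<le>length w. \<Sum>u\<in>?F w. f (take i u) * g (drop i u))"
    by (rule sum.swap)
  also have "\<dots> = (\<Sum>i\<le>length w. \<Sum>(u, v)\<in>?F (take i w) \<times> ?F (drop i w). f u * g v)"
  proof (intro sum.cong refl)
    fix i assume i: "i \<in> {..length w}"
    show "(\<Sum>u\<in>?F w. f (take i u) * g (drop i u)) =
        (\<Sum>(u, v)\<in>?F (take i w) \<times> ?F (drop i w). f u * g v)"
    proof (rule sum.reindex_bij_witness[of _ "\<lambda>(u, v). u @ v" "\<lambda>u. (take i u, drop i u)"])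
      fix u assume "u \<in> ?F w"
      thus "(take i u, drop i u) \<in> ?F (take i w) \<times> ?F (drop i w)"
        using take_drop_lists[of u X i] by (auto simp: take_map drop_map)
    next
      fix uv assume "uv \<in> ?F (take i w) \<times> ?F (drop i w)"
      then obtain u v where uv: "uv = (u, v)" "u \<in> lists X" "v \<in> lists X"
        "map t u = take i w" "map t v = drop i w" by auto
      have "length u = i" using arg_cong[OF uv(4), of length] i by simp
      thus "(take i (case uv of (u, v) \<Rightarrow> u @ v), drop i (case uv of (u, v) \<Rightarrow> u @ v)) = uv"
        by (simp add: uv(1))
      show "(case uv of (u, v) \<Rightarrow> u @ v) \<in> ?F w"
        using uv by simp
    qed auto
  qed
  also have "\<dots> = conv (free_map t X f) (free_map t X g) w"
    unfolding conv_def free_map_def sum_product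
    by (intro sum.cong refl) (simp add: sum.cartesian_product)
  finally show "free_map t X (conv f g) w = conv (free_map t X f) (free_map t X g) w" .
qed

lemma free_map_agree: "agree M f g \<Longrightarrow> agree M (free_map t X f) (free_map t X g)"
  unfolding agree_def free_map_def by (auto intro!: sum.cong)

lemma free_map_comp:
  assumes "finite X" "finite Y" "t ` X \<subseteq> Y"
  shows "free_map s Y (free_map t X f) = free_map (\<lambda>x. s (t x)) X f"
proof
  fix w
  let ?S = "{u \<in> lists X. map (\<lambda>x. s (t x)) u = w}" and ?T = "{v \<in> lists Y. map s v = w}"
  have "(\<Sum>v\<in>?T. \<Sum>u\<in>{u \<in> ?S. map t u = v}. f u) = (\<Sum>u\<in>?S. f u)"
    using assms(1,2) assms(3)[unfolded image_subset_iff]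
    by (intro sum.group finite_fibre) (auto simp: comp_def)
  moreover have "{u \<in> ?S. map t u = v} = {u \<in> lists X. map t u = v}" if "v \<in> ?T" for v
    using that by (auto simp: comp_def)
  ultimately show "free_map s Y (free_map t X f) w = free_map (\<lambda>x. s (t x)) X f w"
    by (simp add: free_map_def)
qed

lemma free_map_ident:
  assumes "f \<in> carrier (free_algebra c Y)" "Y \<subseteq> X" "\<And>x. x \<in> Y \<Longrightarrow> t x = x" "finite X"
  shows "free_map t X f = f"
proof
  fix w
  have map: "map t u = u" if "u \<in> lists Y" for u using that assms(3) by (induction u) auto
  have "free_map t X f w = (\<Sum>u\<in>{u \<in> lists X. map t u = w}. if u = w then f u else 0)"
    unfolding free_map_def
  proof (intro sum.cong refl)
    fix u assume "u \<in> {u \<in> lists X. map t u = w}"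
    thus "f u = (if u = w then f u else 0)"
      using map[of u] carrier_outside[OF assms(1), of u] by (cases "u \<in> lists Y") auto
  qed
  also have "\<dots> = (if w \<in> {u \<in> lists X. map t u = w} then f w else 0)"
    by (rule sum.delta[OF finite_fibre[OF assms(4)]])
  also have "\<dots> = f w"
  proof (cases "w \<in> lists Y")
    case True
    thus ?thesis using map[OF True] assms(2) by auto
  qed (use carrier_outside[OF assms(1)] in auto)
  finally show "free_map t X f w = f w" .
qed

lemma free_map_cong: "(\<And>x. x \<in> X \<Longrightarrow> s x = t x) \<Longrightarrow> free_map s X f = free_map t X f"
  unfolding free_map_def by (intro ext sum.cong Collect_cong) (auto simp: map_eq_conv)

text \<open>Relabelling keeps the weight of each word. Words that become equal may cancel, but no
  new weights arise, so the degree can only rise.\<close>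

lemma series_degree_free_map:
  assumes "\<And>x. x \<in> X \<Longrightarrow> e (t x) = d x"
  shows "series_degree d f \<le> series_degree e (free_map t X f)"
  unfolding series_degree_def[of e]
proof (intro INF_greatest)
  fix w assume "w \<in> {w. free_map t X f w \<noteq> 0}"
  then obtain u where u: "u \<in> lists X" "map t u = w" "f u \<noteq> 0" by (auto elim: free_map_nonzeroE)
  have "map e w = map d u" using u(1) assms unfolding u(2)[symmetric] by (induction u) auto
  thus "series_degree d f \<le> ereal (sum_list (map e w))"
    using series_degree_le[of f u d] u(3) by simp
qed

section \<open>Ideals, bounds and presentations under relabelling\<close>

lemma word_ideal_free_map:
  assumes "finite X" "t ` X \<subseteq> Y" "g \<in> word_ideal X S"
  shows "free_map t X g \<in> word_ideal Y (free_map t X ` S)"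
proof (rule word_ideal_lin[OF lin_free_map assms(3) subspace_word_ideal])
  fix u v s assume *: "u \<in> lists X" "v \<in> lists X" "s \<in> S"
  have "map t u \<in> lists Y" "map t v \<in> lists Y" using * assms(2) by (simp_all only: map_in_lists)
  thus "free_map t X (conv (wmon u) (conv s (wmon v))) \<in> word_ideal Y (free_map t X ` S)"
    using * by (simp add: free_map_conv free_map_wmon assms(1) word_idealI)
qed

lemma rel_ideal_free_map:
  assumes "finite X" "t ` X \<subseteq> Y" "f \<in> rel_ideal c X S"
  shows "free_map t X f \<in> rel_ideal c Y (free_map t X ` S)"
proof -
  have F: "free_map t X f \<in> carrier (free_algebra c Y)"
    using assms by (intro free_map_closed) (auto simp: rel_ideal_def)
  show ?thesis
  proof (cases c)
    case True
    have "\<exists>g\<in>word_ideal Y (free_map t X ` S). agree M (free_map t X f) g" for M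
      using rel_ideal_agree[OF assms(3), of M] word_ideal_free_map[OF assms(1,2)] free_map_agree by blast
    thus ?thesis using F True by (simp add: rel_ideal_def)
  next
    case False
    thus ?thesis using F assms(3) word_ideal_free_map[OF assms(1,2), of f S] by (simp add: rel_ideal_def)
  qed
qed

lemma degree_power_antimono:
  assumes "0 < z" "z \<le> 1" "0 < a" "a \<le> b"
  shows "degree_power z b \<le> degree_power z a"
proof (cases b)
  case (real r)
  then obtain q where "a = ereal q" using assms by (cases a) auto
  thus ?thesis using real assms by (simp add: degree_power_def powr_mono')
qed (use assms in auto)

text \<open>Under relabelling, relations may coincide or rise in degree; for z \<le> 1 both lower
  the sum. One preimage is chosen for each relation in \<open>T\<close>.\<close>

lemma degree_power_sum_image:
  assumes rel: "relations_on X d S" and e: "\<And>x. x \<in> X \<Longrightarrow> e (t x) = d x"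
    and z: "0 < z" "z \<le> 1" and T: "finite T" "T \<subseteq> free_map t X ` U" "U \<subseteq> S"
  obtains T' where "finite T'" "T' \<subseteq> U"
    "(\<Sum>r\<in>T. degree_power z (series_degree e r)) \<le> (\<Sum>r\<in>T'. degree_power z (series_degree d r))"
proof -
  obtain T' where T': "T' \<subseteq> U" "inj_on (free_map t X) T'" "T = free_map t X ` T'"
    using T(2) by (metis subset_image_inj)
  have "finite T'" using T(1) T' finite_image_iff by blast
  moreover have "(\<Sum>r\<in>T. degree_power z (series_degree e r)) =
      (\<Sum>r\<in>T'. degree_power z (series_degree e (free_map t X r)))"
    by (simp add: T'(3) sum.reindex[OF T'(2)])
  moreover have "\<dots> \<le> (\<Sum>r\<in>T'. degree_power z (series_degree d r))"
    using T'(1) T(3) z series_degree_free_map[where X = X and d = d and e = e and t = t, OF e] relations_on_degree_pos[OF rel]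
    by (intro sum_mono degree_power_antimono) auto
  ultimately show ?thesis using that T'(1) by simp
qed

lemma relations_on_image:
  assumes "relations_on X d S" "\<And>x. x \<in> X \<Longrightarrow> e (t x) = d x" "U \<subseteq> S"
  shows "relations_on (t ` X) e (free_map t X ` U)"
  using assms free_map_closed[of _ True X t "t ` X"] by (force simp: relations_on_def)

lemma gs_bound_image:
  assumes rel: "relations_on X d S" and e: "\<And>x. x \<in> X \<Longrightarrow> e (t x) = d x" and inj: "inj_on t X"
    and z: "0 < z" "z \<le> 1" and b: "gs_bound X d S z"
  shows "gs_bound (t ` X) e (free_map t X ` S) z"
  unfolding gs_bound_def
proof (intro allI impI)
  fix T assume "finite T" "T \<subseteq> free_map t X ` S"
  then obtain T' where T': "finite T'" "T' \<subseteq> S"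
    "(\<Sum>r\<in>T. degree_power z (series_degree e r)) \<le> (\<Sum>r\<in>T'. degree_power z (series_degree d r))"
    using degree_power_sum_image[where X = X and d = d and e = e and t = t, OF rel e z] by blast
  have "(\<Sum>r\<in>T'. degree_power z (series_degree d r)) \<le> (\<Sum>x\<in>X. z powr d x) - 1"
    using b T' by (simp add: gs_bound_def)
  also have "(\<Sum>x\<in>X. z powr d x) = (\<Sum>y\<in>t ` X. z powr e y)"
    using e by (simp add: sum.reindex[OF inj])
  finally show "(\<Sum>r\<in>T. degree_power z (series_degree e r)) \<le> (\<Sum>y\<in>t ` X. z powr e y) - 1"
    using T'(3) by simp
qed

lemma alg_hom_free_map:
  assumes "finite Y" "\<rho> \<in> alg_hom (free_algebra c X) L" "s ` Y \<subseteq> X"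
  shows "(\<lambda>f. \<rho> (free_map s Y f)) \<in> alg_hom (free_algebra c Y) L"
proof -
  have cl: "free_map s Y f \<in> carrier (free_algebra c X)" if "f \<in> carrier (free_algebra c Y)" for f
    using free_map_closed[OF that assms(3)] .
  let ?F = "carrier (free_algebra c X)"
  have \<rho>: "f \<in> ?F \<Longrightarrow> \<rho> f \<in> carrier L"
    "f \<in> ?F \<Longrightarrow> g \<in> ?F \<Longrightarrow> \<rho> (conv f g) = \<rho> f \<otimes>\<^bsub>L\<^esub> \<rho> g"
    "f \<in> ?F \<Longrightarrow> g \<in> ?F \<Longrightarrow> \<rho> (f + g) = \<rho> f \<oplus>\<^bsub>L\<^esub> \<rho> g"
    "\<rho> (wmon []) = \<one>\<^bsub>L\<^esub>"
    "f \<in> ?F \<Longrightarrow> \<rho> (\<lambda>w. a * f w) = a \<odot>\<^bsub>L\<^esub> \<rho> f" for f g a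
    using assms(2) by (auto simp: alg_hom_def Ring.ring_hom_def free_algebra_simps)
  show ?thesis
    by (simp add: alg_hom_def Ring.ring_hom_def free_algebra_simps Pi_iff free_map_conv[OF assms(1)]
        linD(1,2)[OF lin_free_map] free_map_wmon[OF assms(1) lists.Nil] cl \<rho> del: plus_fun_apply)
qed

text \<open>\<open>s\<close> inverts \<open>t\<close> on letters, so the two letter maps induce
  inverse isomorphisms of free algebras, each carrying one ideal of relations into the
  other.\<close>

lemma labelled_presentation_bij:
  fixes S :: "('x list \<Rightarrow> 'k::field) set" and t :: "'x \<Rightarrow> 'y"
  assumes "finite X" "labelled_presentation c L X S \<rho>"
    and s: "\<And>x. x \<in> X \<Longrightarrow> s (t x) = x"
  shows "labelled_presentation c L (t ` X) (free_map t X ` S) (\<lambda>f. \<rho> (free_map s (t ` X) f))"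
proof -
  let ?Y = "t ` X"
  have finY: "finite ?Y" using assms(1) by simp
  have sY: "s ` ?Y \<subseteq> X" using s by auto
  have st: "free_map s ?Y (free_map t X f) = f" if "f \<in> carrier (free_algebra c X)" for f
    by (subst free_map_comp[OF assms(1) finY]) (auto intro: free_map_ident[OF that] simp: s assms(1))
  have ts: "free_map t X (free_map s ?Y f) = f" if "f \<in> carrier (free_algebra c ?Y)" for f
    by (subst free_map_comp[OF finY assms(1) sY]) (auto intro: free_map_ident[OF that] simp: s assms(1))
  have S: "S \<subseteq> carrier (free_algebra c X)" and \<rho>: "\<rho> \<in> alg_hom (free_algebra c X) L"
    and surj: "\<rho> ` carrier (free_algebra c X) = carrier L"
    and ker: "\<And>f. f \<in> carrier (free_algebra c X) \<Longrightarrow> \<rho> f = \<zero>\<^bsub>L\<^esub> \<longleftrightarrow> f \<in> rel_ideal c X S"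
    using assms(2) by (auto simp: labelled_presentation_def)
  have ti: "f \<in> carrier (free_algebra c X) \<Longrightarrow> free_map t X f \<in> carrier (free_algebra c ?Y)" for f
    by (rule free_map_closed) auto
  have si: "f \<in> carrier (free_algebra c ?Y) \<Longrightarrow> free_map s ?Y f \<in> carrier (free_algebra c X)" for f
    by (rule free_map_closed[OF _ sY])
  show ?thesis
    unfolding labelled_presentation_def
  proof (intro conjI ballI)
    show "free_map t X ` S \<subseteq> carrier (free_algebra c ?Y)" using S ti by auto
    show "(\<lambda>f. \<rho> (free_map s ?Y f)) \<in> alg_hom (free_algebra c ?Y) L"
      by (rule alg_hom_free_map[OF finY \<rho> sY])
    show "(\<lambda>f. \<rho> (free_map s ?Y f)) ` carrier (free_algebra c ?Y) = carrier L"
    proof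
      show "(\<lambda>f. \<rho> (free_map s ?Y f)) ` carrier (free_algebra c ?Y) \<subseteq> carrier L"
        using surj si by blast
      show "carrier L \<subseteq> (\<lambda>f. \<rho> (free_map s ?Y f)) ` carrier (free_algebra c ?Y)"
      proof
        fix y assume "y \<in> carrier L"
        then obtain f where f: "f \<in> carrier (free_algebra c X)" "y = \<rho> f" using surj by blast
        thus "y \<in> (\<lambda>f. \<rho> (free_map s ?Y f)) ` carrier (free_algebra c ?Y)"
          using st[OF f(1)] ti[OF f(1)] by (intro image_eqI[of _ _ "free_map t X f"]) simp_all
      qed
    qed
  next
    fix f :: "'y list \<Rightarrow> 'k" assume f: "f \<in> carrier (free_algebra c ?Y)"
    have "free_map s ?Y f \<in> rel_ideal c X S \<longleftrightarrow> f \<in> rel_ideal c ?Y (free_map t X ` S)"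
    proof
      assume "free_map s ?Y f \<in> rel_ideal c X S"
      from rel_ideal_free_map[OF assms(1) _ this, of t ?Y]
      show "f \<in> rel_ideal c ?Y (free_map t X ` S)" by (simp add: ts[OF f])
    next
      assume "f \<in> rel_ideal c ?Y (free_map t X ` S)"
      from rel_ideal_free_map[OF finY sY this]
      have "free_map s ?Y f \<in> rel_ideal c X (free_map s ?Y ` free_map t X ` S)" .
      moreover have "free_map s ?Y ` free_map t X ` S = (\<lambda>f. f) ` S"
        unfolding image_image using st S by (intro image_cong) auto
      ultimately show "free_map s ?Y f \<in> rel_ideal c X S" by simp
    qed
    thus "\<rho> (free_map s ?Y f) = \<zero>\<^bsub>L\<^esub> \<longleftrightarrow> f \<in> rel_ideal c ?Y (free_map t X ` S)"
      using ker[OF si[OF f]] by simp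
  qed
qed

text \<open>Homomorphisms out of a completed free algebra are automatically continuous: all but finitely
  many monomials of a series are multiples of one of the finitely many words of length \<open>M + 1\<close>.\<close>

lemma split_at_length:
  fixes f :: "'x list \<Rightarrow> 'k::field"
  assumes X: "finite X" and f: "f \<in> carrier (free_algebra True X)"
  shows "f = (\<Sum>w\<in>{w \<in> lists X. length w \<le> M}. (\<lambda>v. f w * wmon w v)) +
    (\<Sum>w\<in>{w \<in> lists X. length w = Suc M}. conv (wmon w) (\<lambda>u. f (w @ u)))"
proof
  fix v
  let ?A = "{w \<in> lists X. length w \<le> M}" and ?B = "{w \<in> lists X. length w = Suc M}"
  have fA: "finite ?A" by (rule finite_lists_le[OF X])
  have fB: "finite ?B" by (rule finite_subset[OF _ finite_lists_le[OF X, of "Suc M"]]) auto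
  have 1: "(\<Sum>w\<in>?A. (\<lambda>v. f w * wmon w v)) v = (if v \<in> ?A then f v else 0)"
  proof -
    have "(\<Sum>w\<in>?A. f w * wmon w v) = (\<Sum>w\<in>?A. if w = v then f w else 0)"
      by (intro sum.cong) (auto simp: wmon_def)
    thus ?thesis using fA by (simp only: sum_fun_apply sum.delta)
  qed
  have 2: "(\<Sum>w\<in>?B. conv (wmon w) (\<lambda>u. f (w @ u))) v = (if take (Suc M) v \<in> ?B then f v else 0)"
  proof -
    have "(\<Sum>w\<in>?B. conv (wmon w) (\<lambda>u. f (w @ u)) v) = (\<Sum>w\<in>?B. if w = take (Suc M) v then f v else 0)"
    proof (intro sum.cong refl)
      fix w assume "w \<in> ?B"
      hence w: "length w = Suc M" by simp
      show "conv (wmon w) (\<lambda>u. f (w @ u)) v = (if w = take (Suc M) v then f v else 0)"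
        unfolding conv_wmon_left w by (metis append_take_drop_id)
    qed
    thus ?thesis using fB by (simp only: sum_fun_apply sum.delta)
  qed
  have "f v = (if v \<in> ?A then f v else 0) + (if take (Suc M) v \<in> ?B then f v else 0)"
  proof (cases "v \<in> lists X")
    case True
    thus ?thesis using take_drop_lists[OF True, of "Suc M"] by auto
  next
    case False
    thus ?thesis using carrier_outside[OF f False] by simp
  qed
  thus "f v = ((\<Sum>w\<in>?A. (\<lambda>v. f w * wmon w v)) + (\<Sum>w\<in>?B. conv (wmon w) (\<lambda>u. f (w @ u)))) v"
    by (simp add: 1 2)
qed

text \<open>Both sides agree on words, hence on polynomials. For a series, the tail beyond length M
  is a finite sum of terms w g with w of length M + 1. Surjectivity of \<open>h0\<close> realises
  \<open>h g\<close> by some g', so \<open>h f\<close> is the image of a series agreeing with the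
  relabelled f up to length M. As the kernel of \<open>h0\<close> is closed, the relabelled f itself
  has this image.\<close>

lemma hom_eq_free_map:
  fixes h :: "('x list \<Rightarrow> 'k::field) \<Rightarrow> 'b" and h0 :: "('y list \<Rightarrow> 'k) \<Rightarrow> 'b"
  assumes B: "ring B" and h: "h \<in> alg_hom (free_algebra c X) B"
    and h0: "h0 \<in> alg_hom (free_algebra c Y) B" "h0 ` carrier (free_algebra c Y) = carrier B"
    and fin: "finite X" "finite Y" and t: "t ` X \<subseteq> Y" and var: "\<And>x. x \<in> X \<Longrightarrow> h (var x) = h0 (var (t x))"
    and closed: "\<And>f. c \<Longrightarrow> f \<in> carrier (free_algebra c Y) \<Longrightarrow>
      (\<And>M. \<exists>g\<in>carrier (free_algebra c Y). h0 g = \<zero>\<^bsub>B\<^esub> \<and> agree M f g) \<Longrightarrow> h0 f = \<zero>\<^bsub>B\<^esub>"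
    and f: "f \<in> carrier (free_algebra c X)"
  shows "h f = h0 (free_map t X f)"
proof -
  interpret H: free_algebra_hom c X B h by (rule free_algebra_hom.intro[OF B h])
  interpret H0: free_algebra_hom c Y B h0 by (rule free_algebra_hom.intro[OF B h0(1)])
  let ?p = "free_map t X"
  have pc: "g \<in> H.F \<Longrightarrow> ?p g \<in> H0.F" for g by (rule free_map_closed[OF _ t])
  have word: "h (wmon w) = h0 (wmon (map t w))" if w: "w \<in> lists X" for w
  proof -
    have mt: "map t w \<in> lists Y" using w t by (rule map_in_lists)
    have "map (\<lambda>x. h (var x)) w = map (\<lambda>y. h0 (var y)) (map t w)" using w var by auto
    thus ?thesis by (simp only: H.h_wmon[OF w] H0.h_wmon[OF mt])
  qed
  show ?thesis
  proof (cases c)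
    case False
    define V where "V = {f \<in> H.F. h f = h0 (?p f)}"
    have "fv.subspace V"
      using pc
      by (auto simp: linD(1-3)[OF lin_free_map] V_def fv.subspace_def H.h_add H0.h_add H.h_zero H0.h_zero H.h_scale H0.h_scale
          simp del: plus_fun_apply zero_fun_apply)
    moreover have "wmon ` lists X \<subseteq> V"
    proof (rule image_subsetI)
      fix w assume w: "w \<in> lists X"
      show "wmon w \<in> V"
        unfolding V_def mem_Collect_eq free_map_wmon[OF fin(1) w] using word[OF w] w by auto
    qed
    ultimately have "fv.span (wmon ` lists X) \<subseteq> V" by (intro fv.span_minimal)
    thus ?thesis using f False carrier_False_eq_span[of X] by (auto simp: V_def)
  next
    case True
    have approx: "\<exists>g\<in>H0.F. h f = h0 g \<and> agree M g (?p f)" for M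
    proof -
      define V where "V = {f \<in> H.F. \<exists>g\<in>H0.F. h f = h0 g \<and> agree M g (?p f)}"
      have V: "fv.subspace V"
        unfolding fv.subspace_def
      proof (intro conjI ballI allI)
        show "0 \<in> V"
          by (auto simp: linD(3)[OF lin_free_map] V_def H.h_zero H0.h_zero intro!: bexI[of _ 0] simp del: zero_fun_apply)
      next
        fix f g assume fg: "f \<in> V" "g \<in> V"
        then obtain f' g' where *: "f' \<in> H0.F" "h f = h0 f'" "agree M f' (?p f)"
          "g' \<in> H0.F" "h g = h0 g'" "agree M g' (?p g)" "f \<in> H.F" "g \<in> H.F" by (auto simp: V_def)
        have "h (f + g) = h0 (f' + g')" using * by (simp add: H.h_add H0.h_add del: plus_fun_apply)
        moreover have "agree M (f' + g') (?p (f + g))"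
          unfolding linD(1)[OF lin_free_map] by (rule agree_add[OF *(3,6)])
        ultimately show "f + g \<in> V" using * unfolding V_def by blast
      next
        fix a f assume "f \<in> V"
        then obtain f' where *: "f' \<in> H0.F" "h f = h0 f'" "agree M f' (?p f)" "f \<in> H.F" by (auto simp: V_def)
        have "h (\<lambda>w. a * f w) = h0 (\<lambda>w. a * f' w)" using * by (simp add: H.h_scale H0.h_scale)
        moreover have "agree M (\<lambda>w. a * f' w) (?p (\<lambda>w. a * f w))"
          unfolding linD(2)[OF lin_free_map] by (rule agree_scale[OF *(3)])
        ultimately show "(\<lambda>w. a * f w) \<in> V" using * unfolding V_def by blast
      qed
      have 1: "wmon w \<in> V" if w: "w \<in> lists X" for w
      proof -
        have "map t w \<in> lists Y" using w t by (rule map_in_lists)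
        thus ?thesis using w word[OF w] unfolding V_def
          by (auto simp: free_map_wmon[OF fin(1)] intro!: bexI[of _ "wmon (map t w)"])
      qed
      have 2: "conv (wmon w) g \<in> V" if w: "w \<in> lists X" "length w = Suc M" and g: "g \<in> H.F" for w g
      proof -
        have mt: "map t w \<in> lists Y" using w(1) t by (rule map_in_lists)
        \<comment> \<open>Nothing is known about \<open>h g\<close>, but any preimage under
          \<open>h0\<close> will do, since it gets multiplied by a word longer than M.\<close>
        obtain g' where g': "g' \<in> H0.F" "h0 g' = h g" using h0(2) H.h_closed[OF g] by (metis imageE)
        have "h (conv (wmon w) g) = h (wmon w) \<otimes>\<^bsub>B\<^esub> h g" using w g by (intro H.h_mult) auto
        also have "\<dots> = h0 (wmon (map t w)) \<otimes>\<^bsub>B\<^esub> h0 g'" by (simp add: word[OF w(1)] g'(2))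
        also have "\<dots> = h0 (conv (wmon (map t w)) g')" using mt g' by (subst H0.h_mult) auto
        finally have "h (conv (wmon w) g) = h0 (conv (wmon (map t w)) g')" .
        moreover have "conv (wmon (map t w)) g' \<in> H0.F" using mt g' by (intro conv_closed) auto
        moreover have "conv (wmon w) g \<in> H.F" using w g by (intro conv_closed) auto
        moreover have "conv (wmon (map t w)) f v = 0" if "length v \<le> M" for v and f :: "'y list \<Rightarrow> 'k"
        proof -
          have "length (take (Suc M) v) \<noteq> length (map t w)" using that w(2) by simp
          hence "take (length (map t w)) v \<noteq> map t w" using w(2) by (metis length_map)
          thus ?thesis by (simp only: conv_wmon_left if_False)
        qed
        hence "agree M (conv (wmon (map t w)) g') (?p (conv (wmon w) g))"
          by (simp add: agree_def free_map_conv[OF fin(1)] free_map_wmon[OF fin(1) w(1)])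
        ultimately show ?thesis unfolding V_def by blast
      qed
      have shift: "(\<lambda>u. f (w @ u)) \<in> H.F" if "w \<in> lists X" for w
        using f True by (auto simp: carrier_free_algebra_iff)
      have "f \<in> V"
        using f True
        by (subst split_at_length[OF fin(1), of f M])
          (auto intro!: fv.subspace_add[OF V] fv.subspace_sum[OF V] fv.subspace_scale[OF V] 1 2 shift)
      thus ?thesis by (auto simp: V_def)
    qed
    obtain e where e: "e \<in> H0.F" "h f = h0 e" using approx by blast
    \<comment> \<open>For every M there is some \<open>g\<close> with the same image as
      \<open>e\<close> that is close to \<open>?p f\<close>; so \<open>e - ?p f\<close> is a limit
      of the elements \<open>e - g\<close> of the kernel.\<close>
    have "h0 (e - ?p f) = \<zero>\<^bsub>B\<^esub>"
    proof (rule closed[OF True])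
      show "e - ?p f \<in> H0.F" using e pc[OF f] by blast
      fix M
      obtain g where g: "g \<in> H0.F" "h f = h0 g" "agree M g (?p f)" using approx by blast
      have "h0 (e - g) = \<zero>\<^bsub>B\<^esub>" using H0.h_eq_iff[OF e(1) g(1)] e(2) g(2) by simp
      moreover have "agree M (e - ?p f) (e - g)"
        by (rule agree_diff[OF agree_refl agree_sym[OF g(3)]])
      moreover have "e - g \<in> H0.F" using e g by blast
      ultimately show "\<exists>g\<in>H0.F. h0 g = \<zero>\<^bsub>B\<^esub> \<and> agree M (e - ?p f) g" by blast
    qed
    thus ?thesis using H0.h_eq_iff[OF e(1) pc[OF f]] e(2) by simp
  qed
qed

lemma labelled_presentation_hom_eq:
  assumes "ring B" "labelled_presentation c B Y S \<rho>" "h \<in> alg_hom (free_algebra c X) B"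
    "finite X" "finite Y" "t ` X \<subseteq> Y" "\<And>x. x \<in> X \<Longrightarrow> h (var x) = \<rho> (var (t x))"
    "f \<in> carrier (free_algebra c X)"
  shows "h f = \<rho> (free_map t X f)"
proof (rule hom_eq_free_map[OF assms(1,3) _ _ assms(4-7) _ assms(8)])
  show "\<rho> \<in> alg_hom (free_algebra c Y) B" "\<rho> ` carrier (free_algebra c Y) = carrier B"
    using assms(2) by (auto simp: labelled_presentation_def)
  fix f assume c: c and f: "f \<in> carrier (free_algebra c Y)"
    and ap: "\<And>M. \<exists>g\<in>carrier (free_algebra c Y). \<rho> g = \<zero>\<^bsub>B\<^esub> \<and> agree M f g"
  have "f \<in> rel_ideal True Y S"
  proof (rule rel_ideal_closed)
    show "f \<in> carrier (free_algebra True Y)" using f c by simp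
    show "\<exists>g\<in>rel_ideal True Y S. agree M f g" for M
      using ap[of M] assms(2) c by (auto simp: labelled_presentation_def)
  qed
  thus "\<rho> f = \<zero>\<^bsub>B\<^esub>" using f c assms(2) by (auto simp: labelled_presentation_def)
qed

section \<open>Merging letters with equal image\<close>

lemma rel_ideal_carrier: "f \<in> rel_ideal c X S \<Longrightarrow> f \<in> carrier (free_algebra c X)"
  by (simp add: rel_ideal_def)

lemma labelled_presentation_kernel:
  "labelled_presentation c L X S \<rho> \<Longrightarrow> f \<in> carrier (free_algebra c X) \<Longrightarrow>
    \<rho> f = \<zero>\<^bsub>L\<^esub> \<longleftrightarrow> f \<in> rel_ideal c X S"
  by (simp add: labelled_presentation_def)

text \<open>A nonempty word as a factor lengthens everything by at least one, so agreement below m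
  becomes agreement up to and including m. This gain drives the Nakayama argument.\<close>

lemma conv_wmon_agree:
  assumes "\<And>w. length w < m \<Longrightarrow> f w = g w" "0 < length u + length v"
  shows "agree m (conv (wmon u) (conv f (wmon v))) (conv (wmon u) (conv g (wmon v)))"
  unfolding agree_def
proof (intro allI impI)
  fix w :: "'a list" assume w: "length w \<le> m"
  show "conv (wmon u) (conv f (wmon v)) w = conv (wmon u) (conv g (wmon v)) w"
  proof (cases "take (length u) w = u \<and> length v \<le> length (drop (length u) w)")
    case True
    hence "length u \<le> length w" by (metis length_take min.cobounded1)
    moreover have "length v \<le> length w - length u" using True by simp
    moreover have "length (take (length (drop (length u) w) - length v) (drop (length u) w)) =
      length w - length u - length v" by simp
    ultimately have "length (take (length (drop (length u) w) - length v) (drop (length u) w)) < m"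
      using assms(2) w by linarith
    thus ?thesis using assms(1) by (simp add: conv_wmon_left conv_wmon_right)
  qed (auto simp: conv_wmon_left conv_wmon_right)
qed

text \<open>Two letters with equal image in a completed algebra can be merged at the expense of a relation
  \<open>s0\<close> with a linear term in \<open>x\<close>: modulo the remaining relations, \<open>s0\<close> is a combination of the
  \<open>u s0 v\<close> with \<open>u\<close> or \<open>v\<close> nonempty, hence it lies in the closed ideal that they generate.\<close>

lemma merge_letters:
  fixes L :: "('k::field, 'b) module" and S :: "('x list \<Rightarrow> 'k) set"
  assumes L: "ring L" and pres: "labelled_presentation True L X S \<rho>"
    and rel: "relations_on X d S" and z: "0 < z" "z \<le> 1" and b: "gs_bound X d S z"
    and xy: "x \<in> X" "y \<in> X" "x \<noteq> y" "\<rho> (var x) = \<rho> (var y)" "d x = d y"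
  obtains S' where "labelled_presentation True L (X - {x}) S' \<rho>" "relations_on (X - {x}) d S'"
    "gs_bound (X - {x}) d S' z"
proof -
  define t where "t = (id(x := y) :: 'x \<Rightarrow> 'x)"
  define X' where "X' = X - {x}"
  let ?p = "free_map t X" and ?F = "carrier (free_algebra True X) :: ('x list \<Rightarrow> 'k) set"
    and ?F' = "carrier (free_algebra True X') :: ('x list \<Rightarrow> 'k) set"
  let ?I = "rel_ideal True X S"
  have X: "finite X" using rel by (simp add: relations_on_def)
  have X': "finite X'" using X by (simp add: X'_def)
  have SF: "S \<subseteq> ?F" using rel by (simp add: relations_on_def)
  have Sc: "s [] = 0" if "s \<in> S" for s using rel that by (simp add: relations_on_def)
  have tX: "t ` X = X'" using xy by (auto simp: t_def X'_def)
  have tid: "t v = v" if "v \<in> X'" for v using that by (auto simp: t_def X'_def)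
  have dt: "d (t v) = d v" for v using xy(5) by (auto simp: t_def)
  have F'F: "?F' \<subseteq> ?F" by (rule carrier_subset) (auto simp: X'_def)
  have p_closed: "?p f \<in> ?F'" if "f \<in> ?F" for f
    using free_map_closed[OF that, of t X'] tX by simp
  have p_id: "?p f = f" if "f \<in> ?F'" for f
    by (rule free_map_ident[OF that _ tid X]) (auto simp: X'_def)
  have p_word: "u \<in> lists X \<Longrightarrow> map t u \<in> lists X'" for u
    using map_in_lists[of u X t X'] tX by simp
  have disc: "discrete_set d S" using gs_bound_discrete[OF b z] .
  interpret R: free_algebra_hom True X L \<rho>
    using L pres by (intro free_algebra_hom.intro) (simp_all add: labelled_presentation_def)
  note ker = labelled_presentation_kernel[OF pres]
  have \<rho>p: "\<rho> f = \<rho> (?p f)" if "f \<in> ?F" for f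
  proof (rule labelled_presentation_hom_eq[OF L pres _ X X _ _ that])
    show "\<rho> \<in> alg_hom (free_algebra True X) L" by (rule R.hom)
    show "t ` X \<subseteq> X" using tX by (auto simp: X'_def)
    show "\<rho> (var v) = \<rho> (var (t v))" for v using xy(4) by (auto simp: t_def)
  qed
  define e where "e = (wmon [x] - wmon [y] :: 'x list \<Rightarrow> 'k)"
  have eF: "e \<in> ?F" unfolding e_def using xy by (intro diff_closed wmon_closed) auto
  have "\<rho> e = \<zero>\<^bsub>L\<^esub>"
    using R.h_eq_iff[of "wmon [x]" "wmon [y]"] xy by (simp add: e_def var_eq_wmon)
  hence eI: "e \<in> ?I" using ker[OF eF] by simp
  have pe: "?p e = 0"
    using xy by (simp add: e_def linD(4)[OF lin_free_map] free_map_wmon[OF X] t_def)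
  have ex: "e [x] = 1" using xy by (simp add: e_def wmon_def)
  \<comment> \<open>Proper multiples of relations. Relations have no constant term, so a nonempty
    factor leaves no linear term, and the coefficient of \<open>e\<close> at \<open>[x]\<close> must
    come from the relations themselves.\<close>
  define N where "N = fv.span {conv (wmon u) (conv s (wmon v)) |u v s.
    u \<in> lists X \<and> v \<in> lists X \<and> s \<in> S \<and> 0 < length u + length v}"
  have Nx: "n [x] = 0" if "n \<in> N" for n
  proof -
    have "fv.subspace {f :: 'x list \<Rightarrow> 'k. f [x] = 0}" by (simp add: fv.subspace_def)
    hence "N \<subseteq> {f. f [x] = 0}"
      unfolding N_def
    proof (intro fv.span_minimal subsetI)
      fix f assume "f \<in> {conv (wmon u) (conv s (wmon v)) |u v s.
        u \<in> lists X \<and> v \<in> lists X \<and> s \<in> S \<and> 0 < length u + length v}"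
      then obtain u v s where "s \<in> S" and f: "f = conv (wmon u) (conv s (wmon v))"
        and len: "0 < length u + length v" by blast
      have *: "\<And>w. length w < 1 \<Longrightarrow> s w = (0 :: 'x list \<Rightarrow> 'k) w" using Sc[OF \<open>s \<in> S\<close>] by simp
      have "agree 1 (conv (wmon u) (conv s (wmon v))) (conv (wmon u) (conv 0 (wmon v)))"
        by (rule conv_wmon_agree[OF * len])
      hence "conv (wmon u) (conv s (wmon v)) [x] = conv (wmon u) (conv 0 (wmon v)) [x]"
        by (simp add: agree_def del: conv_zero_left conv_zero_right)
      thus "f \<in> {f. f [x] = 0}" by (simp add: f)
    qed
    thus ?thesis using that by auto
  qed
  \<comment> \<open>Up to length m, the relation \<open>s\<close> occurs with nonzero coefficient in
    some expression of \<open>e\<close>. The expression may vary with m, whereas the relation to be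
    dropped has to be the same for all m.\<close>
  define Q where "Q s m \<longleftrightarrow> (\<exists>c a n. c \<noteq> 0 \<and> a \<in> fv.span (S - {s}) \<and> n \<in> N \<and>
    agree m e ((\<lambda>w. c * s w) + a + n))" for s m
  \<comment> \<open>Length \<open>Suc m\<close> is at least 1, so the comparison includes the word
    \<open>[x]\<close>.\<close>
  have Q_ex: "\<exists>s\<in>S. s [x] \<noteq> 0 \<and> Q s (Suc m)" for m
  proof -
    obtain g where g: "g \<in> word_ideal X S" "agree (Suc m) e g" using rel_ideal_agree[OF eI] by blast
    have "word_ideal X S \<subseteq> fv.span (S \<union> {conv (wmon u) (conv s (wmon v)) |u v s.
        u \<in> lists X \<and> v \<in> lists X \<and> s \<in> S \<and> 0 < length u + length v})"
    proof (rule word_ideal_minimal[OF fv.subspace_span], rule fv.span_base)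
      fix u v s assume *: "u \<in> lists X" "v \<in> lists X" "s \<in> S"
      show "conv (wmon u) (conv s (wmon v)) \<in> S \<union> {conv (wmon u) (conv s (wmon v)) |u v s.
        u \<in> lists X \<and> v \<in> lists X \<and> s \<in> S \<and> 0 < length u + length v}"
      proof (cases "u = [] \<and> v = []")
        case True
        thus ?thesis using * by simp
      next
        case False
        hence "0 < length u + length v" by auto
        thus ?thesis using * by blast
      qed
    qed
    then obtain a n where an: "a \<in> fv.span S" "n \<in> N" "g = a + n"
      using g(1) unfolding fv.span_Un N_def by blast
    obtain T r where T: "finite T" "T \<subseteq> S" "a = (\<Sum>s\<in>T. (\<lambda>w. r s * s w))"
      using an(1) unfolding fv.span_explicit by blast
    have "1 = g [x]" using g(2) ex by (simp add: agree_def)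
    hence "(\<Sum>s\<in>T. r s * s [x]) \<noteq> 0" using Nx[OF an(2)] by (simp add: an(3) T(3) sum_fun_apply)
    then obtain s where s: "s \<in> T" "r s * s [x] \<noteq> 0" by (meson sum.neutral)
    have "a = (\<lambda>w. r s * s w) + (\<Sum>s\<in>T - {s}. (\<lambda>w. r s * s w))"
      unfolding T(3) by (rule sum.remove[OF T(1) s(1)])
    moreover have "(\<Sum>s\<in>T - {s}. (\<lambda>w. r s * s w)) \<in> fv.span (S - {s})"
      using T(2) by (intro fv.span_sum fv.span_scale fv.span_base) auto
    ultimately have "Q s (Suc m)"
      unfolding Q_def using g(2) an(2,3) s(2)
      by (intro exI[of _ "r s"] exI[of _ "\<Sum>s\<in>T - {s}. (\<lambda>w. r s * s w)"] exI[of _ n])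
        (simp del: plus_fun_apply)
    thus ?thesis using s T(2) by auto
  qed
  have Q_mono: "Q s m \<Longrightarrow> m' \<le> m \<Longrightarrow> Q s m'" for s m m'
    unfolding Q_def using agree_mono by blast
  \<comment> \<open>A relation with a linear term in x has degree at most \<open>d x\<close>. By
    discreteness there are finitely many of these, and one of them serves for infinitely many
    m.\<close>
  obtain s0 where s0: "s0 \<in> S" "s0 [x] \<noteq> 0" "\<And>m. Q s0 m"
  proof -
    have "finite {s \<in> S. s [x] \<noteq> 0}"
    proof (rule finite_subset)
      show "{s \<in> S. s [x] \<noteq> 0} \<subseteq> {s \<in> S. series_degree d s \<le> ereal (d x)}"
        using series_degree_le[of _ "[x]" d] by auto
      show "finite {s \<in> S. series_degree d s \<le> ereal (d x)}" using disc by (simp add: discrete_set_def)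
    qed
    moreover have "\<exists>s\<in>{s \<in> S. s [x] \<noteq> 0}. Q s (Suc m)" for m using Q_ex by blast
    ultimately have "\<exists>s\<in>{s \<in> S. s [x] \<noteq> 0}. infinite {m. Q s (Suc m)}"
      using pigeonhole_infinite_rel[of "UNIV :: nat set" "{s \<in> S. s [x] \<noteq> 0}" "\<lambda>m s. Q s (Suc m)"]
      by simp
    then obtain s where s: "s \<in> S" "s [x] \<noteq> 0" "infinite {m. Q s (Suc m)}" by blast
    have "Q s m" for m
    proof -
      obtain m' where "m' \<ge> m" "Q s (Suc m')" using s(3) unfolding infinite_nat_iff_unbounded_le by blast
      thus ?thesis using Q_mono by (meson le_SucI)
    qed
    thus ?thesis using that s by blast
  qed
  define S' where "S' = ?p ` (S - {s0})"
  let ?J = "rel_ideal True X' S'"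
  have S'F: "S' \<subseteq> ?F'" using SF p_closed by (auto simp: S'_def)
  have J: "fv.subspace ?J" by (rule subspace_rel_ideal)
  have WJ: "word_ideal X' S' \<subseteq> ?J" by (rule word_ideal_subset_rel_ideal[OF S'F])
  have pS: "?p s \<in> ?J" if "s \<in> S - {s0}" for s
    using relations_subset_rel_ideal[OF S'F] that by (auto simp: S'_def)
  \<comment> \<open>Substituting y for x kills \<open>e\<close>, so the expression of
    \<open>e\<close> can be solved for the image of \<open>s0\<close>. Its multiples by nonempty
    words are known one length further than the image itself, so each round extends the agreement by
    one.\<close>
  have approx: "\<exists>j\<in>?J. \<forall>w. length w < m \<longrightarrow> ?p s0 w = j w" for m
  proof (induction m)
    case 0
    show ?case using fv.subspace_0[OF J] by auto
  next
    case (Suc m)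
    then obtain j where j: "j \<in> ?J" "\<And>w. length w < m \<Longrightarrow> ?p s0 w = j w" by blast
    obtain c a n where c: "c \<noteq> 0" "a \<in> fv.span (S - {s0})" "n \<in> N" "agree m e ((\<lambda>w. c * s0 w) + a + n)"
      using s0(3)[of m] unfolding Q_def by blast
    have pa: "?p a \<in> ?J" by (rule lin_span[OF lin_free_map c(2) pS J])
    define V where "V = {f. \<exists>j\<in>?J. agree m (?p f) j}"
    have V: "fv.subspace V"
      unfolding fv.subspace_def
    proof (intro conjI ballI allI)
      show "0 \<in> V"
        using fv.subspace_0[OF J] by (auto simp: V_def linD(3)[OF lin_free_map] intro!: bexI[of _ 0] simp del: zero_fun_apply)
    next
      fix f g assume "f \<in> V" "g \<in> V"
      then obtain f' g' where "f' \<in> ?J" "agree m (?p f) f'" "g' \<in> ?J" "agree m (?p g) g'" by (auto simp: V_def)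
      hence "f' + g' \<in> ?J" "agree m (?p (f + g)) (f' + g')"
        unfolding linD(1)[OF lin_free_map] by (auto intro: fv.subspace_add[OF J] agree_add simp del: plus_fun_apply)
      thus "f + g \<in> V" unfolding V_def by blast
    next
      fix a f assume "f \<in> V"
      then obtain f' where "f' \<in> ?J" "agree m (?p f) f'" by (auto simp: V_def)
      hence "(\<lambda>w. a * f' w) \<in> ?J" "agree m (?p (\<lambda>w. a * f w)) (\<lambda>w. a * f' w)"
        unfolding linD(2)[OF lin_free_map] by (auto intro: fv.subspace_scale[OF J] agree_scale)
      thus "(\<lambda>w. a * f w) \<in> V" unfolding V_def by blast
    qed
    have "N \<subseteq> V"
      unfolding N_def
    proof (rule fv.span_minimal[OF subsetI V])
      fix f assume "f \<in> {conv (wmon u) (conv s (wmon v)) |u v s.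
        u \<in> lists X \<and> v \<in> lists X \<and> s \<in> S \<and> 0 < length u + length v}"
      then obtain u v s where *: "u \<in> lists X" "v \<in> lists X" "s \<in> S" "0 < length u + length v"
        and f: "f = conv (wmon u) (conv s (wmon v))" by blast
      have eq: "?p (conv (wmon u) (conv s (wmon v))) = conv (wmon (map t u)) (conv (?p s) (wmon (map t v)))"
        using * by (simp add: free_map_conv[OF X] free_map_wmon[OF X])
      have mul: "conv (wmon (map t u)) (conv f (wmon (map t v))) \<in> ?J" if "f \<in> ?J" for f
        using * that by (intro rel_ideal_conv[OF X'] wmon_closed p_word)
      show "f \<in> V"
      proof (cases "s = s0")
        case True
        have "0 < length (map t u) + length (map t v)" using *(4) by simp
        hence "agree m (conv (wmon (map t u)) (conv (?p s0) (wmon (map t v))))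
            (conv (wmon (map t u)) (conv j (wmon (map t v))))"
          using j(2) by (intro conv_wmon_agree)
        thus ?thesis unfolding f V_def mem_Collect_eq eq using mul[OF j(1)] True by blast
      next
        case False
        thus ?thesis unfolding f V_def mem_Collect_eq eq using mul[OF pS[of s]] *(3) False agree_refl by blast
      qed
    qed
    then obtain j' where j': "j' \<in> ?J" "agree m (?p n) j'" using c(3) by (auto simp: V_def)
    let ?k = "\<lambda>w. (- inverse c) * (?p a + j') w"
    have k: "?k \<in> ?J" by (rule fv.subspace_scale[OF J fv.subspace_add[OF J pa j'(1)]])
    have ag: "agree m (?p e) ((\<lambda>w. c * ?p s0 w) + ?p a + ?p n)"
      using free_map_agree[OF c(4), of t X] by (simp only: linD(1,2)[OF lin_free_map])
    have eq: "?p s0 w = ?k w" if w: "length w < Suc m" for w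
    proof -
      have "0 = c * ?p s0 w + ?p a w + ?p n w" using ag w unfolding pe by (simp add: agree_def)
      moreover have "?p n w = j' w" using j'(2) w by (simp add: agree_def)
      ultimately have "c * ?p s0 w + (?p a w + j' w) = 0" by (simp add: add.assoc)
      hence "c * ?p s0 w = - (?p a w + j' w)" by (simp only: eq_neg_iff_add_eq_0)
      hence "inverse c * (c * ?p s0 w) = - inverse c * (?p a w + j' w)"
        by (simp only: mult_minus_left mult_minus_right)
      thus ?thesis using c(1) by (simp flip: mult.assoc)
    qed
    show ?case
      by (rule bexI[OF _ k]) (intro allI impI, rule eq)
  qed
  have ps0: "?p s0 \<in> ?J"
  proof (rule rel_ideal_closed)
    show "?p s0 \<in> ?F'" using s0(1) SF p_closed by auto
    show "\<exists>g\<in>?J. agree M (?p s0) g" for M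
      using approx[of "Suc M"] by (auto simp: agree_def less_Suc_eq_le)
  qed
  have pSJ: "?p ` S \<subseteq> ?J" using pS ps0 by auto
  have WpS: "word_ideal X' (?p ` S) \<subseteq> ?J"
    by (rule ideal_contains_word_ideal[OF ideal_rel_ideal[OF X'] pSJ])
  have kernel: "\<rho> f = \<zero>\<^bsub>L\<^esub> \<longleftrightarrow> f \<in> ?J" if f: "f \<in> ?F'" for f
  proof
    assume "\<rho> f = \<zero>\<^bsub>L\<^esub>"
    hence "f \<in> ?I" using ker f F'F by blast
    hence "?p f \<in> rel_ideal True X' (?p ` S)"
      using rel_ideal_free_map[OF X, of t X' f True S] tX by simp
    hence fp: "f \<in> rel_ideal True X' (?p ` S)" by (simp add: p_id[OF f])
    show "f \<in> ?J"
      using rel_ideal_agree[OF fp] WpS by (intro rel_ideal_closed[OF f]) blast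
  next
    assume fJ: "f \<in> ?J"
    \<comment> \<open>The substituted relations vanish in \<open>L\<close> because \<rho> does not
      see the substitution.\<close>
    have "S' \<subseteq> ?I"
    proof
      fix s' assume "s' \<in> S'"
      then obtain s where s: "s \<in> S" "s' = ?p s" by (auto simp: S'_def)
      have sF: "s \<in> ?F" using s(1) SF by auto
      have "\<rho> s = \<zero>\<^bsub>L\<^esub>" using relations_subset_rel_ideal[OF SF] s(1) ker[OF sF] by auto
      hence "\<rho> s' = \<zero>\<^bsub>L\<^esub>" using \<rho>p[OF sF] s(2) by simp
      moreover have "s' \<in> ?F" using s(2) p_closed[OF sF] F'F by auto
      ultimately show "s' \<in> ?I" using ker by blast
    qed
    hence "word_ideal X S' \<subseteq> ?I" by (rule ideal_contains_word_ideal[OF ideal_rel_ideal[OF X]])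
    moreover have "word_ideal X' S' \<subseteq> word_ideal X S'"
    proof (rule word_ideal_minimal[OF subspace_word_ideal])
      fix u v s assume "u \<in> lists X'" "v \<in> lists X'" "s \<in> S'"
      moreover have "lists X' \<subseteq> lists X" by (rule lists_mono) (auto simp: X'_def)
      ultimately show "conv (wmon u) (conv s (wmon v)) \<in> word_ideal X S'" by (intro word_idealI) blast+
    qed
    ultimately have "f \<in> ?I"
      using rel_ideal_agree[OF fJ] f F'F by (intro rel_ideal_closed) blast+
    thus "\<rho> f = \<zero>\<^bsub>L\<^esub>" using ker f F'F by blast
  qed
  have 1: "labelled_presentation True L X' S' \<rho>"
    unfolding labelled_presentation_def
  proof (intro conjI ballI)
    show "S' \<subseteq> ?F'" by (rule S'F)
    show "\<rho> \<in> alg_hom (free_algebra True X') L"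
      by (simp add: alg_hom_def Ring.ring_hom_def free_algebra_simps Pi_iff subsetD[OF F'F]
          R.h_add R.h_mult R.h_one R.h_scale del: plus_fun_apply)
    show "\<rho> ` ?F' = carrier L"
    proof
      show "\<rho> ` ?F' \<subseteq> carrier L" using F'F by auto
      show "carrier L \<subseteq> \<rho> ` ?F'"
      proof
        fix l assume "l \<in> carrier L"
        hence "l \<in> \<rho> ` ?F" using pres by (simp add: labelled_presentation_def)
        then obtain f where "f \<in> ?F" "l = \<rho> f" by (elim imageE)
        thus "l \<in> \<rho> ` ?F'" using \<rho>p[of f] p_closed[of f] by (intro image_eqI[of _ _ "?p f"]) simp_all
      qed
    qed
  qed (rule kernel)
  have 2: "relations_on X' d S'"
    using relations_on_image[where X = X and d = d and e = d and t = t and U = "S - {s0}", OF rel dt]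
    by (simp add: tX S'_def)
  have 3: "gs_bound X' d S' z"
    unfolding gs_bound_def
  proof (intro allI impI)
    fix T assume "finite T" "T \<subseteq> S'"
    then obtain T' where T': "finite T'" "T' \<subseteq> S - {s0}"
      "(\<Sum>r\<in>T. degree_power z (series_degree d r)) \<le> (\<Sum>r\<in>T'. degree_power z (series_degree d r))"
      using degree_power_sum_image[where X = X and d = d and e = d and t = t and U = "S - {s0}" and T = T, OF rel dt z]
      unfolding S'_def by blast
    have "(\<Sum>r\<in>insert s0 T'. degree_power z (series_degree d r)) \<le> (\<Sum>x\<in>X. z powr d x) - 1"
      using b T' s0(1) unfolding gs_bound_def by (metis Diff_subset finite.insertI insert_subset subset_trans)
    moreover have "s0 \<notin> T'" using T'(2) by auto
    \<comment> \<open>\<open>s0\<close> contributes at least as much as the letter x, so dropping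
      both keeps the bound.\<close>
    moreover have "z powr d x \<le> degree_power z (series_degree d s0)"
    proof -
      have "series_degree d s0 \<le> ereal (d x)" using series_degree_le[of s0 "[x]" d] s0(2) by simp
      hence "degree_power z (ereal (d x)) \<le> degree_power z (series_degree d s0)"
        using relations_on_degree_pos[OF rel s0(1)] z by (intro degree_power_antimono)
      thus ?thesis by (simp add: degree_power_def)
    qed
    moreover have "(\<Sum>x\<in>X. z powr d x) = z powr d x + (\<Sum>x\<in>X'. z powr d x)"
      unfolding X'_def by (rule sum.remove[OF X xy(1)])
    ultimately show "(\<Sum>r\<in>T. degree_power z (series_degree d r)) \<le> (\<Sum>x\<in>X'. z powr d x) - 1"
      using T'(1,3) by simp
  qed
  show ?thesis using that 1 2 3 unfolding X'_def by blast
qed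

section \<open>From formal letters to generators inside the algebra\<close>

lemma merge_all_letters:
  fixes L :: "('k::field, 'b) module" and S :: "('x list \<Rightarrow> 'k) set"
  assumes L: "ring L" and z: "0 < z" "z \<le> 1"
    and "labelled_presentation True L X S \<rho>" "relations_on X d S" "gs_bound X d S z"
    and "\<And>x y. x \<in> X \<Longrightarrow> y \<in> X \<Longrightarrow> \<rho> (var x) = \<rho> (var y) \<Longrightarrow> d x = d y"
  shows "\<exists>X' S'. X' \<subseteq> X \<and> labelled_presentation True L X' S' \<rho> \<and> relations_on X' d S' \<and> gs_bound X' d S' z \<and>
    inj_on (\<lambda>x. \<rho> (var x)) X' \<and> (\<lambda>x. \<rho> (var x)) ` X' = (\<lambda>x. \<rho> (var x)) ` X"
  using assms(4-7)
proof (induction "card X" arbitrary: X S rule: less_induct)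
  case less
  show ?case
  proof (cases "inj_on (\<lambda>x. \<rho> (var x)) X")
    case True
    thus ?thesis using less.prems by blast
  next
    case False
    then obtain x y where xy: "x \<in> X" "y \<in> X" "x \<noteq> y" "\<rho> (var x) = \<rho> (var y)"
      by (auto simp: inj_on_def)
    obtain S' where S': "labelled_presentation True L (X - {x}) S' \<rho>" "relations_on (X - {x}) d S'"
      "gs_bound (X - {x}) d S' z"
      using merge_letters[OF L less.prems(1,2) z less.prems(3) xy less.prems(4)[OF xy(1,2,4)]] by blast
    have lt: "card (X - {x}) < card X"
      using less.prems(2) xy(1) by (intro psubset_card_mono) (auto simp: relations_on_def)
    have deg: "d a = d b" if "a \<in> X - {x}" "b \<in> X - {x}" "\<rho> (var a) = \<rho> (var b)" for a b
      using less.prems(4) that by blast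
    obtain X' S'' where IH: "X' \<subseteq> X - {x}" "labelled_presentation True L X' S'' \<rho>" "relations_on X' d S''"
      "gs_bound X' d S'' z" "inj_on (\<lambda>x. \<rho> (var x)) X'"
      "(\<lambda>x. \<rho> (var x)) ` X' = (\<lambda>x. \<rho> (var x)) ` (X - {x})"
      using less.hyps[OF lt S' deg] by blast
    have "insert x (X - {x}) = X" using xy(1) by auto
    moreover have mem: "\<rho> (var x) \<in> (\<lambda>x. \<rho> (var x)) ` (X - {x})"
      using xy by (intro image_eqI[of _ _ y]) auto
    have "(\<lambda>x. \<rho> (var x)) ` insert x (X - {x}) = (\<lambda>x. \<rho> (var x)) ` (X - {x})"
      unfolding image_insert by (rule insert_absorb[OF mem])
    ultimately have img: "(\<lambda>x. \<rho> (var x)) ` X' = (\<lambda>x. \<rho> (var x)) ` X"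
      using IH(6) by simp
    have "X' \<subseteq> X" using IH(1) by auto
    thus ?thesis using IH(2-5) img by (intro exI[of _ X'] exI[of _ S''] conjI)
  qed
qed

text \<open>The required presentation has elements of \<open>L\<close> as its variables. Formal
  letters with distinct images can be renamed by these images, which changes neither the degrees of
  letters nor the bound.\<close>

lemma injective_labels_weak_golod_shafarevich:
  fixes L :: "('k::field, 'b) module" and S :: "('x list \<Rightarrow> 'k) set"
  assumes pres: "labelled_presentation c L X S \<rho>" and rel: "relations_on X d S"
    and z: "0 < z" "z \<le> 1" and b: "gs_bound X d S z"
    and inj: "inj_on (\<lambda>x. \<rho> (var x)) X" and e: "\<And>x. x \<in> X \<Longrightarrow> e (\<rho> (var x)) = d x"
  shows "weak_golod_shafarevich_wrt c L ((\<lambda>x. \<rho> (var x)) ` X) e"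
proof -
  define t where "t x = \<rho> (var x)" for x
  define s where "s = inv_into X t"
  let ?Y = "t ` X" and ?R = "free_map t X ` S" and ?\<pi> = "\<lambda>f. \<rho> (free_map s (t ` X) f)"
  have X: "finite X" using rel by (simp add: relations_on_def)
  have injt: "inj_on t X" using inj unfolding t_def .
  have et: "e (t x) = d x" if "x \<in> X" for x using e[OF that] by (simp add: t_def)
  have s: "s (t x) = x" if "x \<in> X" for x using that injt by (simp add: s_def)
  have P: "labelled_presentation c L ?Y ?R ?\<pi>" by (rule labelled_presentation_bij[where s = s and t = t, OF X pres s])
  have rel': "relations_on ?Y e ?R"
    using relations_on_image[where X = X and d = d and e = e and t = t and U = S, OF rel et] by simp
  have b': "gs_bound ?Y e ?R z"
    using gs_bound_image[where X = X and d = d and e = e and t = t, OF rel et injt z b] .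
  have R: "?R \<subseteq> carrier (free_algebra c ?Y)" using P by (simp add: labelled_presentation_def)
  have Y: "finite ?Y" using X by simp
  have varF: "var x \<in> carrier (free_algebra c X)" if "x \<in> X" for x using that by (auto simp: var_eq_wmon)
  have sub: "?Y \<subseteq> carrier L" using pres varF unfolding t_def labelled_presentation_def by blast
  have "presentation c L ?Y ?R ?\<pi>"
    unfolding presentation_def
  proof (intro conjI ballI)
    show "?\<pi> (var y) = y" if "y \<in> ?Y" for y
    proof -
      obtain x where x: "x \<in> X" "y = t x" using \<open>y \<in> ?Y\<close> by auto
      have "free_map s ?Y (var y) = (var x :: 'x list \<Rightarrow> 'k)"
        using x s that free_map_wmon[OF Y, of "[y]" s] by (simp add: var_eq_wmon)
      thus ?thesis using x by (simp add: t_def)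
    qed
    show "a_kernel (free_algebra c ?Y) L ?\<pi> = relation_ideal c ?Y ?R"
      unfolding relation_ideal_eq[OF Y R] a_kernel_def'
      using labelled_presentation_kernel[OF P] rel_ideal_carrier[of _ c ?Y ?R] by blast
  qed (use Y sub R rel' P in \<open>auto simp: relations_on_def labelled_presentation_def\<close>)
  moreover have "discrete_set e ?R" by (rule gs_bound_discrete[OF b' z])
  ultimately have "graded_presentation c L ?Y e ?R ?\<pi>"
    using rel' by (simp add: graded_presentation_def relations_on_def)
  moreover have "weak_golod_shafarevich ?Y e ?R"
    unfolding weak_gs_iff using b' z by (intro bexI[of _ z]) auto
  ultimately show ?thesis unfolding weak_golod_shafarevich_wrt_def t_def by blast
qed

section \<open>Direct systems\<close>

lemma alg_hom_comp:
  "h \<in> alg_hom A B \<Longrightarrow> g \<in> alg_hom B C \<Longrightarrow> (\<lambda>x. g (h x)) \<in> alg_hom A C"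
  by (auto simp: alg_hom_def Ring.ring_hom_def Pi_iff)

lemma alg_hom_zero:
  assumes "ring A" "ring B" "h \<in> alg_hom A B"
  shows "h \<zero>\<^bsub>A\<^esub> = \<zero>\<^bsub>B\<^esub>"
  using assms by (intro ring_hom_zero) (auto simp: alg_hom_def)

lemma word_ideal_mono_nonzero:
  assumes "S - {0} \<subseteq> T"
  shows "word_ideal X S \<subseteq> word_ideal X T"
proof (rule word_ideal_minimal[OF subspace_word_ideal])
  fix u v s assume *: "u \<in> lists X" "v \<in> lists X" "s \<in> S"
  show "conv (wmon u) (conv s (wmon v)) \<in> word_ideal X T"
  proof (cases "s = 0")
    case True
    thus ?thesis using fv.subspace_0[OF subspace_word_ideal] by simp
  next
    case False
    thus ?thesis using * assms by (intro word_idealI) auto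
  qed
qed

text \<open>Finitely many relations are involved in an element, and up to zero relations they lie in
  one stage.\<close>

lemma word_ideal_Union:
  fixes S :: "nat \<Rightarrow> ('x list \<Rightarrow> 'k::field) set"
  assumes "\<And>k. S k - {0} \<subseteq> S (Suc k)" "g \<in> word_ideal X (\<Union>k. S k)"
  shows "\<exists>k. g \<in> word_ideal X (S k)"
proof -
  have mono: "word_ideal X (S m) \<subseteq> word_ideal X (S n)" if "m \<le> n" for m n
    using that word_ideal_mono_nonzero[OF assms(1)] by (induction n rule: dec_induct) blast+
  have "fv.subspace (\<Union>k. word_ideal X (S k))"
    unfolding fv.subspace_def
  proof (intro conjI ballI allI)
    show "0 \<in> (\<Union>k. word_ideal X (S k))" using fv.subspace_0[OF subspace_word_ideal] by blast
  next
    fix f g assume "f \<in> (\<Union>k. word_ideal X (S k))" "g \<in> (\<Union>k. word_ideal X (S k))"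
    then obtain m n where mn: "f \<in> word_ideal X (S m)" "g \<in> word_ideal X (S n)" by blast
    have "f \<in> word_ideal X (S (max m n))" "g \<in> word_ideal X (S (max m n))"
      using mn mono[of m "max m n"] mono[of n "max m n"] by auto
    thus "f + g \<in> (\<Union>k. word_ideal X (S k))" using fv.subspace_add[OF subspace_word_ideal] by blast
  next
    fix c f assume "f \<in> (\<Union>k. word_ideal X (S k))"
    thus "(\<lambda>w. c * f w) \<in> (\<Union>k. word_ideal X (S k))"
      using fv.subspace_scale[OF subspace_word_ideal] by blast
  qed
  hence "word_ideal X (\<Union>k. S k) \<subseteq> (\<Union>k. word_ideal X (S k))"
    by (rule word_ideal_minimal) (blast intro: word_idealI)
  thus ?thesis using assms(2) by blast
qed

lemma transition_add:
  "transition \<phi> n (j + k) x = transition \<phi> (n + j) k (transition \<phi> n j x)"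
  by (induction k) (simp_all add: add.assoc)

section \<open>Stages and transition maps\<close>

locale gs_direct_system =
  fixes completed :: bool
    and A :: "nat \<Rightarrow> ('k::field, 'a) module"
    and \<phi> :: "nat \<Rightarrow> 'a \<Rightarrow> 'a"
    and X :: "nat \<Rightarrow> 'a set"
    and deg :: "nat \<Rightarrow> 'a \<Rightarrow> real"
    and R :: "nat \<Rightarrow> ('a list \<Rightarrow> 'k) set"
    and \<pi> :: "nat \<Rightarrow> ('a list \<Rightarrow> 'k) \<Rightarrow> 'a"
    and L :: "('k, 'b) module"
    and \<psi> :: "nat \<Rightarrow> 'a \<Rightarrow> 'b"
  assumes kalgebra_A: "\<And>n. kalgebra (A n)"
    and \<phi>_hom: "\<And>n. \<phi> n \<in> alg_hom (A n) (A (Suc n))"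
    and \<phi>_onto: "\<And>n. \<phi> n ` carrier (A n) = carrier (A (Suc n))"
    and pres: "\<And>n. graded_presentation completed (A n) (X n) (deg n) (R n) (\<pi> n)"
    and compat: "\<And>n. compatible (\<phi> n) (X n) (deg n) (R n) (X (Suc n)) (deg (Suc n)) (R (Suc n))"
    and wgs: "\<And>n. weak_golod_shafarevich (X n) (deg n) (R n)"
    and limit: "if completed then completed_direct_limit A \<phi> X \<pi> L \<psi> else direct_limit A \<phi> L \<psi>"
begin

abbreviation F :: "nat \<Rightarrow> ('a list \<Rightarrow> 'k) set" where
  "F n \<equiv> carrier (free_algebra completed (X n))"

lemma ring_A: "ring (A n)"
  using kalgebra_A by (simp add: kalgebra_def)

lemma cocone: "alg_cocone A \<phi> L \<psi>"
  using limit by (auto simp: completed_direct_limit_def direct_limit_def split: if_splits)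

lemma direct_limit_eqD:
  "\<not> completed \<Longrightarrow> \<psi> n a = \<psi> n b \<Longrightarrow> a \<in> carrier (A n) \<Longrightarrow> b \<in> carrier (A n) \<Longrightarrow>
    \<exists>k. transition \<phi> n k a = transition \<phi> n k b"
  using limit by (simp add: direct_limit_def)

lemma kalgebra_L: "kalgebra L"
  using cocone by (simp add: alg_cocone_def)

lemma ring_L: "ring L"
  using kalgebra_L by (simp add: kalgebra_def)

lemma \<psi>_hom: "\<psi> n \<in> alg_hom (A n) L"
  using cocone by (simp add: alg_cocone_def)

lemma \<psi>_zero: "\<psi> n \<zero>\<^bsub>A n\<^esub> = \<zero>\<^bsub>L\<^esub>"
  by (rule alg_hom_zero[OF ring_A ring_L \<psi>_hom])

lemma transition_hom: "transition \<phi> n k \<in> alg_hom (A n) (A (n + k))"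
proof (induction k)
  case 0
  show ?case by (simp add: alg_hom_def Ring.ring_hom_def)
next
  case (Suc k)
  show ?case using alg_hom_comp[OF Suc \<phi>_hom] by (simp add: comp_def)
qed

lemma transition_zero: "transition \<phi> n k \<zero>\<^bsub>A n\<^esub> = \<zero>\<^bsub>A (n + k)\<^esub>"
  by (rule alg_hom_zero[OF ring_A ring_A transition_hom])

lemma transition_onto: "transition \<phi> n k ` carrier (A n) = carrier (A (n + k))"
  by (induction k) (simp_all add: \<phi>_onto flip: image_image add: comp_def image_comp)

lemma transition_X: "transition \<phi> n k ` X n = X (n + k)"
proof (induction k)
  case (Suc k)
  have "transition \<phi> n (Suc k) ` X n = \<phi> (n + k) ` transition \<phi> n k ` X n" by (simp add: image_comp)
  thus ?case using compat[of "n + k"] Suc by (simp add: compatible_def)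
qed simp

lemma transition_deg: "x \<in> X n \<Longrightarrow> deg (n + k) (transition \<phi> n k x) = deg n x"
proof (induction k)
  case (Suc k)
  have "transition \<phi> n k x \<in> X (n + k)" using Suc.prems transition_X[of n k] by blast
  thus ?case using compat[of "n + k"] Suc by (simp add: compatible_def)
qed simp

lemma \<psi>_transition: "a \<in> carrier (A n) \<Longrightarrow> \<psi> (n + k) (transition \<phi> n k a) = \<psi> n a"
proof (induction k)
  case (Suc k)
  have "transition \<phi> n k a \<in> carrier (A (n + k))" using Suc.prems transition_onto[of n k] by blast
  thus ?case using cocone Suc by (simp add: alg_cocone_def)
qed simp

lemma X_carrier: "X n \<subseteq> carrier (A n)"
  using pres[of n] by (simp add: graded_presentation_def presentation_def)

lemma finite_X: "finite (X n)"
  using pres[of n] by (simp add: graded_presentation_def presentation_def)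

lemma R_carrier: "R n \<subseteq> F n"
  using pres[of n] by (simp add: graded_presentation_def presentation_def)

lemma \<pi>_hom: "\<pi> n \<in> alg_hom (free_algebra completed (X n)) (A n)"
  using pres[of n] by (simp add: graded_presentation_def presentation_def)

lemma \<pi>_onto: "\<pi> n ` F n = carrier (A n)"
  using pres[of n] by (simp add: graded_presentation_def presentation_def)

lemma \<pi>_var: "x \<in> X n \<Longrightarrow> \<pi> n (var x) = x"
  using pres[of n] by (simp add: graded_presentation_def presentation_def)

lemma labelled: "labelled_presentation completed (A n) (X n) (R n) (\<pi> n)"
  unfolding labelled_presentation_def
proof (intro conjI ballI)
  fix f assume f: "f \<in> F n"
  have "a_kernel (free_algebra completed (X n)) (A n) (\<pi> n) = rel_ideal completed (X n) (R n)"
    using pres[of n] relation_ideal_eq[OF finite_X R_carrier, of n]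
    by (simp add: graded_presentation_def presentation_def)
  thus "\<pi> n f = \<zero>\<^bsub>A n\<^esub> \<longleftrightarrow> f \<in> rel_ideal completed (X n) (R n)"
    using f unfolding a_kernel_def' by blast
qed (simp_all add: R_carrier \<pi>_hom \<pi>_onto)

lemma relations: "relations_on (X n) (deg n) (R n)"
proof -
  have "R n \<subseteq> carrier (free_algebra True (X n))" using R_carrier[of n] carrier_True by blast
  thus ?thesis using pres[of n] by (simp add: graded_presentation_def presentation_def relations_on_def)
qed

text \<open>Both sides are homomorphisms with the same values on variables; in the completed case
  this determines them by automatic continuity.\<close>

lemma transition_\<pi>:
  assumes "f \<in> F n"
  shows "transition \<phi> n k (\<pi> n f) = \<pi> (n + k) (free_map (transition \<phi> n k) (X n) f)"
proof (rule labelled_presentation_hom_eq[OF ring_A labelled alg_hom_comp[OF \<pi>_hom transition_hom] finite_X finite_X _ _ assms])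
  show "transition \<phi> n k ` X n \<subseteq> X (n + k)" by (simp add: transition_X)
  show "transition \<phi> n k (\<pi> n (var x)) = \<pi> (n + k) (var (transition \<phi> n k x))" if "x \<in> X n" for x
    using that transition_X[of n k] by (subst \<pi>_var[of "transition \<phi> n k x"]) (auto simp: \<pi>_var)
qed

text \<open>Letters map onto letters, so their number never increases; from a stage where it is
  minimal, no later map can identify two of them.\<close>

lemma stable_index: obtains N where "\<And>k. inj_on (transition \<phi> N k) (X N)"
proof -
  obtain N where N: "\<And>n. card (X N) \<le> card (X n)"
    using ex_has_least_nat[of "\<lambda>_. True" 0 "\<lambda>n. card (X n)"] by blast
  have "inj_on (transition \<phi> N k) (X N)" for k
  proof (rule eq_card_imp_inj_on[OF finite_X])
    show "card (transition \<phi> N k ` X N) = card (X N)"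
      using N[of "N + k"] card_image_le[OF finite_X, of "transition \<phi> N k" N] by (simp add: transition_X)
  qed
  thus ?thesis using that by blast
qed

lemma \<psi>_X: "\<psi> n ` X n = \<psi> 0 ` X 0"
proof -
  have "\<psi> n ` X n = (\<lambda>x. \<psi> (0 + n) (transition \<phi> 0 n x)) ` X 0"
    using transition_X[of 0 n] by (simp flip: image_image)
  also have "\<dots> = \<psi> 0 ` X 0" using X_carrier[of 0] \<psi>_transition[of _ 0 n] by (intro image_cong) auto
  finally show ?thesis .
qed

end

section \<open>Relations pulled back to a stage with stable letters\<close>

locale stable_gs_direct_system = gs_direct_system completed A \<phi> X deg R \<pi> L \<psi>
  for completed :: bool
    and A :: "nat \<Rightarrow> ('k::field, 'a) module"
    and \<phi> :: "nat \<Rightarrow> 'a \<Rightarrow> 'a"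
    and X :: "nat \<Rightarrow> 'a set"
    and deg :: "nat \<Rightarrow> 'a \<Rightarrow> real"
    and R :: "nat \<Rightarrow> ('a list \<Rightarrow> 'k) set"
    and \<pi> :: "nat \<Rightarrow> ('a list \<Rightarrow> 'k) \<Rightarrow> 'a"
    and L :: "('k, 'b) module"
    and \<psi> :: "nat \<Rightarrow> 'a \<Rightarrow> 'b" +
  fixes N :: nat
  assumes stable: "\<And>k. inj_on (transition \<phi> N k) (X N)"
begin

definition pull :: "nat \<Rightarrow> 'a \<Rightarrow> 'a" where
  "pull k = inv_into (X N) (transition \<phi> N k)"

definition S :: "nat \<Rightarrow> ('a list \<Rightarrow> 'k) set" where
  "S k = free_map (pull k) (X (N + k)) ` R (N + k)"

definition \<rho> :: "('a list \<Rightarrow> 'k) \<Rightarrow> 'b" where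
  "\<rho> f = \<psi> N (\<pi> N f)"

lemma pull_transition: "x \<in> X N \<Longrightarrow> pull k (transition \<phi> N k x) = x"
  unfolding pull_def by (rule inv_into_f_f[OF stable])

lemma transition_pull: "y \<in> X (N + k) \<Longrightarrow> transition \<phi> N k (pull k y) = y"
  unfolding pull_def using transition_X[of N k] by (intro f_inv_into_f) simp

lemma pull_X: "pull k ` X (N + k) = X N"
  unfolding transition_X[of N k, symmetric] image_image using pull_transition by simp

lemma deg_pull: "y \<in> X (N + k) \<Longrightarrow> deg N (pull k y) = deg (N + k) y"
  using transition_deg[of "pull k y" N k] subsetD[OF equalityD1[OF pull_X], of "pull k y" k] transition_pull[of y k]
  by simp

lemma relations_S: "relations_on (X N) (deg N) (S k)"
  using relations_on_image[where t = "pull k" and e = "deg N", OF relations deg_pull subset_refl]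
  by (simp add: pull_X S_def)

lemma S_carrier: "S k \<subseteq> F N"
  unfolding S_def using R_carrier[of "N + k"] free_map_closed[of _ completed "X (N + k)" "pull k" "X N"] pull_X[of k]
  by blast

text \<open>Renaming the given presentation of \<open>A (N + k)\<close> by the letters
  \<open>X N\<close> turns its relations into \<open>S k\<close> and its quotient map into \<pi> N
  followed by the transition map.\<close>

lemma kernel_S: "f \<in> F N \<Longrightarrow> transition \<phi> N k (\<pi> N f) = \<zero>\<^bsub>A (N + k)\<^esub> \<longleftrightarrow> f \<in> rel_ideal completed (X N) (S k)"
  using labelled_presentation_kernel[OF labelled_presentation_bij[where t = "pull k" and s = "transition \<phi> N k" and X = "X (N + k)",
      OF finite_X labelled transition_pull], where f = f]
  by (simp add: pull_X S_def transition_\<pi>)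

text \<open>Pulling a relation back directly, or pushing it to the next stage and pulling back from
  there, gives the same result. If this is nonzero, so is the pushed relation, and compatibility
  applies to it.\<close>

lemma S_mono: "S k - {0} \<subseteq> S (Suc k)"
proof
  fix r' assume r': "r' \<in> S k - {0}"
  then obtain r where r: "r \<in> R (N + k)" "r' = free_map (pull k) (X (N + k)) r" by (auto simp: S_def)
  let ?q = "free_map (\<phi> (N + k)) (X (N + k)) r"
  have "pull (Suc k) (\<phi> (N + k) y) = pull k y" if y: "y \<in> X (N + k)" for y
  proof -
    have "pull k y \<in> X N" using y pull_X[of k] by blast
    thus ?thesis using pull_transition[of "pull k y" "Suc k"] transition_pull[OF y] by simp
  qed
  moreover have "\<phi> (N + k) ` X (N + k) \<subseteq> X (N + Suc k)"
    using compat[of "N + k"] by (simp add: compatible_def)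
  ultimately have q: "free_map (pull (Suc k)) (X (N + Suc k)) ?q = r'"
    unfolding r(2) by (subst free_map_comp[OF finite_X finite_X]) (auto intro: free_map_cong)
  have "?q \<noteq> 0"
  proof
    assume "?q = 0"
    hence "r' = 0" using q by (simp only: linD(3)[OF lin_free_map])
    thus False using r' by blast
  qed
  hence "?q \<in> R (N + Suc k)"
    using compat[of "N + k"] r(1) unfolding compatible_def zero_fun_def by auto
  thus "r' \<in> S (Suc k)" using q unfolding S_def by blast
qed

lemma S_mono_le: "m \<le> n \<Longrightarrow> S m - {0} \<subseteq> S n"
proof (induction n rule: dec_induct)
  case (step n)
  thus ?case using S_mono[of n] by blast
qed auto

lemma gs_bound_S:
  assumes "gs_bound (X (N + k)) (deg (N + k)) (R (N + k)) z" "0 < z" "z \<le> 1"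
  shows "gs_bound (X N) (deg N) (S k) z"
proof -
  have "inj_on (pull k) (X (N + k))" by (rule inj_on_inverseI[where g = "transition \<phi> N k", OF transition_pull])
  from gs_bound_image[where t = "pull k" and e = "deg N", OF relations deg_pull this assms(2,3,1)]
  show ?thesis by (simp add: pull_X S_def)
qed

lemma weak_gs_S: "\<exists>z\<in>{0..1}. gs_bound (X N) (deg N) (S k) z"
proof -
  obtain z where z: "z \<in> {0..1}" "gs_bound (X (N + k)) (deg (N + k)) (R (N + k)) z"
    using wgs[of "N + k"] by (auto simp: weak_gs_iff)
  thus ?thesis using gs_bound_S[OF z(2) gs_bound_pos[OF z(2)]] by auto
qed

lemma gs_bound_limit: obtains z where "0 < z" "z \<le> 1" "gs_bound (X N) (deg N) (\<Union>k. S k) z"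
  using gs_bound_Union[where S = S and X = "X N" and d = "deg N", OF relations_S S_mono weak_gs_S] by auto

lemma relations_limit: "relations_on (X N) (deg N) (\<Union>k. S k)"
  using relations_S by (auto simp: relations_on_def)

text \<open>If the only common parameter is \<open>1\<close>, then the sequence of relations is eventually constant up
  to zero relations, and the strict inequality of some stage provides a smaller one.\<close>

lemma gs_bound_limit_strict:
  assumes "finite {n. \<not> golod_shafarevich (X n) (deg n) (R n)}"
  obtains z where "0 < z" "z < 1" "gs_bound (X N) (deg N) (\<Union>k. S k) z"
proof -
  obtain z where z: "0 < z" "z \<le> 1" "gs_bound (X N) (deg N) (\<Union>k. S k) z"
    using gs_bound_limit by blast
  show ?thesis
  proof (cases "z = 1")
    case False
    thus ?thesis using that z by auto
  next
    case True
    hence fin: "finite ((\<Union>k. S k) - {0})"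
      using gs_bound_one_finite[OF relations_limit] z(3) by simp
    have "\<exists>k. T \<subseteq> S k" if "finite T" "T \<subseteq> (\<Union>k. S k) - {0}" for T
      using that
    proof (induction T rule: finite_induct)
      case (insert r T)
      obtain m where m: "T \<subseteq> S m" using insert by blast
      obtain n where n: "r \<in> S n" using insert.prems by blast
      have "insert r T \<subseteq> S (max m n)"
      proof
        fix s assume s: "s \<in> insert r T"
        hence "s \<in> S m - {0} \<or> s \<in> S n - {0}" using m n insert.prems by blast
        thus "s \<in> S (max m n)"
          using subsetD[OF S_mono_le[of m "max m n"], of s] subsetD[OF S_mono_le[of n "max m n"], of s] by auto
      qed
      thus ?case ..
    qed simp
    then obtain k0 where k0: "(\<Union>k. S k) - {0} \<subseteq> S k0" using fin by blast
    obtain m where m: "\<And>n. \<not> golod_shafarevich (X n) (deg n) (R n) \<Longrightarrow> n \<le> m"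
      using assms unfolding finite_nat_set_iff_bounded_le by blast
    \<comment> \<open>Beyond N, beyond the stage that contains all nonzero relations, and beyond
      every stage that fails to be Golod--Shafarevich.\<close>
    define n where "n = Suc (N + k0 + m)"
    have n: "N + k0 \<le> n" "golod_shafarevich (X n) (deg n) (R n)"
      using m[of n] by (auto simp: n_def)
    define k where "k = n - N"
    have k: "n = N + k" "k0 \<le> k" using n(1) by (auto simp: k_def)
    obtain y where y: "0 < y" "y < 1" "gs_bound (X n) (deg n) (R n) y"
      using golod_shafarevich_gs_bound[OF relations n(2)] by blast
    have "gs_bound (X N) (deg N) (S k) y" using gs_bound_S[of k y] y k(1) by simp
    moreover have "(\<Union>k. S k) - {0} \<subseteq> S k" using k0 S_mono_le[OF k(2)] by auto
    ultimately have "gs_bound (X N) (deg N) (\<Union>k. S k) y" by (rule gs_bound_mono)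
    thus ?thesis using that y by blast
  qed
qed

section \<open>The presentation of the limit\<close>

lemma \<rho>_hom: "\<rho> \<in> alg_hom (free_algebra completed (X N)) L"
  using alg_hom_comp[OF \<pi>_hom \<psi>_hom, of N] unfolding \<rho>_def[abs_def] .

lemma \<rho>_var: "x \<in> X N \<Longrightarrow> \<rho> (var x) = \<psi> N x"
  by (simp add: \<rho>_def \<pi>_var)

lemma \<pi>_closed: "f \<in> F n \<Longrightarrow> \<pi> n f \<in> carrier (A n)"
  using \<pi>_onto by blast

text \<open>An element coming from stage n is pushed to stage n + N and lifted back along the
  surjection from stage N.\<close>

lemma carrier_L: "carrier L = \<psi> N ` carrier (A N)"
proof (cases completed)
  case True
  hence "carrier L = \<psi> 0 ` carrier (A 0)" using limit by (simp add: completed_direct_limit_def)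
  also have "\<dots> = (\<lambda>a. \<psi> (0 + N) (transition \<phi> 0 N a)) ` carrier (A 0)"
    using \<psi>_transition[of _ 0 N] by (intro image_cong) auto
  also have "\<dots> = \<psi> N ` carrier (A N)" using transition_onto[of 0 N] by (simp flip: image_image)
  finally show ?thesis .
next
  case False
  hence eq: "carrier L = (\<Union>n. \<psi> n ` carrier (A n))" using limit by (simp add: direct_limit_def)
  show ?thesis
  proof
    show "carrier L \<subseteq> \<psi> N ` carrier (A N)"
      unfolding eq
    proof clarify
      fix n a assume a: "a \<in> carrier (A n)"
      have "transition \<phi> n N a \<in> carrier (A (n + N))" using a transition_onto[of n N] by blast
      hence "transition \<phi> n N a \<in> transition \<phi> N n ` carrier (A N)"
        using transition_onto[of N n] by (simp add: add.commute)
      then obtain b where b: "b \<in> carrier (A N)" "transition \<phi> n N a = transition \<phi> N n b" by blast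
      have "\<psi> n a = \<psi> N b"
        using \<psi>_transition[OF a, of N] \<psi>_transition[OF b(1), of n] b(2) by (simp add: add.commute)
      thus "\<psi> n a \<in> \<psi> N ` carrier (A N)" using b(1) by simp
    qed
  qed (use eq in blast)
qed

text \<open>The limit is described on the letters of stage 0, some of which may be identified on the
  way to stage N. The letter map and its section \<sigma> move approximations back and forth;
  agreement on short words survives because relabelling preserves length.\<close>

lemma kernel_completed:
  assumes completed and f: "f \<in> F N"
  shows "\<rho> f = \<zero>\<^bsub>L\<^esub> \<longleftrightarrow> f \<in> rel_ideal True (X N) (\<Union>k. S k)"
proof -
  define t where "t = transition \<phi> 0 N"
  define \<sigma> where "\<sigma> = inv_into (X 0) t"
  let ?p = "free_map t (X 0)" and ?s = "free_map \<sigma> (X N)"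
  have tX: "t ` X 0 = X N" using transition_X[of 0 N] by (simp add: t_def)
  have \<sigma>: "t (\<sigma> x) = x" "\<sigma> x \<in> X 0" if "x \<in> X N" for x
    using that tX by (auto simp: \<sigma>_def f_inv_into_f inv_into_into)
  have \<sigma>X: "\<sigma> ` X N \<subseteq> X 0" using \<sigma>(2) by auto
  have p: "g \<in> F 0 \<Longrightarrow> ?p g \<in> F N" for g by (rule free_map_closed) (simp_all add: tX)
  have s: "g \<in> F N \<Longrightarrow> ?s g \<in> F 0" for g by (rule free_map_closed[OF _ \<sigma>X])
  have ps: "?p (?s g) = g" if "g \<in> F N" for g
    by (subst free_map_comp[OF finite_X finite_X \<sigma>X]) (auto intro: free_map_ident[OF that] simp: \<sigma> finite_X)
  have t\<pi>: "t (\<pi> 0 g) = \<pi> N (?p g)" if "g \<in> F 0" for g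
    using transition_\<pi>[OF that, of N] by (simp add: t_def)
  have \<rho>s: "\<rho> g = \<psi> 0 (\<pi> 0 (?s g))" if g: "g \<in> F N" for g
    using t\<pi>[OF s[OF g]] ps[OF g] \<psi>_transition[OF \<pi>_closed[OF s[OF g]], of N] by (simp add: \<rho>_def t_def)
  let ?K = "\<Union>n. {g \<in> F 0. transition \<phi> 0 n (\<pi> 0 g) = \<zero>\<^bsub>A n\<^esub>}"
  have K: "\<psi> 0 (\<pi> 0 g) = \<zero>\<^bsub>L\<^esub> \<longleftrightarrow> (\<forall>M. \<exists>g'\<in>?K. agree M g g')" if g: "g \<in> F 0" for g
  proof -
    have "a_kernel (free_algebra True (X 0)) L (\<psi> 0 \<circ> \<pi> 0) = coeff_topology (X 0) closure_of ?K"
      using limit assms(1) unfolding completed_direct_limit_def a_kernel_def' by simp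
    also have "\<dots> = {f \<in> F 0. \<forall>M. \<exists>g'\<in>?K. agree M f g'}"
      using closure_of_coeff_topology[OF finite_X, of ?K 0] assms(1) by auto
    finally show ?thesis using g assms(1) unfolding a_kernel_def' by auto
  qed
  have split: "transition \<phi> 0 (N + k) a = transition \<phi> N k (t a)" for k a
    using transition_add[of \<phi> 0 N k a] by (simp add: t_def)
  show ?thesis
  proof
    assume "\<rho> f = \<zero>\<^bsub>L\<^esub>"
    hence 0: "\<forall>M. \<exists>g'\<in>?K. agree M (?s f) g'" using K[OF s[OF f]] \<rho>s[OF f] by simp
    have "\<exists>h\<in>word_ideal (X N) (\<Union>k. S k). agree M f h" for M
    proof -
      obtain n g' where g': "g' \<in> F 0" "transition \<phi> 0 n (\<pi> 0 g') = \<zero>\<^bsub>A n\<^esub>" "agree M (?s f) g'"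
        using 0 by blast
      \<comment> \<open>The index n may be smaller than N; at stage n + N the path from stage 0
        passes through both.\<close>
      have "transition \<phi> N n (\<pi> N (?p g')) = transition \<phi> 0 (n + N) (\<pi> 0 g')"
        using split[of n "\<pi> 0 g'"] t\<pi>[OF g'(1)] by (simp add: add.commute)
      also have "\<dots> = \<zero>\<^bsub>A (N + n)\<^esub>"
        using transition_add[of \<phi> 0 n N "\<pi> 0 g'"] g'(2) transition_zero[of n N] by (simp add: add.commute)
      finally have "?p g' \<in> rel_ideal completed (X N) (S n)" using kernel_S p[OF g'(1)] by blast
      then obtain h where h: "h \<in> word_ideal (X N) (S n)" "agree M (?p g') h" using rel_ideal_agree by blast
      have "agree M f (?p g')" using free_map_agree[OF g'(3), of t "X 0"] ps[OF f] by simp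
      hence "agree M f h" using h(2) agree_trans by blast
      moreover have "h \<in> word_ideal (X N) (\<Union>k. S k)"
        using h(1) word_ideal_mono[of "S n" "\<Union>k. S k" "X N"] by blast
      ultimately show ?thesis by blast
    qed
    thus "f \<in> rel_ideal True (X N) (\<Union>k. S k)" using f assms(1) by (simp add: rel_ideal_def)
  next
    assume fI: "f \<in> rel_ideal True (X N) (\<Union>k. S k)"
    have "\<exists>g'\<in>?K. agree M (?s f) g'" for M
    proof -
      obtain h where h: "h \<in> word_ideal (X N) (\<Union>k. S k)" "agree M f h" using rel_ideal_agree[OF fI] by blast
      \<comment> \<open>Each approximation uses finitely many relations, hence a single stage,
        although \<open>f\<close> itself need not vanish at any stage.\<close>
      obtain k where k: "h \<in> word_ideal (X N) (S k)" using word_ideal_Union[where S = S, OF S_mono h(1)] by blast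
      have hI: "h \<in> rel_ideal completed (X N) (S k)"
        using word_ideal_subset_rel_ideal[OF S_carrier] k by blast
      have hF: "h \<in> F N" by (rule rel_ideal_carrier[OF hI])
      have "transition \<phi> N k (\<pi> N h) = \<zero>\<^bsub>A (N + k)\<^esub>" using kernel_S[OF hF] hI by simp
      hence "transition \<phi> 0 (N + k) (\<pi> 0 (?s h)) = \<zero>\<^bsub>A (N + k)\<^esub>"
        using split[of k] t\<pi>[OF s[OF hF]] ps[OF hF] by simp
      hence "?s h \<in> ?K" using s[OF hF] by blast
      thus ?thesis using free_map_agree[OF h(2)] by blast
    qed
    thus "\<rho> f = \<zero>\<^bsub>L\<^esub>" using K[OF s[OF f]] \<rho>s[OF f] by simp
  qed
qed

lemma kernel_uncompleted:
  assumes "\<not> completed" and f: "f \<in> F N"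
  shows "\<rho> f = \<zero>\<^bsub>L\<^esub> \<longleftrightarrow> f \<in> rel_ideal False (X N) (\<Union>k. S k)"
proof
  assume "\<rho> f = \<zero>\<^bsub>L\<^esub>"
  hence "\<psi> N (\<pi> N f) = \<psi> N \<zero>\<^bsub>A N\<^esub>" by (simp add: \<rho>_def \<psi>_zero)
  moreover have "\<zero>\<^bsub>A N\<^esub> \<in> carrier (A N)" using ring_A[of N] by (simp add: ring.ring_simprules)
  ultimately obtain k where "transition \<phi> N k (\<pi> N f) = transition \<phi> N k \<zero>\<^bsub>A N\<^esub>"
    using direct_limit_eqD[OF assms(1) _ \<pi>_closed[OF f]] by blast
  hence "f \<in> rel_ideal completed (X N) (S k)" using kernel_S[OF f, of k] by (simp add: transition_zero)
  moreover have "word_ideal (X N) (S k) \<subseteq> word_ideal (X N) (\<Union>k. S k)" by (rule word_ideal_mono) auto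
  ultimately show "f \<in> rel_ideal False (X N) (\<Union>k. S k)" using assms(1) by (auto simp: rel_ideal_def)
next
  assume "f \<in> rel_ideal False (X N) (\<Union>k. S k)"
  hence "f \<in> word_ideal (X N) (\<Union>k. S k)" by (simp add: rel_ideal_def)
  then obtain k where "f \<in> word_ideal (X N) (S k)" using word_ideal_Union[where S = S, OF S_mono] by blast
  hence "f \<in> rel_ideal completed (X N) (S k)" using word_ideal_subset_rel_ideal[OF S_carrier] by blast
  hence "transition \<phi> N k (\<pi> N f) = \<zero>\<^bsub>A (N + k)\<^esub>" using kernel_S[OF f] by simp
  thus "\<rho> f = \<zero>\<^bsub>L\<^esub>" using \<psi>_transition[OF \<pi>_closed[OF f], of k] by (simp add: \<rho>_def \<psi>_zero)
qed

lemma limit_presentation: "labelled_presentation completed L (X N) (\<Union>k. S k) \<rho>"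
  unfolding labelled_presentation_def
proof (intro conjI ballI)
  show "(\<Union>k. S k) \<subseteq> F N" using S_carrier by blast
  show "\<rho> \<in> alg_hom (free_algebra completed (X N)) L" by (rule \<rho>_hom)
  show "\<rho> ` F N = carrier L"
    unfolding carrier_L \<pi>_onto[symmetric] image_image \<rho>_def ..
  show "\<rho> f = \<zero>\<^bsub>L\<^esub> \<longleftrightarrow> f \<in> rel_ideal completed (X N) (\<Union>k. S k)" if "f \<in> F N" for f
    using kernel_completed[OF _ that] kernel_uncompleted[OF _ that] by (cases completed) simp_all
qed

lemma \<rho>_image: "(\<lambda>x. \<rho> (var x)) ` X N = \<psi> 0 ` X 0"
  using \<psi>_X[of N] \<rho>_var by simp

lemma limit_exponential_growth:
  assumes "finite {n. \<not> golod_shafarevich (X n) (deg n) (R n)}"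
  shows "exponential_growth L (\<psi> 0 ` X 0)"
proof -
  obtain z where z: "0 < z" "z < 1" "gs_bound (X N) (deg N) (\<Union>k. S k) z"
    using gs_bound_limit_strict[OF assms] by blast
  show ?thesis
    using labelled_presentation_exponential_growth[OF kalgebra_L limit_presentation relations_limit z]
    by (simp only: \<rho>_image)
qed

lemma limit_weak_golod_shafarevich:
  assumes e: "\<And>n x. x \<in> X n \<Longrightarrow> e (\<psi> n x) = deg n x"
  shows "weak_golod_shafarevich_wrt completed L (\<psi> 0 ` X 0) e"
proof -
  obtain z where z: "0 < z" "z \<le> 1" "gs_bound (X N) (deg N) (\<Union>k. S k) z"
    using gs_bound_limit by blast
  have e\<rho>: "e (\<rho> (var x)) = deg N x" if "x \<in> X N" for x using e[OF that] \<rho>_var[OF that] by simp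
  show ?thesis
  proof (cases completed)
    case True
    \<comment> \<open>The induced degree function lives on the images, so letters that the closure
      identifies have equal degrees and may be merged.\<close>
    have "deg N x = deg N y" if "x \<in> X N" "y \<in> X N" "\<rho> (var x) = \<rho> (var y)" for x y
      using e\<rho>[OF that(1)] e\<rho>[OF that(2)] that(3) by simp
    from merge_all_letters[OF ring_L z(1,2) limit_presentation[unfolded eqTrueI[OF True]] relations_limit z(3) this]
    obtain X' S' where X': "X' \<subseteq> X N" "labelled_presentation True L X' S' \<rho>" "relations_on X' (deg N) S'"
      "gs_bound X' (deg N) S' z" "inj_on (\<lambda>x. \<rho> (var x)) X'"
      "(\<lambda>x. \<rho> (var x)) ` X' = (\<lambda>x. \<rho> (var x)) ` X N" by blast
    have "e (\<rho> (var x)) = deg N x" if "x \<in> X'" for x using e\<rho> X'(1) that by blast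
    from injective_labels_weak_golod_shafarevich[where e = e, OF X'(2,3) z(1,2) X'(4,5) this]
    show ?thesis using True by (simp add: X'(6) \<rho>_image)
  next
    case False
    \<comment> \<open>In the ordinary limit equality occurs at a finite stage, and from N on letters
      stay distinct.\<close>
    have "inj_on (\<lambda>x. \<rho> (var x)) (X N)"
    proof (rule inj_onI)
      fix x y assume xy: "x \<in> X N" "y \<in> X N" "\<rho> (var x) = \<rho> (var y)"
      hence "\<psi> N x = \<psi> N y" by (simp add: \<rho>_var)
      then obtain k where "transition \<phi> N k x = transition \<phi> N k y"
        using direct_limit_eqD[OF False] subsetD[OF X_carrier] xy(1,2) by blast
      thus "x = y" using stable[of k] xy by (auto dest: inj_onD)
    qed
    from injective_labels_weak_golod_shafarevich[where e = e, OF limit_presentation relations_limit z this e\<rho>]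
    show ?thesis by (simp add: \<rho>_image)
  qed
qed

end

text \<open>Letters with the same image become equal at a finite stage, and degrees are preserved up
  to there, so the degree depends on the image alone. In the completed case equality in the limit is
  only approximate equality at finite stages, and this argument does not apply.\<close>

lemma (in gs_direct_system) induced_degree:
  assumes "\<not> completed"
  shows "\<exists>e. \<forall>n. \<forall>x\<in>X n. e (\<psi> n x) = deg n x"
proof -
  have eq: "deg m x = deg n y" if xy: "x \<in> X m" "y \<in> X n" "\<psi> m x = \<psi> n y" for m n x y
  proof -
    let ?x = "transition \<phi> m n x" and ?y = "transition \<phi> n m y"
    have x: "?x \<in> X (m + n)" using xy(1) transition_X[of m n] by blast
    have y: "?y \<in> X (m + n)" using xy(2) transition_X[of n m] by (auto simp: add.commute)
    have "\<psi> (m + n) ?x = \<psi> (m + n) ?y"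
      using \<psi>_transition[OF subsetD[OF X_carrier xy(1)], of n]
        \<psi>_transition[OF subsetD[OF X_carrier xy(2)], of m] xy(3) by (simp add: add.commute)
    then obtain k where k: "transition \<phi> (m + n) k ?x = transition \<phi> (m + n) k ?y"
      using direct_limit_eqD[OF assms _ subsetD[OF X_carrier x] subsetD[OF X_carrier y]] by blast
    have "deg m x = deg (m + n + k) (transition \<phi> (m + n) k ?x)"
      using transition_deg[OF x, of k] transition_deg[OF xy(1), of n] by simp
    also have "\<dots> = deg n y"
      unfolding k using transition_deg[OF y, of k] transition_deg[OF xy(2), of m] by (simp add: add.commute)
    finally show ?thesis .
  qed
  \<comment> \<open>An arbitrary pair of a stage and a letter over \<open>y\<close>; by
    \<open>eq\<close> the choice does not affect the degree.\<close>
  define p where "p y = (SOME p. snd p \<in> X (fst p) \<and> \<psi> (fst p) (snd p) = y)" for y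
  define e where "e y = deg (fst (p y)) (snd (p y))" for y
  have "e (\<psi> n x) = deg n x" if x: "x \<in> X n" for n x
  proof -
    have "snd (p (\<psi> n x)) \<in> X (fst (p (\<psi> n x))) \<and> \<psi> (fst (p (\<psi> n x))) (snd (p (\<psi> n x))) = \<psi> n x"
      unfolding p_def by (rule someI[of _ "(n, x)"]) (simp add: x)
    thus ?thesis using eq x unfolding e_def by blast
  qed
  thus ?thesis by blast
qed

theorem theorem1p6:
  fixes completed :: bool
    and A :: "nat \<Rightarrow> ('k::field, 'a) module"
    and \<phi> :: "nat \<Rightarrow> 'a \<Rightarrow> 'a"
    and X :: "nat \<Rightarrow> 'a set"
    and deg :: "nat \<Rightarrow> 'a \<Rightarrow> real"
    and R :: "nat \<Rightarrow> ('a list \<Rightarrow> 'k) set"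
    and \<pi> :: "nat \<Rightarrow> ('a list \<Rightarrow> 'k) \<Rightarrow> 'a"
    and L :: "('k, 'b) module"
    and \<psi> :: "nat \<Rightarrow> 'a \<Rightarrow> 'b"
  assumes "\<And>n. kalgebra (A n)"
    and "\<And>n. \<phi> n \<in> alg_hom (A n) (A (Suc n))"
    and "\<And>n. \<phi> n ` carrier (A n) = carrier (A (Suc n))"
    and "\<And>n. graded_presentation completed (A n) (X n) (deg n) (R n) (\<pi> n)"
    and "\<And>n. compatible (\<phi> n) (X n) (deg n) (R n) (X (Suc n)) (deg (Suc n)) (R (Suc n))"
    and "\<And>n. weak_golod_shafarevich (X n) (deg n) (R n)"
    and "if completed then completed_direct_limit A \<phi> X \<pi> L \<psi> else direct_limit A \<phi> L \<psi>"
  shows "(\<not> completed \<longrightarrow> (\<exists>e. \<forall>n. \<forall>x\<in>X n. e (\<psi> n x) = deg n x))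
    \<and> (\<forall>e. (\<forall>n. \<forall>x\<in>X n. e (\<psi> n x) = deg n x) \<longrightarrow>
           weak_golod_shafarevich_wrt completed L (\<psi> 0 ` X 0) e)
    \<and> (finite {n. \<not> golod_shafarevich (X n) (deg n) (R n)} \<longrightarrow>
         exponential_growth L (\<psi> 0 ` X 0))"
proof -
  interpret gs_direct_system completed A \<phi> X deg R \<pi> L \<psi>
    by (rule gs_direct_system.intro) (fact assms)+
  obtain N where N: "\<And>k. inj_on (transition \<phi> N k) (X N)" using stable_index by blast
  interpret stable_gs_direct_system completed A \<phi> X deg R \<pi> L \<psi> N
    by unfold_locales (rule N)
  show ?thesis
    using induced_degree limit_weak_golod_shafarevich limit_exponential_growth by blast
qed

end
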